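(* Let $\mathcal F$ be a saturated fusion system on a finite $p$-group $S$, let $\mathcal F_S:=\mathcal F_S(S)$ be the trivial fusion system on $S$, and let $\beta_{\Delta(S)}\in A(S,S)_{(p)}\cong A(S\times S)_{(p)}$ be the stabilization, with respect to the product fusion system $\mathcal F\times\mathcal F_S$ on $S\times S$, of the transitive $(S\times S)$-set $(S\times S)/\Delta(S)$, where $\Delta(S)=\{(s,s)\mid s\in S\}$. Then $\varepsilon(\beta_{\Delta(S)})=1$, and $\beta_{\Delta(S)}$ is a characteristic idempotent for $\mathcal F$, i.e. it is idempotent with respect to $\circ$ and $\mathcal F$-characteristic.
   Context: Here $p$ is a prime and $p$-groups are finite. A fusion system $\mathcal F$ on a $p$-group $S$ is a category whose objects are the subgroups of $S$, whose morphism sets $\mathcal F(P,Q)=\mathrm{Hom}_{\mathcal F}(P,Q)$ consist of injective group homomorphisms $P\to Q$ (composed as homomorphisms) and contain all homomorphisms $P\to Q$ induced by conjugation by elements of $S$, and such that for each $\varphi\in\mathcal F(P,Q)$ the isomorphism $\varphi\colon P\to\varphi P$ and its inverse are morphisms of $\mathcal F$. Write $\mathrm{Aut}_{\mathcal F}(P)=\mathcal F(P,P)$. Subgroups $P,Q$ are $\mathcal F$-conjugate if they are isomorphic in $\mathcal F$; $[P]_{\mathcal F}$ is the set of $\mathcal F$-conjugates of $P$. $P$ is fully $\mathcal F$-normalized (resp. fully $\mathcal F$-centralized) if $|N_SP|\ge|N_SQ|$ (resp. $|C_SP|\ge|C_SQ|$) for all $Q\in[P]_{\mathcal F}$. $\mathcal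 F$ is saturated if for all $P\le S$: (1) if $P$ is fully $\mathcal F$-normalized, then $P$ is fully $\mathcal F$-centralized and $\mathrm{Aut}_S(P)$ is a Sylow $p$-subgroup of $\mathrm{Aut}_{\mathcal F}(P)$; (2) every $\varphi\in\mathcal F(P,S)$ with $\varphi(P)$ fully $\mathcal F$-centralized extends to a morphism in $\mathcal F(N_\varphi,S)$, where $N_\varphi=\{x\in N_S(P)\mid \exists y\in S:\varphi\circ c_x=c_y\circ\varphi\}$. $\mathcal F_S(S)$ is the fusion system on $S$ whose morphisms are exactly the homomorphisms induced by $S$-conjugation. Product: for fusion systems $\mathcal F_i$ on $S_i$, $\mathcal F_2\times\mathcal F_1$ is the fusion system on $S_2\times S_1$ in which the morphisms $D\to C$ are the homomorphisms $D\to C$ that are restrictions to $D$ of $\varphi_2\times\varphi_1$ with $\varphi_i\in\mathcal F_i(D_i,S_i)$, $D_i$ being the projection of $D$ to $S_i$. Products of saturated fusion systems are saturated. Bisets: for finite groups $G,H$, a $(G,H)$-biset is a finite set with commuting right $G$-action and left $H$-action, regarded as a left $(H\times G)$-set via $(h,g).x=hxg^{-1}$. $A(G,H)$ is the Grothendieck group of isomorphism classes of $(G,H)$-bisets; additively $A(G,H)\cong A(H\times G)$. For $D\le H\times G$, $\Phi_D$ is the additive map counting $D$-fixed points. Composition $\circ\colon A(H,K)\times A(G,H)\to A(G,K)$ is induced by $Y\circ X=Y\times_HX$. For $U\le G$ and a homomorphism $\varphi\colon U\to H$, $\Delta(U,\varphi)=\{(\varphi(u),u)\mid u\in U\}$ and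 $[U,\varphi]_G^H=[(H\times G)/\Delta(U,\varphi)]$. The subscript $(p)$ denotes tensoring with $\mathbb Z_{(p)}$. Stabilization: $\beta_{\Delta(S)}$ is the (existing, unique) element of $A(S\times S)_{(p)}$ with $\Phi_D(\beta_{\Delta(S)})=\frac{1}{|[D]_{\mathcal F\times\mathcal F_S}|}\sum_{D'\in[D]_{\mathcal F\times\mathcal F_S}}\Phi_{D'}([(S\times S)/\Delta(S)])$ for all $D\le S\times S$. $X\in A(S,S)_{(p)}$ is $\mathcal F$-generated if it is a $\mathbb Z_{(p)}$-linear combination of elements $[P,\varphi]_S^S$ with $P\le S$, $\varphi\in\mathcal F(P,S)$. It is right $\mathcal F$-stable if $X\circ[P,\varphi]_P^S=X\circ[P,\mathrm{id}]_P^S$, and left $\mathcal F$-stable if $[\varphi P,\varphi^{-1}]_S^P\circ X=[P,\mathrm{id}]_S^P\circ X$, for all $P\le S$, $\varphi\in\mathcal F(P,S)$. $\varepsilon$ is the ring homomorphism to $\mathbb Z_{(p)}$ extending $X\mapsto|X|/|S|$, defined on the subring of $A(S,S)_{(p)}$ spanned by left-free bisets (which contains all $\mathcal F$-generated elements). $X$ is $\mathcal F$-characteristic if it is $\mathcal F$-generated, left and right $\mathcal F$-stable, and $\varepsilon(X)$ is invertible in $\mathbb Z_{(p)}$. *)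

theory Defs
  imports
    "HOL-Algebra.Group_Action"
    "HOL-Algebra.Left_Coset"
    "HOL-Computational_Algebra.Primes"
    "HOL-Library.Poly_Mapping"
    "HOL-Library.Countable_Set"
begin

section \<open>Fusion systems\<close>

text \<open>
  \<open>F P Q\<close> is the set of morphisms from \<open>P\<close> to \<open>Q\<close>; it is only meaningful when \<open>P\<close> and \<open>Q\<close> are
  subgroups.  Morphisms are extensional functions (\<open>undefined\<close> outside \<open>P\<close>), so that the elements
  of \<open>F P Q\<close> are in bijection with the morphisms they represent.
\<close>

type_synonym 'a fusion = "'a set \<Rightarrow> 'a set \<Rightarrow> ('a \<Rightarrow> 'a) set"

definition conj_map :: "('a, 'm) monoid_scheme \<Rightarrow> 'a \<Rightarrow> 'a \<Rightarrow> 'a" where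
  "conj_map S x u = x \<otimes>\<^bsub>S\<^esub> u \<otimes>\<^bsub>S\<^esub> inv\<^bsub>S\<^esub> x"

definition trivial_fusion :: "('a, 'm) monoid_scheme \<Rightarrow> 'a fusion" where
  "trivial_fusion S P Q =
    {restrict (conj_map S x) P | x. x \<in> carrier S \<and> conj_map S x ` P \<subseteq> Q}"

definition inj_homs :: "('a, 'm) monoid_scheme \<Rightarrow> 'a set \<Rightarrow> 'a set \<Rightarrow> ('a \<Rightarrow> 'a) set" where
  "inj_homs S P Q = mon (S\<lparr>carrier := P\<rparr>) (S\<lparr>carrier := Q\<rparr>) \<inter> extensional P"

definition fusion_system :: "('a, 'm) monoid_scheme \<Rightarrow> 'a fusion \<Rightarrow> bool" where
  "fusion_system S F \<longleftrightarrow>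
    (\<forall>P Q. subgroup P S \<longrightarrow> subgroup Q S \<longrightarrow>
      F P Q \<subseteq> inj_homs S P Q \<and>
      trivial_fusion S P Q \<subseteq> F P Q \<and>
      (\<forall>\<phi>\<in>F P Q. \<phi> \<in> F P (\<phi> ` P) \<and> restrict (inv_into P \<phi>) (\<phi> ` P) \<in> F (\<phi> ` P) P)) \<and>
    (\<forall>P Q R. subgroup P S \<longrightarrow> subgroup Q S \<longrightarrow> subgroup R S \<longrightarrow>
      (\<forall>\<phi>\<in>F P Q. \<forall>\<psi>\<in>F Q R. compose P \<psi> \<phi> \<in> F P R))"

definition fconj_class :: "('a, 'm) monoid_scheme \<Rightarrow> 'a fusion \<Rightarrow> 'a set \<Rightarrow> 'a set set" where
  "fconj_class S F P =
    {Q. subgroup Q S \<and>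
      (\<exists>\<phi>\<in>F P Q. \<exists>\<psi>\<in>F Q P. (\<forall>x\<in>P. \<psi> (\<phi> x) = x) \<and> (\<forall>y\<in>Q. \<phi> (\<psi> y) = y))}"

definition centralizer :: "('a, 'm) monoid_scheme \<Rightarrow> 'a set \<Rightarrow> 'a set" where
  "centralizer S P = {x \<in> carrier S. \<forall>u\<in>P. x \<otimes>\<^bsub>S\<^esub> u = u \<otimes>\<^bsub>S\<^esub> x}"

definition fully_normalized :: "('a, 'm) monoid_scheme \<Rightarrow> 'a fusion \<Rightarrow> 'a set \<Rightarrow> bool" where
  "fully_normalized S F P \<longleftrightarrow>
    (\<forall>Q\<in>fconj_class S F P. card (normalizer S Q) \<le> card (normalizer S P))"

definition fully_centralized :: "('a, 'm) monoid_scheme \<Rightarrow> 'a fusion \<Rightarrow> 'a set \<Rightarrow> bool" where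
  "fully_centralized S F P \<longleftrightarrow>
    (\<forall>Q\<in>fconj_class S F P. card (centralizer S Q) \<le> card (centralizer S P))"

definition Aut_fusion :: "'a fusion \<Rightarrow> 'a set \<Rightarrow> ('a \<Rightarrow> 'a) monoid" where
  "Aut_fusion F P = BijGroup P\<lparr>carrier := F P P\<rparr>"

definition Aut_inner :: "('a, 'm) monoid_scheme \<Rightarrow> 'a set \<Rightarrow> ('a \<Rightarrow> 'a) set" where
  "Aut_inner S P = {restrict (conj_map S x) P | x. x \<in> normalizer S P}"

definition sylow_subgroup :: "nat \<Rightarrow> 'g set \<Rightarrow> ('g, 'm) monoid_scheme \<Rightarrow> bool" where
  "sylow_subgroup p H G \<longleftrightarrow> subgroup H G \<and> card H = p ^ multiplicity p (order G)"

definition extender :: "('a, 'm) monoid_scheme \<Rightarrow> 'a set \<Rightarrow> ('a \<Rightarrow> 'a) \<Rightarrow> 'a set" where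
  "extender S P \<phi> =
    {x \<in> normalizer S P.
      \<exists>y\<in>carrier S. \<forall>u\<in>P. \<phi> (conj_map S x u) = conj_map S y (\<phi> u)}"

definition saturated :: "nat \<Rightarrow> ('a, 'm) monoid_scheme \<Rightarrow> 'a fusion \<Rightarrow> bool" where
  "saturated p S F \<longleftrightarrow>
    fusion_system S F \<and>
    (\<forall>P. subgroup P S \<longrightarrow>
      (fully_normalized S F P \<longrightarrow>
        fully_centralized S F P \<and> sylow_subgroup p (Aut_inner S P) (Aut_fusion F P)) \<and>
      (\<forall>\<phi>\<in>F P (carrier S). fully_centralized S F (\<phi> ` P) \<longrightarrow>
        (\<exists>\<psi>\<in>F (extender S P \<phi>) (carrier S). \<forall>u\<in>P. \<psi> u = \<phi> u)))"

definition product_fusion ::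
  "('a, 'm) monoid_scheme \<Rightarrow> 'a fusion \<Rightarrow> ('b, 'n) monoid_scheme \<Rightarrow> 'b fusion
    \<Rightarrow> ('a \<times> 'b) fusion" where
  "product_fusion S2 F2 S1 F1 D C =
    {restrict (map_prod \<phi>2 \<phi>1) D | \<phi>2 \<phi>1.
      \<phi>2 \<in> F2 (fst ` D) (carrier S2) \<and> \<phi>1 \<in> F1 (snd ` D) (carrier S1) \<and>
      map_prod \<phi>2 \<phi>1 ` D \<subseteq> C}"


section \<open>Finite sets with a group action\<close>

record ('g, 'x) gset =
  pts :: "'x set"
  act :: "'g \<Rightarrow> 'x \<Rightarrow> 'x"

definition is_gset :: "('g, 'm) monoid_scheme \<Rightarrow> ('g, 'x) gset \<Rightarrow> bool" where
  "is_gset G X \<longleftrightarrow> finite (pts X) \<and> group_action G (pts X) (act X)"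

definition gset_iso ::
  "('g, 'm) monoid_scheme \<Rightarrow> ('g, 'x) gset \<Rightarrow> ('g, 'y) gset \<Rightarrow> bool" where
  "gset_iso G X Y \<longleftrightarrow>
    (\<exists>f. bij_betw f (pts X) (pts Y) \<and>
      (\<forall>g\<in>carrier G. \<forall>x\<in>pts X. f (act X g x) = act Y g (f x)))"

definition gset_sum :: "('g, 'x) gset \<Rightarrow> ('g, 'y) gset \<Rightarrow> ('g, 'x + 'y) gset" where
  "gset_sum X Y =
    \<lparr>pts = pts X <+> pts Y, act = (\<lambda>g. restrict (map_sum (act X g) (act Y g)) (pts X <+> pts Y))\<rparr>"

definition coset_gset :: "('g, 'm) monoid_scheme \<Rightarrow> 'g set \<Rightarrow> ('g, 'g set) gset" where
  "coset_gset G D =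
    \<lparr>pts = lcosets\<^bsub>G\<^esub> D, act = (\<lambda>g. \<lambda>C\<in>lcosets\<^bsub>G\<^esub> D. g <#\<^bsub>G\<^esub> C)\<rparr>"

definition fixed_points :: "'g set \<Rightarrow> ('g, 'x) gset \<Rightarrow> 'x set" where
  "fixed_points D X = {x \<in> pts X. \<forall>g\<in>D. act X g x = x}"

text \<open>
  The isomorphism class of a finite \<open>G\<close>-set on an arbitrary type.  Every finite set is in bijection
  with a set of natural numbers, so the members on \<^typ>\<open>nat\<close> suffice.
\<close>

definition iso_class ::
  "('g, 'm) monoid_scheme \<Rightarrow> ('g, 'x) gset \<Rightarrow> ('g, nat) gset set" where
  "iso_class G X = {Y. is_gset G Y \<and> gset_iso G X Y}"

definition iso_classes :: "('g, 'm) monoid_scheme \<Rightarrow> ('g, nat) gset set set" where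
  "iso_classes G = {iso_class G X | X :: ('g, nat) gset. is_gset G X}"


section \<open>The \<open>p\<close>-localized Burnside module\<close>

definition Z_loc :: "nat \<Rightarrow> rat set" where
  "Z_loc p = {of_int a / of_int b | a b. \<not> int p dvd b}"

text \<open>
  The Grothendieck group of isomorphism classes of finite \<open>G\<close>-sets, tensored with the ring
  \<open>Z_loc p\<close>, is the free \<open>Z_loc p\<close>-module on the isomorphism classes modulo the submodule generated
  by all \<open>[X \<squnion> Y] - [X] - [Y]\<close>.  Its elements are represented as cosets of formal sums.
\<close>

type_synonym 'g formal_sum = "('g, nat) gset set \<Rightarrow>\<^sub>0 rat"

definition formal_sums :: "nat \<Rightarrow> ('g, 'm) monoid_scheme \<Rightarrow> 'g formal_sum set" where
  "formal_sums p G = {a. Poly_Mapping.keys a \<subseteq> iso_classes G \<and>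
    (\<forall>c. Poly_Mapping.lookup a c \<in> Z_loc p)}"

inductive_set sum_relations :: "nat \<Rightarrow> ('g, 'm) monoid_scheme \<Rightarrow> 'g formal_sum set"
  for p :: nat and G :: "('g, 'm) monoid_scheme" where
  zero: "0 \<in> sum_relations p G"
| step: "\<lbrakk>a \<in> sum_relations p G; q \<in> Z_loc p;
    is_gset G (X :: ('g, nat) gset); is_gset G (Y :: ('g, nat) gset)\<rbrakk> \<Longrightarrow>
    a + (Poly_Mapping.single (iso_class G (gset_sum X Y)) q
      - Poly_Mapping.single (iso_class G X) q - Poly_Mapping.single (iso_class G Y) q)
    \<in> sum_relations p G"

definition burnside_rel ::
  "nat \<Rightarrow> ('g, 'm) monoid_scheme \<Rightarrow> ('g formal_sum \<times> 'g formal_sum) set" where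
  "burnside_rel p G =
    {(a, b). a \<in> formal_sums p G \<and> b \<in> formal_sums p G \<and> a - b \<in> sum_relations p G}"

definition burnside :: "nat \<Rightarrow> ('g, 'm) monoid_scheme \<Rightarrow> 'g formal_sum set set" where
  "burnside p G = formal_sums p G // burnside_rel p G"

definition burnside_class ::
  "nat \<Rightarrow> ('g, 'm) monoid_scheme \<Rightarrow> 'g formal_sum \<Rightarrow> 'g formal_sum set" where
  "burnside_class p G a = burnside_rel p G `` {a}"

definition gset_class ::
  "nat \<Rightarrow> ('g, 'm) monoid_scheme \<Rightarrow> ('g, 'x) gset \<Rightarrow> 'g formal_sum set" where
  "gset_class p G X = burnside_class p G (Poly_Mapping.single (iso_class G X) 1)"

text \<open>Linear extension of an isomorphism-invariant numerical function on \<open>G\<close>-sets:\<close>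

definition linear_ext :: "(('g, nat) gset \<Rightarrow> rat) \<Rightarrow> 'g formal_sum \<Rightarrow> rat" where
  "linear_ext h a =
    (\<Sum>c\<in>Poly_Mapping.keys a. Poly_Mapping.lookup a c * h (SOME X. X \<in> c))"

definition fixed_point_map :: "'g set \<Rightarrow> 'g formal_sum set \<Rightarrow> rat" where
  "fixed_point_map D A =
    the_elem (linear_ext (\<lambda>X. of_nat (card (fixed_points D X))) ` A)"

definition stabilization ::
  "nat \<Rightarrow> ('g, 'm) monoid_scheme \<Rightarrow> 'g fusion \<Rightarrow> 'g formal_sum set \<Rightarrow> 'g formal_sum set" where
  "stabilization p T F A =
    (THE B. B \<in> burnside p T \<and>
      (\<forall>D. subgroup D T \<longrightarrow>
        fixed_point_map D B =
          1 / of_nat (card (fconj_class T F D)) *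
          (\<Sum>D'\<in>fconj_class T F D. fixed_point_map D' A)))"


section \<open>Bisets\<close>

text \<open>
  A \<open>(G, H)\<close>-biset is a left \<open>H \<times>\<times> G\<close>-set via \<open>(h, g).x = h x g\<^sup>-\<^sup>1\<close>, and the localized
  group of \<open>(G, H)\<close>-bisets is \<open>burnside p (H \<times>\<times> G)\<close>.

  For a \<open>(G, H)\<close>-biset \<open>X\<close> and an \<open>(H, K)\<close>-biset \<open>Y\<close>, the product \<open>Y \<times>\<^sub>H X\<close> consists of the orbits
  of \<open>H\<close> on \<open>Y \<times> X\<close> under \<open>h.(y, x) = (y h\<^sup>-\<^sup>1, h x)\<close>, where \<open>y h\<^sup>-\<^sup>1 = (1, h).y\<close> and
  \<open>h x = (h, 1).x\<close>.
\<close>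

definition biset_product_pts ::
  "('g, 'l) monoid_scheme \<Rightarrow> ('h, 'm) monoid_scheme \<Rightarrow> ('k, 'n) monoid_scheme \<Rightarrow>
    ('k \<times> 'h, 'y) gset \<Rightarrow> ('h \<times> 'g, 'x) gset \<Rightarrow> ('y \<times> 'x) set set" where
  "biset_product_pts G H K Y X =
    orbits H (pts Y \<times> pts X) (\<lambda>h. map_prod (act Y (\<one>\<^bsub>K\<^esub>, h)) (act X (h, \<one>\<^bsub>G\<^esub>)))"

definition biset_product ::
  "('g, 'l) monoid_scheme \<Rightarrow> ('h, 'm) monoid_scheme \<Rightarrow> ('k, 'n) monoid_scheme \<Rightarrow>
    ('k \<times> 'h, 'y) gset \<Rightarrow> ('h \<times> 'g, 'x) gset \<Rightarrow> ('k \<times> 'g, ('y \<times> 'x) set) gset" where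
  "biset_product G H K Y X =
    \<lparr>pts = biset_product_pts G H K Y X,
     act = (\<lambda>(k, g). \<lambda>C\<in>biset_product_pts G H K Y X.
       map_prod (act Y (k, \<one>\<^bsub>H\<^esub>)) (act X (\<one>\<^bsub>H\<^esub>, g)) ` C)\<rparr>"

definition formal_comp ::
  "('g, 'l) monoid_scheme \<Rightarrow> ('h, 'm) monoid_scheme \<Rightarrow> ('k, 'n) monoid_scheme \<Rightarrow>
    ('k \<times> 'h) formal_sum \<Rightarrow> ('h \<times> 'g) formal_sum \<Rightarrow> ('k \<times> 'g) formal_sum" where
  "formal_comp G H K b a =
    (\<Sum>d\<in>Poly_Mapping.keys b. \<Sum>c\<in>Poly_Mapping.keys a.
      Poly_Mapping.single
        (iso_class (K \<times>\<times> G) (biset_product G H K (SOME Y. Y \<in> d) (SOME X. X \<in> c)))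
        (Poly_Mapping.lookup b d * Poly_Mapping.lookup a c))"

definition burnside_comp ::
  "nat \<Rightarrow> ('g, 'l) monoid_scheme \<Rightarrow> ('h, 'm) monoid_scheme \<Rightarrow> ('k, 'n) monoid_scheme \<Rightarrow>
    ('k \<times> 'h) formal_sum set \<Rightarrow> ('h \<times> 'g) formal_sum set \<Rightarrow> ('k \<times> 'g) formal_sum set" where
  "burnside_comp p G H K B A =
    (\<Union>b\<in>B. \<Union>a\<in>A. burnside_class p (K \<times>\<times> G) (formal_comp G H K b a))"

definition twisted_diag :: "'g set \<Rightarrow> ('g \<Rightarrow> 'h) \<Rightarrow> ('h \<times> 'g) set" where
  "twisted_diag U \<phi> = {(\<phi> u, u) | u. u \<in> U}"

definition trans_biset ::
  "('g, 'm) monoid_scheme \<Rightarrow> ('h, 'n) monoid_scheme \<Rightarrow> 'g set \<Rightarrow> ('g \<Rightarrow> 'h) \<Rightarrow>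
    ('h \<times> 'g, ('h \<times> 'g) set) gset" where
  "trans_biset G H U \<phi> = coset_gset (H \<times>\<times> G) (twisted_diag U \<phi>)"

definition trans_class ::
  "nat \<Rightarrow> ('g, 'm) monoid_scheme \<Rightarrow> ('h, 'n) monoid_scheme \<Rightarrow> 'g set \<Rightarrow> ('g \<Rightarrow> 'h) \<Rightarrow>
    ('h \<times> 'g) formal_sum set" where
  "trans_class p G H U \<phi> = gset_class p (H \<times>\<times> G) (trans_biset G H U \<phi>)"

definition left_free ::
  "('g, 'm) monoid_scheme \<Rightarrow> ('h, 'n) monoid_scheme \<Rightarrow> ('h \<times> 'g, 'x) gset \<Rightarrow> bool" where
  "left_free G H X \<longleftrightarrow>
    (\<forall>h\<in>carrier H. \<forall>x\<in>pts X. act X (h, \<one>\<^bsub>G\<^esub>) x = x \<longrightarrow> h = \<one>\<^bsub>H\<^esub>)"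

text \<open>
  The domain of \<open>\<epsilon>\<close> is the subring spanned by the left-free bisets: only representatives that are
  formal sums of left-free bisets are evaluated, and the value is unspecified if there are none.
\<close>

definition augmentation :: "('a, 'm) monoid_scheme \<Rightarrow> ('a \<times> 'a) formal_sum set \<Rightarrow> rat" where
  "augmentation S A =
    the_elem (linear_ext (\<lambda>X. of_nat (card (pts X)) / of_nat (order S)) `
      {a \<in> A. \<forall>c\<in>Poly_Mapping.keys a. \<forall>X\<in>c. left_free S S X})"


section \<open>Characteristic elements\<close>

definition F_generated ::
  "nat \<Rightarrow> ('a, 'm) monoid_scheme \<Rightarrow> 'a fusion \<Rightarrow> ('a \<times> 'a) formal_sum set \<Rightarrow> bool" where
  "F_generated p S F A \<longleftrightarrow>
    (\<exists>q. (\<forall>P \<phi>. q P \<phi> \<in> Z_loc p) \<and>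
      A = burnside_class p (S \<times>\<times> S)
        (\<Sum>P\<in>{P. subgroup P S}. \<Sum>\<phi>\<in>F P (carrier S).
          Poly_Mapping.single (iso_class (S \<times>\<times> S) (trans_biset S S P \<phi>)) (q P \<phi>)))"

definition right_stable ::
  "nat \<Rightarrow> ('a, 'm) monoid_scheme \<Rightarrow> 'a fusion \<Rightarrow> ('a \<times> 'a) formal_sum set \<Rightarrow> bool" where
  "right_stable p S F A \<longleftrightarrow>
    (\<forall>P. subgroup P S \<longrightarrow> (\<forall>\<phi>\<in>F P (carrier S).
      burnside_comp p (S\<lparr>carrier := P\<rparr>) S S A (trans_class p (S\<lparr>carrier := P\<rparr>) S P \<phi>) =
      burnside_comp p (S\<lparr>carrier := P\<rparr>) S S A (trans_class p (S\<lparr>carrier := P\<rparr>) S P id)))"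

definition left_stable ::
  "nat \<Rightarrow> ('a, 'm) monoid_scheme \<Rightarrow> 'a fusion \<Rightarrow> ('a \<times> 'a) formal_sum set \<Rightarrow> bool" where
  "left_stable p S F A \<longleftrightarrow>
    (\<forall>P. subgroup P S \<longrightarrow> (\<forall>\<phi>\<in>F P (carrier S).
      burnside_comp p S S (S\<lparr>carrier := P\<rparr>)
        (trans_class p S (S\<lparr>carrier := P\<rparr>) (\<phi> ` P) (inv_into P \<phi>)) A =
      burnside_comp p S S (S\<lparr>carrier := P\<rparr>)
        (trans_class p S (S\<lparr>carrier := P\<rparr>) P id) A))"

definition characteristic ::
  "nat \<Rightarrow> ('a, 'm) monoid_scheme \<Rightarrow> 'a fusion \<Rightarrow> ('a \<times> 'a) formal_sum set \<Rightarrow> bool" where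
  "characteristic p S F A \<longleftrightarrow>
    A \<in> burnside p (S \<times>\<times> S) \<and>
    F_generated p S F A \<and> left_stable p S F A \<and> right_stable p S F A \<and>
    augmentation S A \<in> Z_loc p \<and> (\<exists>r\<in>Z_loc p. augmentation S A * r = 1)"

definition characteristic_idempotent ::
  "nat \<Rightarrow> ('a, 'm) monoid_scheme \<Rightarrow> 'a fusion \<Rightarrow> ('a \<times> 'a) formal_sum set \<Rightarrow> bool" where
  "characteristic_idempotent p S F A \<longleftrightarrow>
    burnside_comp p S S S A A = A \<and> characteristic p S F A"

end

theory Submission
  imports Defs "HOL-Algebra.Generated_Groups"
begin

text \<open>
  Write \<open>T = S \<times> S\<close>, call \<open>\<Delta>(P, \<phi>) = {(\<phi> u, u) | u \<in> P}\<close> with \<open>\<phi> : P \<rightarrow> S\<close> in \<open>F\<close> a graph, and let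
  the mark of a \<open>T\<close>-set at \<open>D\<close> be its number of \<open>D\<close>-fixed points.  An element of the localized
  Burnside module is determined by its marks, because the table of marks is triangular
  (\<open>marks_separate\<close>).  Everything is therefore a statement about marks.

  The class of \<open>\<Delta>(Q, \<psi>)\<close> under \<open>F \<times> F\<^sub>S\<close> consists of all graphs whose domain is \<open>S\<close>-conjugate to \<open>Q\<close>,
  and the marks of \<open>T/\<Delta>(S)\<close> at the graphs with one fixed domain add up to \<open>|S|\<close>.  So the
  stabilization must have the mark \<open>|S| / |F(Q, S)|\<close> at every graph with domain \<open>Q\<close>, and \<open>0\<close> at all
  other subgroups (\<open>target\<close>, \<open>average_diagonal\<close>).

  Suppose that some \<open>p\<close>-integral combination \<open>b\<close> of the sets \<open>T/\<Delta>(P, \<phi>)\<close> has these marks.  A point of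
  \<open>Y \<times>\<^sub>H X\<close> has the relational composite of the stabilizers of \<open>y\<close> and \<open>x\<close> as its stabilizer.  When the
  stabilizers on one side are graphs, composition thus evaluates the marks of the other factor at
  subgroups transported along morphisms of \<open>F\<close>, and \<open>target\<close> is invariant under such transport in
  either coordinate (\<open>target_push\<close>).  This gives both stability conditions.  The mark of \<open>b \<circ> b\<close> at \<open>D\<close>
  is \<open>target D / |S|\<close> times the sum of the marks of \<open>b\<close> at the graphs whose domain is the
  second projection of \<open>D\<close>; that sum is \<open>|S|\<close>, so \<open>b\<close> is idempotent.  The augmentation is the same
  sum for the trivial domain, divided by \<open>|S|\<close>.

  The existence of \<open>b\<close> (\<open>realizable_target\<close>) is where saturation enters.  One starts with \<open>T/\<Delta>(S)\<close>
  and corrects the marks by downward induction on the domain \<open>P\<close>, keeping the sum of the marks over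
  all graphs with a given domain equal to \<open>|S|\<close>.  The Sylow condition at a fully normalized conjugate
  of \<open>P\<close> yields \<open>\<phi>0 : P \<rightarrow> S\<close> with fully centralized image that carries the conjugation action of
  \<open>N\<^sub>S(P)\<close> into conjugation in \<open>S\<close> (\<open>good_morphism\<close>).  By the extension axiom, the normalizer in \<open>T\<close>
  of any other graph \<open>V\<close> on \<open>P\<close> embeds into that of \<open>V0 = \<Delta>(P, \<phi>0)\<close> through a morphism of \<open>F\<close>.  Counting
  orbits of this normalizer on the fixed points of \<open>V\<close> and of \<open>V0\<close> shows that the two marks agree
  modulo \<open>|N\<^sub>T(V)| / |P|\<close> (\<open>value_congruence\<close>).  Added up over all graphs on \<open>P\<close>, these congruences also
  show that the common value differs from the target by a multiple of \<open>|N\<^sub>T(V)| / |P|\<close>.  This number is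
  the mark of \<open>T/V\<close> at \<open>V\<close>, so integral multiples of the \<open>T/V\<close> repair the marks
  (\<open>correction_step\<close>).  The multipliers add up to \<open>0\<close>, and the sum of the marks of \<open>T/V\<close> over the graphs
  with a given domain depends only on the domain of \<open>V\<close>; so the sums stay equal to \<open>|S|\<close>.
\<close>

section \<open>Finite sets with an action of a finite group\<close>

lemma group_actionI:
  assumes "group G"
    and "\<And>g. g \<in> carrier G \<Longrightarrow> \<phi> g \<in> extensional E"
    and closed: "\<And>g x. g \<in> carrier G \<Longrightarrow> x \<in> E \<Longrightarrow> \<phi> g x \<in> E"
    and one: "\<And>x. x \<in> E \<Longrightarrow> \<phi> \<one>\<^bsub>G\<^esub> x = x"
    and mult: "\<And>g h x. g \<in> carrier G \<Longrightarrow> h \<in> carrier G \<Longrightarrow> x \<in> E \<Longrightarrow> \<phi> (g \<otimes>\<^bsub>G\<^esub> h) x = \<phi> g (\<phi> h x)"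
  shows "group_action G E \<phi>"
proof -
  interpret group G by fact
  have bij: "\<phi> g \<in> Bij E" if "g \<in> carrier G" for g
  proof -
    have "bij_betw (\<phi> g) E E"
    proof (rule bij_betw_byWitness[where f' = "\<phi> (inv\<^bsub>G\<^esub> g)"])
      show "\<forall>x\<in>E. \<phi> (inv\<^bsub>G\<^esub> g) (\<phi> g x) = x" "\<forall>x\<in>E. \<phi> g (\<phi> (inv\<^bsub>G\<^esub> g) x) = x"
        using that one by (simp_all flip: mult)
      show "\<phi> g ` E \<subseteq> E" "\<phi> (inv\<^bsub>G\<^esub> g) ` E \<subseteq> E" using that closed by auto
    qed
    then show ?thesis using assms(2)[OF that] by (simp add: Bij_def)
  qed
  have "\<phi> \<in> hom G (BijGroup E)"
  proof (rule homI)
    show "\<phi> g \<in> carrier (BijGroup E)" if "g \<in> carrier G" for g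
      using bij[OF that] by (simp add: BijGroup_def)
    show "\<phi> (g \<otimes>\<^bsub>G\<^esub> h) = \<phi> g \<otimes>\<^bsub>BijGroup E\<^esub> \<phi> h" if "g \<in> carrier G" "h \<in> carrier G" for g h
    proof -
      have "\<phi> (g \<otimes>\<^bsub>G\<^esub> h) = compose E (\<phi> g) (\<phi> h)"
        using assms(2)[of "g \<otimes>\<^bsub>G\<^esub> h"] that
        by (intro extensionalityI[of _ E]) (auto simp: compose_eq mult)
      then show ?thesis using that bij by (simp add: BijGroup_def)
    qed
  qed
  then show ?thesis
    by (simp add: group_action_def group_hom_def group_hom_axioms_def group_BijGroup assms(1))
qed

lemma (in group_action) orbit_subset: "x \<in> E \<Longrightarrow> orbit G \<phi> x \<subseteq> E"
  using element_image by (auto simp: orbit_def)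

lemma (in group_action) orbit_eq_iff:
  assumes x: "x \<in> E" and y: "y \<in> E"
  shows "orbit G \<phi> x = orbit G \<phi> y \<longleftrightarrow> x \<in> orbit G \<phi> y"
proof
  assume "orbit G \<phi> x = orbit G \<phi> y"
  then show "x \<in> orbit G \<phi> y" using orbit_refl[OF x] by simp
next
  assume *: "x \<in> orbit G \<phi> y"
  show "orbit G \<phi> x = orbit G \<phi> y"
  proof
    show "orbit G \<phi> x \<subseteq> orbit G \<phi> y"
      using orbit_trans[OF y x _ *] orbit_subset[OF x] by auto
    show "orbit G \<phi> y \<subseteq> orbit G \<phi> x"
      using orbit_trans[OF x y _ orbit_sym[OF y x *]] orbit_subset[OF y] by auto
  qed
qed

lemma is_gset_finite: "is_gset G X \<Longrightarrow> finite (pts X)"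
  by (simp add: is_gset_def)

lemma is_gset_action: "is_gset G X \<Longrightarrow> group_action G (pts X) (act X)"
  by (simp add: is_gset_def)

lemma gset_closed:
  "\<lbrakk>is_gset G X; g \<in> carrier G; x \<in> pts X\<rbrakk> \<Longrightarrow> act X g x \<in> pts X"
  by (meson group_action.element_image is_gset_action)

lemma gset_mult:
  "\<lbrakk>is_gset G X; g \<in> carrier G; h \<in> carrier G; x \<in> pts X\<rbrakk> \<Longrightarrow>
    act X (g \<otimes>\<^bsub>G\<^esub> h) x = act X g (act X h x)"
  by (meson group_action.composition_rule is_gset_action)

lemma gset_one:
  "\<lbrakk>is_gset G X; x \<in> pts X\<rbrakk> \<Longrightarrow> act X \<one>\<^bsub>G\<^esub> x = x"
  by (metis group_action.id_eq_one is_gset_action restrict_apply')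

lemma gset_group: "is_gset G X \<Longrightarrow> group G"
  by (meson group_action.group_hom group_hom.axioms(1) is_gset_action)

lemma gset_inv:
  assumes "is_gset G X" "g \<in> carrier G" "x \<in> pts X"
  shows "act X (inv\<^bsub>G\<^esub> g) (act X g x) = x" "act X g (act X (inv\<^bsub>G\<^esub> g) x) = x"
proof -
  interpret group G using assms(1) by (rule gset_group)
  show "act X (inv\<^bsub>G\<^esub> g) (act X g x) = x" "act X g (act X (inv\<^bsub>G\<^esub> g) x) = x"
    using assms by (simp_all add: gset_one flip: gset_mult)
qed

lemma stabilizer_gset:
  "\<lbrakk>is_gset G X; x \<in> pts X\<rbrakk> \<Longrightarrow> subgroup (stabilizer G (act X) x) G"
  by (meson group_action.stabilizer_subgroup is_gset_action)

lemma is_gset_sum: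
  assumes "is_gset G X" "is_gset G Y"
  shows "is_gset G (gset_sum X Y)"
  unfolding is_gset_def
proof (intro conjI)
  show "finite (pts (gset_sum X Y))"
    using assms by (simp add: gset_sum_def is_gset_finite)
  show "group_action G (pts (gset_sum X Y)) (act (gset_sum X Y))"
    using assms by (intro group_actionI)
      (auto simp: gset_sum_def gset_one gset_mult gset_closed intro: gset_group)
qed

subsection \<open>Isomorphism classes\<close>

lemma gset_iso_refl: "gset_iso G X X"
  unfolding gset_iso_def by (intro exI[of _ id]) auto

lemma gset_iso_sym:
  assumes "gset_iso G X Y" "is_gset G X"
  shows "gset_iso G Y X"
proof -
  obtain f where f: "bij_betw f (pts X) (pts Y)"
    and eq: "\<And>g x. g \<in> carrier G \<Longrightarrow> x \<in> pts X \<Longrightarrow> f (act X g x) = act Y g (f x)"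
    using assms(1) unfolding gset_iso_def by blast
  let ?h = "inv_into (pts X) f"
  have "?h (act Y g y) = act X g (?h y)" if g: "g \<in> carrier G" and "y \<in> pts Y" for g y
  proof -
    have "y \<in> f ` pts X" using f that by (simp add: bij_betw_def)
    then have hy: "?h y \<in> pts X" and y: "f (?h y) = y" by (auto simp: inv_into_into f_inv_into_f)
    have "act Y g y = f (act X g (?h y))" using eq[OF g hy] y by simp
    then show ?thesis
      using f gset_closed[OF assms(2) g hy] by (simp add: bij_betw_def inv_into_f_f)
  qed
  then show ?thesis
    unfolding gset_iso_def using bij_betw_inv_into[OF f] by blast
qed

lemma gset_iso_trans:
  assumes "gset_iso G X Y" "gset_iso G Y Z"
  shows "gset_iso G X Z"
proof -
  obtain f where f: "bij_betw f (pts X) (pts Y)"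
    and feq: "\<And>g x. g \<in> carrier G \<Longrightarrow> x \<in> pts X \<Longrightarrow> f (act X g x) = act Y g (f x)"
    using assms(1) unfolding gset_iso_def by blast
  obtain h where h: "bij_betw h (pts Y) (pts Z)"
    and heq: "\<And>g x. g \<in> carrier G \<Longrightarrow> x \<in> pts Y \<Longrightarrow> h (act Y g x) = act Z g (h x)"
    using assms(2) unfolding gset_iso_def by blast
  show ?thesis unfolding gset_iso_def
  proof (intro exI conjI ballI)
    show "bij_betw (h \<circ> f) (pts X) (pts Z)" using f h by (rule bij_betw_trans)
    show "(h \<circ> f) (act X g x) = act Z g ((h \<circ> f) x)" if "g \<in> carrier G" "x \<in> pts X" for g x
      using that feq heq bij_betwE[OF f] by auto
  qed
qed

lemma iso_class_eq:
  fixes X :: "('g, 'x) gset" and Y :: "('g, 'y) gset"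
  assumes "gset_iso G X Y" "is_gset G X"
  shows "iso_class G X = iso_class G Y"
proof -
  have "gset_iso G X Z \<longleftrightarrow> gset_iso G Y Z" for Z :: "('g, nat) gset"
    using gset_iso_trans[OF assms(1)] gset_iso_trans[OF gset_iso_sym[OF assms]] by blast
  then show ?thesis by (simp add: iso_class_def)
qed

text \<open>A bijection from a finite set to natural numbers transports the action, which makes
  \<open>iso_class\<close> nonempty for \<open>G\<close>-sets on any type.\<close>

lemma ex_nat_gset:
  fixes X :: "('g, 'x) gset"
  assumes "is_gset G X"
  obtains Y :: "('g, nat) gset" where "is_gset G Y" "gset_iso G X Y"
proof -
  obtain f :: "'x \<Rightarrow> nat" where f: "inj_on f (pts X)"
    using finite_imp_inj_to_nat_seg[OF is_gset_finite[OF assms]] by metis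
  let ?h = "inv_into (pts X) f"
  define Y :: "('g, nat) gset" where
    "Y = \<lparr>pts = f ` pts X, act = (\<lambda>g. \<lambda>y\<in>f ` pts X. f (act X g (?h y)))\<rparr>"
  have "is_gset G Y" unfolding is_gset_def
  proof (intro conjI)
    show "finite (pts Y)" using assms by (simp add: Y_def is_gset_finite)
    have "?h (f x) = x" if "x \<in> pts X" for x using f that by simp
    then show "group_action G (pts Y) (act Y)"
      using assms by (intro group_actionI)
        (auto simp: Y_def gset_one gset_mult gset_closed inj_on_eq_iff[OF f] intro: gset_group)
  qed
  moreover have "gset_iso G X Y"
    unfolding gset_iso_def using f assms
    by (intro exI[of _ f]) (auto simp: Y_def bij_betw_def gset_closed)
  ultimately show ?thesis by (rule that)
qed

lemma iso_class_in_iso_classes: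
  fixes X :: "('g, 'x) gset"
  assumes "is_gset G X"
  shows "iso_class G X \<in> iso_classes G"
proof -
  obtain Y :: "('g, nat) gset" where "is_gset G Y" "gset_iso G X Y"
    using ex_nat_gset[OF assms] .
  then show ?thesis
    using iso_class_eq[OF _ assms] unfolding iso_classes_def by blast
qed

lemma some_iso_class:
  assumes "c \<in> iso_classes G"
  shows "is_gset G (SOME X. X \<in> c)" "iso_class G (SOME X. X \<in> c) = c"
proof -
  obtain X :: "('a, nat) gset" where X: "is_gset G X" and c: "c = iso_class G X"
    using assms unfolding iso_classes_def by blast
  have "X \<in> c" using X gset_iso_refl by (simp add: c iso_class_def)
  then have *: "(SOME X. X \<in> c) \<in> c" by (rule someI)
  then show "is_gset G (SOME X. X \<in> c)" by (simp add: c iso_class_def)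
  have "gset_iso G X (SOME X. X \<in> c)" using * by (simp add: c iso_class_def)
  from iso_class_eq[OF this X] show "iso_class G (SOME X. X \<in> c) = c" by (simp only: c)
qed

subsection \<open>Sums over stabilizers\<close>

text \<open>
  Sums over points of a weight of the stabilizer are additive and isomorphism invariant for any
  weight whatsoever.  Fixed point counts, cardinalities and the fixed point counts of composites of
  bisets all have this form, so that one invariance lemma serves them all.\<close>

definition stab_sum :: "('g, 'm) monoid_scheme \<Rightarrow> ('g set \<Rightarrow> rat) \<Rightarrow> ('g, 'x) gset \<Rightarrow> rat" where
  "stab_sum G w X = (\<Sum>x\<in>pts X. w (stabilizer G (act X) x))"

lemma stabilizer_iso:
  assumes f: "bij_betw f (pts X) (pts Y)"
    and eq: "\<And>g x. g \<in> carrier G \<Longrightarrow> x \<in> pts X \<Longrightarrow> f (act X g x) = act Y g (f x)"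
    and X: "is_gset G X" and x: "x \<in> pts X"
  shows "stabilizer G (act Y) (f x) = stabilizer G (act X) x"
proof -
  have "act Y g (f x) = f x \<longleftrightarrow> act X g x = x" if g: "g \<in> carrier G" for g
    using inj_on_eq_iff[OF bij_betw_imp_inj_on[OF f] gset_closed[OF X g x] x] eq[OF g x] by auto
  then show ?thesis unfolding stabilizer_def by auto
qed

lemma stab_sum_iso:
  assumes "gset_iso G X Y" "is_gset G X"
  shows "stab_sum G w X = stab_sum G w Y"
proof -
  obtain f where f: "bij_betw f (pts X) (pts Y)"
    and eq: "\<And>g x. g \<in> carrier G \<Longrightarrow> x \<in> pts X \<Longrightarrow> f (act X g x) = act Y g (f x)"
    using assms(1) unfolding gset_iso_def by blast
  have "stab_sum G w Y = (\<Sum>x\<in>pts X. w (stabilizer G (act Y) (f x)))"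
    unfolding stab_sum_def by (rule sum.reindex_bij_betw[OF f, symmetric])
  also have "\<dots> = stab_sum G w X"
    unfolding stab_sum_def using stabilizer_iso[OF f eq assms(2)] by (intro sum.cong) auto
  finally show ?thesis by simp
qed

lemma stab_sum_gset_sum:
  assumes "finite (pts X)" "finite (pts Y)"
  shows "stab_sum G w (gset_sum X Y) = stab_sum G w X + stab_sum G w Y"
proof -
  have "stabilizer G (act (gset_sum X Y)) (Inl x) = stabilizer G (act X) x" if "x \<in> pts X" for x
    using that by (auto simp: stabilizer_def gset_sum_def)
  moreover have "stabilizer G (act (gset_sum X Y)) (Inr y) = stabilizer G (act Y) y" if "y \<in> pts Y" for y
    using that by (auto simp: stabilizer_def gset_sum_def)
  ultimately show ?thesis
    using assms by (simp add: stab_sum_def gset_sum_def sum.Plus)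
qed

lemma stab_sum_some:
  assumes "is_gset G X"
  shows "stab_sum G w (SOME Y. Y \<in> iso_class G X) = stab_sum G w X"
proof -
  obtain Y :: "('a, nat) gset" where Y: "is_gset G Y" "gset_iso G X Y"
    using ex_nat_gset[OF assms] .
  have "Y \<in> iso_class G X" using Y by (simp add: iso_class_def)
  then have "(SOME Y. Y \<in> iso_class G X) \<in> iso_class G X" by (rule someI)
  then have "gset_iso G X (SOME Y. Y \<in> iso_class G X)" by (simp add: iso_class_def)
  from stab_sum_iso[OF this assms] show ?thesis by simp
qed

lemma stab_sum_sum: "stab_sum G (\<lambda>U. \<Sum>i\<in>I. w i U) X = (\<Sum>i\<in>I. stab_sum G (w i) X)"
  unfolding stab_sum_def by (rule sum.swap)

lemma stab_sum_mult: "stab_sum G (\<lambda>U. r * w U) X = r * stab_sum G w X"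
  by (simp add: stab_sum_def sum_distrib_left)

abbreviation contains :: "'g set \<Rightarrow> 'g set \<Rightarrow> rat" where
  "contains D U \<equiv> of_bool (D \<subseteq> U)"

lemma card_fixed_points:
  assumes "finite (pts X)" "D \<subseteq> carrier G"
  shows "of_nat (card (fixed_points D X)) = stab_sum G (contains D) X"
proof -
  have "D \<subseteq> stabilizer G (act X) x \<longleftrightarrow> (\<forall>g\<in>D. act X g x = x)" for x
    using assms(2) by (auto simp: stabilizer_def)
  then have "stab_sum G (contains D) X = (\<Sum>x\<in>pts X. of_bool (\<forall>g\<in>D. act X g x = x))"
    by (simp add: stab_sum_def)
  also have "\<dots> = of_nat (card (fixed_points D X))"
    using assms(1) by (simp add: fixed_points_def sum_of_bool_eq Int_def)
  finally show ?thesis by simp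
qed

subsection \<open>Transitive sets\<close>

lemma act_coset_gset:
  "\<lbrakk>C \<in> lcosets\<^bsub>G\<^esub> D\<rbrakk> \<Longrightarrow> act (coset_gset G D) g C = g <#\<^bsub>G\<^esub> C"
  by (simp add: coset_gset_def)

lemma pts_coset_gset: "pts (coset_gset G D) = (\<lambda>a. a <#\<^bsub>G\<^esub> D) ` carrier G"
  by (auto simp: coset_gset_def LCOSETS_def)

lemma is_gset_coset:
  assumes "group G" "finite (carrier G)" "subgroup D G"
  shows "is_gset G (coset_gset G D)"
proof -
  interpret group G by fact
  have D: "D \<subseteq> carrier G" using assms(3) by (rule subgroup.subset)
  show ?thesis unfolding is_gset_def
  proof (intro conjI group_actionI)
    show "finite (pts (coset_gset G D))" by (simp add: pts_coset_gset assms(2))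
    show "act (coset_gset G D) g \<in> extensional (pts (coset_gset G D))" for g
      by (simp add: coset_gset_def)
    fix x assume "x \<in> pts (coset_gset G D)"
    then obtain a where a: "a \<in> carrier G" "x = a <#\<^bsub>G\<^esub> D" by (auto simp: pts_coset_gset)
    then have x: "x \<in> lcosets\<^bsub>G\<^esub> D" "x \<subseteq> carrier G"
      using D by (auto simp: LCOSETS_def l_coset_subset_G)
    have cl: "g <#\<^bsub>G\<^esub> x \<in> lcosets\<^bsub>G\<^esub> D" if "g \<in> carrier G" for g
      using a D that by (auto simp: LCOSETS_def lcos_m_assoc)
    show "act (coset_gset G D) \<one>\<^bsub>G\<^esub> x = x" using x by (simp add: act_coset_gset lcos_mult_one)
    fix g assume g: "g \<in> carrier G"
    show "act (coset_gset G D) g x \<in> pts (coset_gset G D)"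
      using cl[OF g] x by (simp add: act_coset_gset) (simp add: coset_gset_def)
    show "act (coset_gset G D) (g \<otimes>\<^bsub>G\<^esub> h) x = act (coset_gset G D) g (act (coset_gset G D) h x)"
      if h: "h \<in> carrier G" for h
      using x cl[OF h] g h by (simp add: act_coset_gset lcos_m_assoc)
  qed (rule assms(1))
qed

text \<open>Conjugate subsets, which are the stabilizers of the points of a transitive set.\<close>

definition conj_set :: "('g, 'm) monoid_scheme \<Rightarrow> 'g \<Rightarrow> 'g set \<Rightarrow> 'g set" where
  "conj_set G g U = conj_map G g ` U"

lemma (in group) conj_map_closed [simp]:
  "\<lbrakk>x \<in> carrier G; u \<in> carrier G\<rbrakk> \<Longrightarrow> conj_map G x u \<in> carrier G"
  by (simp add: conj_map_def)

lemma (in group) conj_map_one [simp]: "u \<in> carrier G \<Longrightarrow> conj_map G \<one> u = u"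
  by (simp add: conj_map_def)

lemma (in group) conj_map_mult:
  "\<lbrakk>x \<in> carrier G; y \<in> carrier G; u \<in> carrier G\<rbrakk> \<Longrightarrow>
    conj_map G (x \<otimes> y) u = conj_map G x (conj_map G y u)"
  by (simp add: conj_map_def m_assoc inv_mult_group)

lemma (in group) conj_map_hom:
  "\<lbrakk>x \<in> carrier G; u \<in> carrier G; v \<in> carrier G\<rbrakk> \<Longrightarrow>
    conj_map G x (u \<otimes> v) = conj_map G x u \<otimes> conj_map G x v"
  by (simp add: conj_map_def m_assoc inv_solve_left)

lemma (in group) conj_map_inv [simp]:
  assumes "x \<in> carrier G" "u \<in> carrier G"
  shows "conj_map G (inv x) (conj_map G x u) = u" "conj_map G x (conj_map G (inv x) u) = u"
  using assms by (simp_all flip: conj_map_mult)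

lemma (in group) conj_map_inj: "x \<in> carrier G \<Longrightarrow> inj_on (conj_map G x) (carrier G)"
  by (metis conj_map_inv(1) inj_onI)

lemma (in group) conj_set_closed:
  "\<lbrakk>x \<in> carrier G; U \<subseteq> carrier G\<rbrakk> \<Longrightarrow> conj_set G x U \<subseteq> carrier G"
  by (auto simp: conj_set_def)

lemma (in group) conj_set_one [simp]: "U \<subseteq> carrier G \<Longrightarrow> conj_set G \<one> U = U"
  by (auto simp: conj_set_def image_iff subset_iff)

lemma (in group) conj_set_mult:
  "\<lbrakk>x \<in> carrier G; y \<in> carrier G; U \<subseteq> carrier G\<rbrakk> \<Longrightarrow>
    conj_set G (x \<otimes> y) U = conj_set G x (conj_set G y U)"
  unfolding conj_set_def image_image by (intro image_cong) (auto simp: conj_map_mult)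

lemma (in group) conj_set_inv [simp]:
  assumes "x \<in> carrier G" "U \<subseteq> carrier G"
  shows "conj_set G (inv x) (conj_set G x U) = U" "conj_set G x (conj_set G (inv x) U) = U"
  using assms by (simp_all flip: conj_set_mult)

lemma (in group) conj_set_mono_iff:
  assumes "x \<in> carrier G" "U \<subseteq> carrier G" "V \<subseteq> carrier G"
  shows "conj_set G x U \<subseteq> conj_set G x V \<longleftrightarrow> U \<subseteq> V"
proof
  assume "conj_set G x U \<subseteq> conj_set G x V"
  then have "conj_set G (inv x) (conj_set G x U) \<subseteq> conj_set G (inv x) (conj_set G x V)"
    unfolding conj_set_def by (rule image_mono)
  then show "U \<subseteq> V" using assms by simp
qed (auto simp: conj_set_def)

lemma (in group) card_conj_set:
  "\<lbrakk>x \<in> carrier G; U \<subseteq> carrier G\<rbrakk> \<Longrightarrow> card (conj_set G x U) = card U"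
  unfolding conj_set_def by (metis card_image conj_map_inj inj_on_subset)

lemma (in group) subgroup_conj_set:
  assumes x: "x \<in> carrier G" and U: "subgroup U G"
  shows "subgroup (conj_set G x U) G"
proof -
  have "conj_map G x \<in> hom G G"
    by (intro homI) (auto simp: x conj_map_hom)
  then interpret h: group_hom G G "conj_map G x"
    by (simp add: group_hom_def group_hom_axioms_def)
  show ?thesis unfolding conj_set_def by (rule h.subgroup_img_is_subgroup[OF U])
qed

lemma (in group) mem_normalizer:
  assumes "U \<subseteq> carrier G"
  shows "x \<in> normalizer G U \<longleftrightarrow> x \<in> carrier G \<and> conj_set G x U = U"
proof -
  have "x <# U #> inv x = conj_set G x U"
    by (auto simp: l_coset_def r_coset_def conj_set_def conj_map_def)
  then show ?thesis using assms by (simp add: normalizer_def stabilizer_def)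
qed

lemma (in group) l_coset_eq_iff:
  assumes "subgroup U G" "a \<in> carrier G" "b \<in> carrier G"
  shows "a <# U = b <# U \<longleftrightarrow> inv a \<otimes> b \<in> U"
proof
  assume "a <# U = b <# U"
  then have "b \<in> a <# U" using lcos_self[OF assms(3,1)] by simp
  then show "inv a \<otimes> b \<in> U"
    using subgroup.lcos_module_imp[OF assms(1) is_group assms(2)] by simp
next
  assume *: "inv a \<otimes> b \<in> U"
  have "b = a \<otimes> (inv a \<otimes> b)" using assms by (simp flip: m_assoc)
  then have "b \<in> a <# U" using * by (auto simp: l_coset_def)
  then show "a <# U = b <# U" using l_repr_independence assms by metis
qed

lemma (in group) stabilizer_coset:
  assumes U: "subgroup U G" and a: "a \<in> carrier G"
  shows "stabilizer G (act (coset_gset G U)) (a <# U) = conj_set G a U"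
proof -
  have sub: "U \<subseteq> carrier G" using U by (rule subgroup.subset)
  have mem: "a <# U \<in> lcosets U" using a by (auto simp: LCOSETS_def)
  have "g \<in> stabilizer G (act (coset_gset G U)) (a <# U) \<longleftrightarrow> g \<in> carrier G \<and> conj_map G (inv a) g \<in> U" for g
  proof (cases "g \<in> carrier G")
    case g: True
    have "a <# U = (g \<otimes> a) <# U \<longleftrightarrow> inv a \<otimes> (g \<otimes> a) \<in> U"
      using l_coset_eq_iff[OF U a] a g by simp
    then show ?thesis
      using g a sub mem
      by (auto simp: stabilizer_def act_coset_gset lcos_m_assoc conj_map_def m_assoc)
  qed (simp add: stabilizer_def)
  also have "g \<in> carrier G \<and> conj_map G (inv a) g \<in> U \<longleftrightarrow> g \<in> conj_set G a U" for g
    using a sub by (force simp: conj_set_def image_iff)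
  finally show ?thesis by blast
qed

text \<open>Each coset \<open>gU\<close> is counted \<open>|U|\<close> times when \<open>g\<close> runs through the group, and has stabilizer
  \<open>gUg\<^sup>-\<^sup>1\<close>.\<close>

lemma (in group) stab_sum_coset:
  assumes fin: "finite (carrier G)" and U: "subgroup U G"
  shows "stab_sum G w (coset_gset G U) = (\<Sum>g\<in>carrier G. w (conj_set G g U)) / of_nat (card U)"
proof -
  let ?f = "\<lambda>a. a <# U" and ?s = "\<lambda>C. w (stabilizer G (act (coset_gset G U)) C)"
  have sub: "U \<subseteq> carrier G" using U by (rule subgroup.subset)
  have "(\<Sum>g\<in>carrier G. w (conj_set G g U)) = (\<Sum>g\<in>carrier G. ?s (?f g))"
    by (simp add: stabilizer_coset[OF U])
  also have "\<dots> = (\<Sum>C\<in>?f ` carrier G. \<Sum>g | g \<in> carrier G \<and> ?f g = C. ?s (?f g))"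
    by (rule sum.image_gen[OF fin])
  also have "\<dots> = (\<Sum>C\<in>?f ` carrier G. of_nat (card U) * ?s C)"
  proof (rule sum.cong[OF refl])
    fix C assume "C \<in> ?f ` carrier G"
    then obtain a where a: "a \<in> carrier G" and C: "C = a <# U" by blast
    have "{g \<in> carrier G. ?f g = C} = C"
      using lcos_self[OF _ U] l_repr_independence[OF _ a U] l_coset_subset_G[OF sub a]
      by (auto simp: C)
    moreover have "card C = card U"
      using l_card_cosets_equal[OF _ sub fin, of C] a unfolding C LCOSETS_def by fastforce
    moreover have "(\<Sum>g | g \<in> carrier G \<and> ?f g = C. ?s (?f g)) =
        (\<Sum>g | g \<in> carrier G \<and> ?f g = C. ?s C)"
      by (intro sum.cong) auto
    ultimately show "(\<Sum>g | g \<in> carrier G \<and> ?f g = C. ?s (?f g)) = of_nat (card U) * ?s C"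
      by simp
  qed
  also have "\<dots> = of_nat (card U) * stab_sum G w (coset_gset G U)"
    by (simp add: stab_sum_def pts_coset_gset sum_distrib_left)
  finally show ?thesis
    using finite_subset[OF sub fin] subgroup.one_closed[OF U] by (auto simp: field_simps)
qed

section \<open>The localized Burnside module\<close>

lemma Z_locI: "\<not> int p dvd b \<Longrightarrow> of_int a / of_int b \<in> Z_loc p"
  unfolding Z_loc_def by blast

lemma Z_loc_of_int [simp]: "prime p \<Longrightarrow> of_int a \<in> Z_loc p"
  using Z_locI[of p 1 a] prime_gt_1_nat[of p] by simp

lemma Z_loc_of_nat [simp]: "prime p \<Longrightarrow> of_nat a \<in> Z_loc p"
  using Z_loc_of_int[of p "int a"] by simp

lemma Z_loc_0 [simp]: "prime p \<Longrightarrow> 0 \<in> Z_loc p"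
  and Z_loc_1 [simp]: "prime p \<Longrightarrow> 1 \<in> Z_loc p"
  using Z_loc_of_int[of p 0] Z_loc_of_int[of p 1] by simp_all

lemma Z_loc_add [simp]:
  assumes p: "prime p" and "x \<in> Z_loc p" "y \<in> Z_loc p"
  shows "x + y \<in> Z_loc p"
proof -
  obtain a b c d where x: "x = of_int a / of_int b" and y: "y = of_int c / of_int d"
    and nd: "\<not> int p dvd b" "\<not> int p dvd d"
    using assms(2,3) unfolding Z_loc_def by blast
  then have "b \<noteq> 0" "d \<noteq> 0" by auto
  then have "x + y = of_int (a * d + c * b) / of_int (b * d)"
    by (simp add: x y divide_simps)
  moreover have "\<not> int p dvd b * d" using nd p by (simp add: prime_dvd_mult_iff)
  ultimately show ?thesis using Z_locI by metis
qed

lemma Z_loc_mult [simp]: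
  assumes p: "prime p" and "x \<in> Z_loc p" "y \<in> Z_loc p"
  shows "x * y \<in> Z_loc p"
proof -
  obtain a b c d where x: "x = of_int a / of_int b" and y: "y = of_int c / of_int d"
    and nd: "\<not> int p dvd b" "\<not> int p dvd d"
    using assms(2,3) unfolding Z_loc_def by blast
  have "x * y = of_int (a * c) / of_int (b * d)" by (simp add: x y)
  moreover have "\<not> int p dvd b * d" using nd p by (simp add: prime_dvd_mult_iff)
  ultimately show ?thesis using Z_locI by metis
qed

lemma Z_loc_uminus [simp]: "x \<in> Z_loc p \<Longrightarrow> - x \<in> Z_loc p"
  unfolding Z_loc_def by clarify (metis minus_divide_left of_int_minus)

lemma Z_loc_diff [simp]: "\<lbrakk>prime p; x \<in> Z_loc p; y \<in> Z_loc p\<rbrakk> \<Longrightarrow> x - y \<in> Z_loc p"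
  using Z_loc_add[of p x "- y"] by simp

lemma Z_loc_sum: "\<lbrakk>prime p; \<And>i. i \<in> I \<Longrightarrow> f i \<in> Z_loc p\<rbrakk> \<Longrightarrow> sum f I \<in> Z_loc p"
  by (induction I rule: infinite_finite_induct) auto

text \<open>The ring is local: elements congruent to \<open>1\<close> modulo \<open>p\<close> are units.\<close>

lemma Z_loc_inverse:
  assumes p: "prime p" and "x \<in> Z_loc p"
  shows "1 - of_nat p * x \<noteq> 0" "1 / (1 - of_nat p * x) \<in> Z_loc p"
proof -
  obtain a b where x: "x = of_int a / of_int b" and nd: "\<not> int p dvd b"
    using assms(2) unfolding Z_loc_def by blast
  then have b: "b \<noteq> 0" by auto
  have eq: "1 - of_nat p * x = of_int (b - int p * a) / of_int b"
    using b by (simp add: x field_simps)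
  have nd': "\<not> int p dvd b - int p * a" using nd by (simp add: dvd_diff_left_iff)
  then have "b - int p * a \<noteq> 0" by (metis dvd_0_right)
  then show "1 - of_nat p * x \<noteq> 0" using b unfolding eq
    by (simp only: divide_eq_0_iff of_int_eq_0_iff) simp
  have "1 / (1 - of_nat p * x) = of_int b / of_int (b - int p * a)" unfolding eq by simp
  also have "\<dots> \<in> Z_loc p" using nd' by (rule Z_locI)
  finally show "1 / (1 - of_nat p * x) \<in> Z_loc p" .
qed

subsection \<open>Linear extension\<close>

lemma linear_ext_superset:
  assumes "finite K" "Poly_Mapping.keys a \<subseteq> K"
  shows "linear_ext h a = (\<Sum>c\<in>K. Poly_Mapping.lookup a c * h (SOME X. X \<in> c))"
  unfolding linear_ext_def using assms
  by (intro sum.mono_neutral_left) (auto simp: in_keys_iff)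

lemma linear_ext_add: "linear_ext h (a + b) = linear_ext h a + linear_ext h b"
proof -
  let ?K = "Poly_Mapping.keys a \<union> Poly_Mapping.keys b"
  have "linear_ext h c = (\<Sum>k\<in>?K. Poly_Mapping.lookup c k * h (SOME X. X \<in> k))"
    if "Poly_Mapping.keys c \<subseteq> ?K" for c
    using that by (intro linear_ext_superset) auto
  then show ?thesis
    using Poly_Mapping.keys_add[of a b] by (simp add: lookup_add distrib_right sum.distrib)
qed

lemma linear_ext_0 [simp]: "linear_ext h 0 = 0"
  by (simp add: linear_ext_def)

lemma linear_ext_uminus: "linear_ext h (- a) = - linear_ext h a"
  using linear_ext_add[of h a "- a"] by simp

lemma linear_ext_diff: "linear_ext h (a - b) = linear_ext h a - linear_ext h b"
  using linear_ext_add[of h a "- b"] by (simp add: linear_ext_uminus)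

lemma linear_ext_sum: "linear_ext h (sum f I) = (\<Sum>i\<in>I. linear_ext h (f i))"
  by (induction I rule: infinite_finite_induct) (auto simp: linear_ext_add)

lemma linear_ext_single [simp]:
  "linear_ext h (Poly_Mapping.single c q) = q * h (SOME X. X \<in> c)"
  by (simp add: linear_ext_def)

lemma linear_ext_scale: "linear_ext (\<lambda>X. r * h X) a = r * linear_ext h a"
  by (simp add: linear_ext_def sum_distrib_left mult_ac)

lemma linear_ext_sum_fun: "linear_ext (\<lambda>X. \<Sum>i\<in>I. h i X) a = (\<Sum>i\<in>I. linear_ext (h i) a)"
  unfolding linear_ext_def sum_distrib_left by (rule sum.swap)

lemma linear_ext_cong:
  assumes "a \<in> formal_sums p G" "\<And>X. is_gset G X \<Longrightarrow> h X = h' X"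
  shows "linear_ext h a = linear_ext h' a"
  unfolding linear_ext_def using assms some_iso_class(1)
  by (intro sum.cong refl) (fastforce simp: formal_sums_def)

text \<open>Evaluation of a stabilizer sum on formal sums; \<open>wsum G (contains D)\<close> counts
  \<open>D\<close>-fixed points.\<close>

abbreviation wsum :: "('g, 'm) monoid_scheme \<Rightarrow> ('g set \<Rightarrow> rat) \<Rightarrow> 'g formal_sum \<Rightarrow> rat" where
  "wsum G w \<equiv> linear_ext (stab_sum G w)"

lemma wsum_single:
  "is_gset G X \<Longrightarrow> wsum G w (Poly_Mapping.single (iso_class G X) q) = q * stab_sum G w X"
  by (simp add: stab_sum_some)

text \<open>Additivity of stabilizer sums makes them well defined on the Burnside module.\<close>

lemma wsum_relation:
  "a \<in> sum_relations p G \<Longrightarrow> wsum G w a = 0"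
proof (induction rule: sum_relations.induct)
  case (step a q X Y)
  then show ?case
    by (simp add: linear_ext_add linear_ext_diff wsum_single is_gset_sum stab_sum_gset_sum
        is_gset_finite algebra_simps del: linear_ext_single)
qed simp

lemma wsum_linear:
  "wsum G (\<lambda>U. r * w U) a = r * wsum G w a"
  "wsum G (\<lambda>U. \<Sum>i\<in>I. v i U) a = (\<Sum>i\<in>I. wsum G (v i) a)"
  unfolding stab_sum_mult stab_sum_sum by (rule linear_ext_scale linear_ext_sum_fun)+

subsection \<open>Formal sums and relations\<close>

lemma formal_sums_0 [simp]: "prime p \<Longrightarrow> 0 \<in> formal_sums p G"
  by (simp add: formal_sums_def)

lemma formal_sums_add:
  "\<lbrakk>prime p; a \<in> formal_sums p G; b \<in> formal_sums p G\<rbrakk> \<Longrightarrow> a + b \<in> formal_sums p G"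
  using Poly_Mapping.keys_add[of a b] by (auto simp: formal_sums_def lookup_add)

lemma formal_sums_uminus:
  "a \<in> formal_sums p G \<Longrightarrow> - a \<in> formal_sums p G"
  by (auto simp: formal_sums_def in_keys_iff)

lemma formal_sums_diff:
  "\<lbrakk>prime p; a \<in> formal_sums p G; b \<in> formal_sums p G\<rbrakk> \<Longrightarrow> a - b \<in> formal_sums p G"
  using formal_sums_add[of p a G "- b"] formal_sums_uminus by auto

lemma formal_sums_single:
  "\<lbrakk>prime p; c \<in> iso_classes G; q \<in> Z_loc p\<rbrakk> \<Longrightarrow> Poly_Mapping.single c q \<in> formal_sums p G"
  by (auto simp: formal_sums_def lookup_single when_def)

lemma formal_sums_sum:
  "\<lbrakk>prime p; \<And>i. i \<in> I \<Longrightarrow> f i \<in> formal_sums p G\<rbrakk> \<Longrightarrow> sum f I \<in> formal_sums p G"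
  by (induction I rule: infinite_finite_induct) (auto intro: formal_sums_add)

lemma sum_relations_add:
  assumes "b \<in> sum_relations p G" "a \<in> sum_relations p G"
  shows "a + b \<in> sum_relations p G"
  using assms
proof (induction rule: sum_relations.induct)
  case (step b q X Y)
  show ?case
    using sum_relations.step[OF step.IH[OF step.prems] step.hyps(2-4)] by (simp add: add.assoc)
qed simp

lemma sum_relations_uminus:
  assumes "a \<in> sum_relations p G"
  shows "- a \<in> sum_relations p G"
  using assms
proof (induction rule: sum_relations.induct)
  case (step b q X Y)
  have "- (b + (Poly_Mapping.single (iso_class G (gset_sum X Y)) q
      - Poly_Mapping.single (iso_class G X) q - Poly_Mapping.single (iso_class G Y) q)) =
    - b + (Poly_Mapping.single (iso_class G (gset_sum X Y)) (- q)
      - Poly_Mapping.single (iso_class G X) (- q) - Poly_Mapping.single (iso_class G Y) (- q))"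
    by (simp add: single_uminus)
  then show ?case
    using sum_relations.step[OF step.IH Z_loc_uminus[OF step.hyps(2)] step.hyps(3,4)] by metis
qed (simp add: sum_relations.zero)

text \<open>The generating relations only mention sets of natural numbers; they hold for \<open>G\<close>-sets on any
  types.\<close>

lemma relation_gset_sum:
  fixes X :: "('g, 'x) gset" and Y :: "('g, 'y) gset"
  assumes X: "is_gset G X" and Y: "is_gset G Y" and q: "q \<in> Z_loc p"
  shows "Poly_Mapping.single (iso_class G (gset_sum X Y)) q
      - Poly_Mapping.single (iso_class G X) q - Poly_Mapping.single (iso_class G Y) q
    \<in> sum_relations p G"
proof -
  obtain X' :: "('g, nat) gset" where X': "is_gset G X'" "gset_iso G X X'" using ex_nat_gset[OF X] .
  obtain Y' :: "('g, nat) gset" where Y': "is_gset G Y'" "gset_iso G Y Y'" using ex_nat_gset[OF Y] .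
  obtain f where f: "bij_betw f (pts X) (pts X')"
    and feq: "\<And>g x. g \<in> carrier G \<Longrightarrow> x \<in> pts X \<Longrightarrow> f (act X g x) = act X' g (f x)"
    using X'(2) unfolding gset_iso_def by blast
  obtain h where h: "bij_betw h (pts Y) (pts Y')"
    and heq: "\<And>g x. g \<in> carrier G \<Longrightarrow> x \<in> pts Y \<Longrightarrow> h (act Y g x) = act Y' g (h x)"
    using Y'(2) unfolding gset_iso_def by blast
  have inj: "inj_on (map_sum f h) (pts X <+> pts Y)"
    using bij_betw_imp_inj_on[OF f] bij_betw_imp_inj_on[OF h]
    by (intro inj_onI) (auto elim!: PlusE dest: inj_onD)
  have "map_sum f h ` (pts X <+> pts Y) = pts X' <+> pts Y'"
    unfolding bij_betw_imp_surj_on[OF f, symmetric] bij_betw_imp_surj_on[OF h, symmetric]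
    by (simp add: Plus_def image_Un image_image)
  then have "gset_iso G (gset_sum X Y) (gset_sum X' Y')"
    unfolding gset_iso_def using inj feq heq bij_betwE[OF f] bij_betwE[OF h]
    by (intro exI[of _ "map_sum f h"]) (auto simp: gset_sum_def bij_betw_def InlI InrI)
  then have "iso_class G (gset_sum X Y) = iso_class G (gset_sum X' Y')"
    using is_gset_sum[OF X Y] by (rule iso_class_eq)
  moreover have "iso_class G X = iso_class G X'" "iso_class G Y = iso_class G Y'"
    by (rule iso_class_eq[OF X'(2) X], rule iso_class_eq[OF Y'(2) Y])
  ultimately show ?thesis
    using sum_relations.step[OF sum_relations.zero q X'(1) Y'(1)] by simp
qed

subsection \<open>Decomposition into transitive sets\<close>

text \<open>Restriction of the action to a subset that is meant to be invariant.\<close>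

definition sub_gset :: "('g, 'x) gset \<Rightarrow> 'x set \<Rightarrow> ('g, 'x) gset" where
  "sub_gset X E = \<lparr>pts = E, act = (\<lambda>g. restrict (act X g) E)\<rparr>"

lemma is_gset_sub:
  assumes "is_gset G X" "E \<subseteq> pts X" "\<And>g x. g \<in> carrier G \<Longrightarrow> x \<in> E \<Longrightarrow> act X g x \<in> E"
  shows "is_gset G (sub_gset X E)"
  unfolding is_gset_def
proof (intro conjI)
  show "finite (pts (sub_gset X E))"
    using is_gset_finite[OF assms(1)] assms(2) by (auto simp: sub_gset_def intro: finite_subset)
  show "group_action G (pts (sub_gset X E)) (act (sub_gset X E))"
    using assms by (intro group_actionI)
      (auto simp: sub_gset_def gset_one gset_mult subset_iff intro: gset_group)
qed

lemma gset_iso_split: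
  assumes "E \<subseteq> pts X"
    and E: "\<And>g x. g \<in> carrier G \<Longrightarrow> x \<in> E \<Longrightarrow> act X g x \<in> E"
    and E': "\<And>g x. g \<in> carrier G \<Longrightarrow> x \<in> pts X - E \<Longrightarrow> act X g x \<in> pts X - E"
  shows "gset_iso G X (gset_sum (sub_gset X E) (sub_gset X (pts X - E)))"
proof -
  let ?f = "\<lambda>x. if x \<in> E then Inl x else Inr x"
  have "bij_betw ?f (pts X) (E <+> (pts X - E))"
    unfolding bij_betw_def using assms(1) by (auto simp: inj_on_def)
  moreover have "?f (act X g x) = act (gset_sum (sub_gset X E) (sub_gset X (pts X - E))) g (?f x)"
    if "g \<in> carrier G" "x \<in> pts X" for g x
    using E[of g x] E'[of g x] that by (auto simp: gset_sum_def sub_gset_def)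
  ultimately show ?thesis
    unfolding gset_iso_def by (intro exI[of _ ?f]) (auto simp: gset_sum_def sub_gset_def)
qed

lemma (in group) act_coset_rep:
  "\<lbrakk>U \<subseteq> carrier G; a \<in> carrier G; g \<in> carrier G\<rbrakk> \<Longrightarrow>
    act (coset_gset G U) g (a <# U) = (g \<otimes> a) <# U"
  by (subst act_coset_gset) (auto simp: LCOSETS_def lcos_m_assoc)

lemma gset_iso_orbit:
  assumes X: "is_gset G X" and x: "x \<in> pts X"
  shows "gset_iso G (coset_gset G (stabilizer G (act X) x)) (sub_gset X (orbit G (act X) x))"
proof -
  interpret group G using X by (rule gset_group)
  let ?U = "stabilizer G (act X) x"
  have U: "subgroup ?U G" using X x by (rule stabilizer_gset)
  have iff: "act X a x = act X b x \<longleftrightarrow> a <#\<^bsub>G\<^esub> ?U = b <#\<^bsub>G\<^esub> ?U" if ab: "a \<in> carrier G" "b \<in> carrier G" for a b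
  proof -
    have "a <#\<^bsub>G\<^esub> ?U = b <#\<^bsub>G\<^esub> ?U \<longleftrightarrow> act X (inv\<^bsub>G\<^esub> a) (act X b x) = x"
      unfolding l_coset_eq_iff[OF U ab] using ab X x by (simp add: stabilizer_def flip: gset_mult)
    also have "\<dots> \<longleftrightarrow> act X a x = act X b x"
      using ab X x by (metis gset_closed gset_inv)
    finally show ?thesis by simp
  qed
  define f where "f C = act X (SOME a. a \<in> carrier G \<and> C = a <#\<^bsub>G\<^esub> ?U) x" for C
  have f: "f (a <#\<^bsub>G\<^esub> ?U) = act X a x" if "a \<in> carrier G" for a
  proof -
    let ?b = "SOME b. b \<in> carrier G \<and> a <#\<^bsub>G\<^esub> ?U = b <#\<^bsub>G\<^esub> ?U"
    have "?b \<in> carrier G \<and> a <#\<^bsub>G\<^esub> ?U = ?b <#\<^bsub>G\<^esub> ?U" by (rule someI[of _ a]) (simp add: that)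
    then show ?thesis using iff[OF that, of ?b] by (simp add: f_def)
  qed
  show ?thesis unfolding gset_iso_def
  proof (intro exI[of _ f] conjI ballI)
    have "inj_on f (pts (coset_gset G ?U))"
      by (auto simp: inj_on_def pts_coset_gset f iff)
    moreover have "f ` pts (coset_gset G ?U) = orbit G (act X) x"
      by (force simp: pts_coset_gset orbit_def image_iff f)
    ultimately show "bij_betw f (pts (coset_gset G ?U)) (pts (sub_gset X (orbit G (act X) x)))"
      by (simp add: bij_betw_def sub_gset_def)
    fix g C assume g: "g \<in> carrier G" and "C \<in> pts (coset_gset G ?U)"
    then obtain a where a: "a \<in> carrier G" "C = a <#\<^bsub>G\<^esub> ?U" by (auto simp: pts_coset_gset)
    then have "act (coset_gset G ?U) g C = (g \<otimes>\<^bsub>G\<^esub> a) <#\<^bsub>G\<^esub> ?U"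
      using g subgroup.subset[OF U] by (simp add: act_coset_rep)
    then show "f (act (coset_gset G ?U) g C) = act (sub_gset X (orbit G (act X) x)) g (f C)"
      using a g X x by (auto simp: f sub_gset_def orbit_def gset_mult)
  qed
qed

definition trans_classes :: "('g, 'm) monoid_scheme \<Rightarrow> ('g, nat) gset set set" where
  "trans_classes G = {iso_class G (coset_gset G U) | U. subgroup U G}"

text \<open>Splitting off one orbit at a time.  The coefficient \<open>q\<close> is carried along so that no scalar
  multiplication of formal sums is needed.\<close>

lemma single_transitive:
  fixes X :: "('g, 'x) gset"
  assumes p: "prime p" and fin: "finite (carrier G)" and X: "is_gset G X" and q: "q \<in> Z_loc p"
  shows "\<exists>b\<in>formal_sums p G. Poly_Mapping.keys b \<subseteq> trans_classes G \<and>
    Poly_Mapping.single (iso_class G X) q - b \<in> sum_relations p G"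
  using X
proof (induction "card (pts X)" arbitrary: X rule: less_induct)
  case less
  interpret group G using less.prems by (rule gset_group)
  interpret X: group_action G "pts X" "act X" using less.prems by (rule is_gset_action)
  show ?case
  proof (cases "pts X = {}")
    case True
    have "gset_iso G (gset_sum X X) X"
        unfolding gset_iso_def using True by (auto simp: gset_sum_def bij_betw_def Plus_def)
    then have "iso_class G (gset_sum X X) = iso_class G X"
      using is_gset_sum[OF less.prems less.prems] by (rule iso_class_eq)
    then have "- Poly_Mapping.single (iso_class G X) q \<in> sum_relations p G"
      using relation_gset_sum[OF less.prems less.prems q] by simp
    from sum_relations_uminus[OF this] show ?thesis
      using p by (intro bexI[of _ 0]) auto
  next
    case False
    then obtain x where x: "x \<in> pts X" by blast
    let ?E = "orbit G (act X) x" and ?U = "stabilizer G (act X) x"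
    let ?Y = "sub_gset X ?E" and ?Z = "sub_gset X (pts X - orbit G (act X) x)"
    have E: "?E \<subseteq> pts X" using x by (auto simp: orbit_def X.element_image)
    have cl: "act X g y \<in> ?E" if "g \<in> carrier G" "y \<in> ?E" for g y
    proof -
      obtain h where h: "h \<in> carrier G" "y = act X h x" using \<open>y \<in> ?E\<close> by (auto simp: orbit_def)
      then have "act X g y = act X (g \<otimes>\<^bsub>G\<^esub> h) x" using that(1) x by (simp add: X.composition_rule)
      then show ?thesis using that(1) h(1) by (auto simp: orbit_def)
    qed
    have cl': "act X g y \<in> pts X - ?E" if g: "g \<in> carrier G" and y: "y \<in> pts X - ?E" for g y
    proof -
      have "act X g y \<notin> ?E"
        using cl[of "inv\<^bsub>G\<^esub> g" "act X g y"] gset_inv(1)[OF less.prems g, of y] g y by auto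
      then show ?thesis using g y less.prems by (simp add: gset_closed)
    qed
    have Y: "is_gset G ?Y" using less.prems E cl by (rule is_gset_sub)
    have Z: "is_gset G ?Z" using less.prems Diff_subset cl' by (rule is_gset_sub)
    have "x \<in> ?E" using x by (rule X.orbit_refl)
    then have "card (pts ?Z) < card (pts X)"
      using x is_gset_finite[OF less.prems] by (auto simp: sub_gset_def intro!: psubset_card_mono)
    from less.hyps[OF this Z] obtain b where b: "b \<in> formal_sums p G"
      "Poly_Mapping.keys b \<subseteq> trans_classes G"
      "Poly_Mapping.single (iso_class G ?Z) q - b \<in> sum_relations p G" by blast
    have U: "subgroup ?U G" using less.prems x by (rule stabilizer_gset)
    have cU: "is_gset G (coset_gset G ?U)" by (rule is_gset_coset[OF is_group fin U])
    have YU: "iso_class G ?Y = iso_class G (coset_gset G ?U)"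
      using iso_class_eq[OF gset_iso_orbit[OF less.prems x] cU] by simp
    have XS: "iso_class G X = iso_class G (gset_sum ?Y ?Z)"
      using iso_class_eq[OF gset_iso_split[OF E cl cl'] less.prems] by simp
    let ?b = "Poly_Mapping.single (iso_class G (coset_gset G ?U)) q + b"
    have "Poly_Mapping.single (iso_class G X) q - ?b \<in> sum_relations p G"
      using sum_relations_add[OF relation_gset_sum[OF Y Z q] b(3)]
      by (simp add: XS YU algebra_simps)
    moreover have "?b \<in> formal_sums p G"
      using formal_sums_single[OF p iso_class_in_iso_classes[OF cU] q] b(1) p
      by (intro formal_sums_add)
    moreover have "Poly_Mapping.keys ?b \<subseteq> trans_classes G"
      using Poly_Mapping.keys_add[of "Poly_Mapping.single (iso_class G (coset_gset G ?U)) q" b] b(2) U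
      by (auto simp: trans_classes_def split: if_splits)
    ultimately show ?thesis by blast
  qed
qed

lemma formal_sum_monomials:
  "a = (\<Sum>c\<in>Poly_Mapping.keys a. Poly_Mapping.single c (Poly_Mapping.lookup a c))"
proof (rule poly_mapping_eqI)
  fix k
  have "Poly_Mapping.lookup (\<Sum>c\<in>Poly_Mapping.keys a. Poly_Mapping.single c (Poly_Mapping.lookup a c)) k
      = (\<Sum>c\<in>Poly_Mapping.keys a. if c = k then Poly_Mapping.lookup a c else 0)"
    by (simp add: lookup_sum lookup_single when_def)
  also have "\<dots> = (if k \<in> Poly_Mapping.keys a then Poly_Mapping.lookup a k else 0)"
    by simp
  also have "\<dots> = Poly_Mapping.lookup a k" by (simp add: in_keys_iff)
  finally show "Poly_Mapping.lookup a k = Poly_Mapping.lookup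
      (\<Sum>c\<in>Poly_Mapping.keys a. Poly_Mapping.single c (Poly_Mapping.lookup a c)) k" by simp
qed

lemma formal_sum_transitive:
  fixes a :: "'g formal_sum"
  assumes p: "prime p" and fin: "finite (carrier G)" and a: "a \<in> formal_sums p G"
  shows "\<exists>b\<in>formal_sums p G. Poly_Mapping.keys b \<subseteq> trans_classes G \<and> a - b \<in> sum_relations p G"
proof -
  have "\<exists>b\<in>formal_sums p G. Poly_Mapping.keys b \<subseteq> trans_classes G \<and>
      Poly_Mapping.single c (Poly_Mapping.lookup a c) - b \<in> sum_relations p G"
    if c: "c \<in> Poly_Mapping.keys a" for c
  proof -
    have c': "c \<in> iso_classes G" and "Poly_Mapping.lookup a c \<in> Z_loc p"
      using a c by (auto simp: formal_sums_def)
    then show ?thesis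
      using single_transitive[OF p fin some_iso_class(1)[OF c']] some_iso_class(2)[OF c'] by simp
  qed
  then obtain b where b: "\<And>c. c \<in> Poly_Mapping.keys a \<Longrightarrow> b c \<in> formal_sums p G \<and>
      Poly_Mapping.keys (b c) \<subseteq> trans_classes G \<and>
      Poly_Mapping.single c (Poly_Mapping.lookup a c) - b c \<in> sum_relations p G" by metis
  let ?b = "\<Sum>c\<in>Poly_Mapping.keys a. b c"
  have "(\<Sum>c\<in>K. Poly_Mapping.single c (Poly_Mapping.lookup a c) - b c) \<in> sum_relations p G"
    if "finite K" "K \<subseteq> Poly_Mapping.keys a" for K
    using that by (induction K) (auto intro!: sum_relations.zero sum_relations_add[of _ p G "Poly_Mapping.single _ _ - b _"] simp: b)
  then have "a - ?b \<in> sum_relations p G"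
    by (subst formal_sum_monomials[of a]) (simp flip: sum_subtractf)
  moreover have "Poly_Mapping.keys ?b \<subseteq> trans_classes G"
    using Poly_Mapping.keys_sum[of b "Poly_Mapping.keys a"] b by blast
  moreover have "?b \<in> formal_sums p G" using b by (intro formal_sums_sum[OF p]) blast
  ultimately show ?thesis by blast
qed

lemma trans_classesE:
  assumes "c \<in> trans_classes G" "group G" "finite (carrier G)"
  obtains U where "subgroup U G" "c = iso_class G (coset_gset G U)"
    "\<And>w. stab_sum G w (SOME X. X \<in> c) = stab_sum G w (coset_gset G U)"
  using assms stab_sum_some[OF is_gset_coset[OF assms(2,3)]] unfolding trans_classes_def by blast

lemma (in group) conj_coset_iso_class:
  assumes fin: "finite (carrier G)" and U: "subgroup U G" and g: "g \<in> carrier G"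
  shows "iso_class G (coset_gset G (conj_set G g U)) = iso_class G (coset_gset G U)"
proof -
  let ?X = "coset_gset G U" and ?x = "g <# U"
  have X: "is_gset G ?X" by (rule is_gset_coset[OF is_group fin U])
  have x: "?x \<in> pts ?X" using g by (simp add: pts_coset_gset)
  have sub: "U \<subseteq> carrier G" using U by (rule subgroup.subset)
  have "orbit G (act ?X) ?x = pts ?X"
  proof
    show "orbit G (act ?X) ?x \<subseteq> pts ?X" using gset_closed[OF X _ x] by (auto simp: orbit_def)
    show "pts ?X \<subseteq> orbit G (act ?X) ?x"
    proof
      fix C assume "C \<in> pts ?X"
      then obtain a where a: "a \<in> carrier G" and C: "C = a <# U" by (auto simp: pts_coset_gset)
      have "act ?X (a \<otimes> inv g) ?x = C"
        using a g sub by (simp add: act_coset_rep C m_assoc)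
      then show "C \<in> orbit G (act ?X) ?x" using a g by (force simp: orbit_def)
    qed
  qed
  moreover have "gset_iso G (sub_gset ?X (pts ?X)) ?X"
    unfolding gset_iso_def by (intro exI[of _ id]) (auto simp: sub_gset_def)
  ultimately have "gset_iso G (coset_gset G (conj_set G g U)) ?X"
    using gset_iso_orbit[OF X x] gset_iso_trans unfolding stabilizer_coset[OF U g] by metis
  then show ?thesis
    by (rule iso_class_eq) (rule is_gset_coset[OF is_group fin subgroup_conj_set[OF g U]])
qed

text \<open>The table of marks is triangular with nonzero diagonal: \<open>G/V\<close> has a \<open>U\<close>-fixed point only
  if \<open>U\<close> is subconjugate to \<open>V\<close>.  At a subgroup \<open>U\<close> of maximal order in the support, only the
  class of \<open>G/U\<close> contributes.\<close>

lemma (in group) marks_separate_transitive: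
  assumes fin: "finite (carrier G)" and keys: "Poly_Mapping.keys b \<subseteq> trans_classes G"
    and zero: "\<And>D. subgroup D G \<Longrightarrow> wsum G (contains D) b = 0"
  shows "b = 0"
proof (rule ccontr)
  assume "b \<noteq> 0"
  let ?P = "\<lambda>U. subgroup U G \<and> iso_class G (coset_gset G U) \<in> Poly_Mapping.keys b"
  obtain c where "c \<in> Poly_Mapping.keys b"
    using \<open>b \<noteq> 0\<close> by (metis in_keys_iff lookup_zero poly_mapping_eqI)
  then obtain U0 where U0: "?P U0" using keys unfolding trans_classes_def by blast
  have "\<forall>U. ?P U \<longrightarrow> card U < Suc (card (carrier G))"
    using fin by (auto simp: less_Suc_eq_le intro!: card_mono subgroup.subset)
  from ex_has_greatest_nat[of ?P, OF U0 this]
  obtain U where U: "?P U" and max: "\<And>V. ?P V \<Longrightarrow> card V \<le> card U" by auto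
  let ?u = "iso_class G (coset_gset G U)"
  have other: "stab_sum G (contains U) (SOME X. X \<in> c) = 0" if c: "c \<in> Poly_Mapping.keys b" "c \<noteq> ?u" for c
  proof -
    obtain V where V: "subgroup V G" "c = iso_class G (coset_gset G V)"
      and eq: "stab_sum G (contains U) (SOME X. X \<in> c) = stab_sum G (contains U) (coset_gset G V)"
      using trans_classesE[OF subsetD[OF keys c(1)] is_group fin] by metis
    have sub: "V \<subseteq> carrier G" using V(1) by (rule subgroup.subset)
    have "\<not> U \<subseteq> conj_set G g V" if g: "g \<in> carrier G" for g
    proof
      assume *: "U \<subseteq> conj_set G g V"
      have "finite (conj_set G g V)" using conj_set_closed[OF g sub] fin by (rule finite_subset)
      moreover have "card (conj_set G g V) \<le> card U" using max V c(1) g sub by (simp add: card_conj_set)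
      ultimately have "U = conj_set G g V" using * card_seteq by metis
      then show False using conj_coset_iso_class[OF fin V(1) g] V(2) c(2) by simp
    qed
    then show ?thesis by (simp add: eq stab_sum_coset[OF fin V(1)])
  qed
  have sub: "U \<subseteq> carrier G" and Us: "subgroup U G" using U by (auto simp: subgroup.subset)
  have "wsum G (contains U) b = Poly_Mapping.lookup b ?u * stab_sum G (contains U) (SOME X. X \<in> ?u)"
  proof -
    have "wsum G (contains U) b = (\<Sum>c\<in>Poly_Mapping.keys b. if c = ?u then
        Poly_Mapping.lookup b ?u * stab_sum G (contains U) (SOME X. X \<in> ?u) else 0)"
      unfolding linear_ext_def by (intro sum.cong refl) (simp add: other)
    then show ?thesis using U by simp
  qed
  moreover have "stab_sum G (contains U) (SOME X. X \<in> ?u) \<noteq> 0"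
  proof -
    have "stab_sum G (contains U) (SOME X. X \<in> ?u) =
        (\<Sum>g\<in>carrier G. contains U (conj_set G g U)) / of_nat (card U)"
      by (simp add: stab_sum_some is_gset_coset is_group fin Us stab_sum_coset)
    moreover have "(\<Sum>g\<in>carrier G. contains U (conj_set G g U)) > 0"
      using fin sub by (intro sum_pos2[of _ \<one>]) auto
    moreover have "card U > 0" 
      using finite_subset[OF sub fin] subgroup.one_closed[OF Us] by (auto simp: card_gt_0_iff)
    ultimately show ?thesis by simp
  qed
  ultimately show False using zero[OF Us] U by (simp add: in_keys_iff)
qed

text \<open>Modulo the relations every formal sum is one of transitive sets, where triangularity applies.\<close>

lemma marks_separate:
  assumes p: "prime p" and G: "group G" and fin: "finite (carrier G)" and a: "a \<in> formal_sums p G"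
    and zero: "\<And>D. subgroup D G \<Longrightarrow> wsum G (contains D) a = 0"
  shows "a \<in> sum_relations p G"
proof -
  obtain b where b: "Poly_Mapping.keys b \<subseteq> trans_classes G" "a - b \<in> sum_relations p G"
    using formal_sum_transitive[OF p fin a] G by blast
  have "wsum G (contains D) b = 0" if "subgroup D G" for D
    using wsum_relation[OF b(2)] zero[OF that] by (simp add: linear_ext_diff)
  then have "b = 0" using group.marks_separate_transitive[OF G fin b(1)] by blast
  then show ?thesis using b(2) by simp
qed

subsection \<open>Classes and their marks\<close>

lemma burnside_rel_iff:
  assumes "prime p" "group G" "finite (carrier G)"
  shows "(a, b) \<in> burnside_rel p G \<longleftrightarrow> a \<in> formal_sums p G \<and> b \<in> formal_sums p G \<and>
    (\<forall>D. subgroup D G \<longrightarrow> wsum G (contains D) a = wsum G (contains D) b)"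
  using marks_separate[OF assms, of "a - b"] wsum_relation[of "a - b" p G] formal_sums_diff[OF assms(1)]
  by (auto simp: burnside_rel_def linear_ext_diff)

lemma burnside_class_eq_iff:
  assumes pG: "prime p" "group G" "finite (carrier G)"
    and ab: "a \<in> formal_sums p G" "b \<in> formal_sums p G"
  shows "burnside_class p G a = burnside_class p G b \<longleftrightarrow>
    (\<forall>D. subgroup D G \<longrightarrow> wsum G (contains D) a = wsum G (contains D) b)"
  using ab unfolding burnside_class_def by (auto simp: burnside_rel_iff[OF pG] set_eq_iff)

lemma burnside_iff:
  "A \<in> burnside p G \<longleftrightarrow> (\<exists>a\<in>formal_sums p G. A = burnside_class p G a)"
  by (auto simp: burnside_def burnside_class_def quotient_def)

lemma mem_burnside_class:
  "b \<in> burnside_class p G a \<longleftrightarrow>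
    a \<in> formal_sums p G \<and> b \<in> formal_sums p G \<and> a - b \<in> sum_relations p G"
  by (auto simp: burnside_class_def burnside_rel_def)

lemma burnside_class_self: "a \<in> formal_sums p G \<Longrightarrow> a \<in> burnside_class p G a"
  by (simp add: mem_burnside_class sum_relations.zero)

lemma wsum_burnside_class:
  "b \<in> burnside_class p G a \<Longrightarrow> wsum G w b = wsum G w a"
  using wsum_relation[of "a - b" p G w] by (simp add: mem_burnside_class linear_ext_diff)

lemma fixed_point_map_class:
  assumes a: "a \<in> formal_sums p G" and D: "D \<subseteq> carrier G"
  shows "fixed_point_map D (burnside_class p G a) = wsum G (contains D) a"
proof -
  have "linear_ext (\<lambda>X. of_nat (card (fixed_points D X))) b = wsum G (contains D) a"
    if "b \<in> burnside_class p G a" for b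
    using that card_fixed_points[OF is_gset_finite D] wsum_burnside_class[OF that]
      linear_ext_cong[of b p G "\<lambda>X. of_nat (card (fixed_points D X))" "stab_sum G (contains D)"]
    by (auto simp: mem_burnside_class)
  then have "linear_ext (\<lambda>X. of_nat (card (fixed_points D X))) ` burnside_class p G a =
      {wsum G (contains D) a}"
    using burnside_class_self[OF a] by auto
  then show ?thesis by (simp add: fixed_point_map_def)
qed

section \<open>Composition of bisets\<close>

text \<open>
  The stabilizer of the class of \<open>(y, x)\<close> in \<open>Y \<times>\<^sub>H X\<close> is the relational composite of the stabilizers of
  \<open>y\<close> and \<open>x\<close>, and the class of \<open>(y, x)\<close> has as many elements as \<open>H\<close> divided by the following
  intersection.  So every sum over stabilizers of \<open>Y \<times>\<^sub>H X\<close> is a double sum over the stabilizers of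
  \<open>Y\<close> and of \<open>X\<close>.\<close>

definition middle_stab ::
  "('g, 'l) monoid_scheme \<Rightarrow> ('h, 'm) monoid_scheme \<Rightarrow> ('k, 'n) monoid_scheme \<Rightarrow>
    ('k \<times> 'h) set \<Rightarrow> ('h \<times> 'g) set \<Rightarrow> 'h set" where
  "middle_stab G H K A B = {h \<in> carrier H. (\<one>\<^bsub>K\<^esub>, h) \<in> A \<and> (h, \<one>\<^bsub>G\<^esub>) \<in> B}"

definition comp_weight ::
  "('g, 'l) monoid_scheme \<Rightarrow> ('h, 'm) monoid_scheme \<Rightarrow> ('k, 'n) monoid_scheme \<Rightarrow>
    (('k \<times> 'g) set \<Rightarrow> rat) \<Rightarrow> ('k \<times> 'h) set \<Rightarrow> ('h \<times> 'g) set \<Rightarrow> rat" where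
  "comp_weight G H K w A B = w (A O B) * of_nat (card (middle_stab G H K A B)) / of_nat (order H)"

text \<open>In this locale \<open>mid\<close> is the action of the middle group whose orbits are the points of
  \<open>Y \<times>\<^sub>H X\<close>, and \<open>out\<close> is the remaining action of the two outer groups.\<close>

locale biset_pair =
  G: group G + H: group H + K: group K
  for G :: "('g, 'l) monoid_scheme" and H :: "('h, 'm) monoid_scheme"
    and K :: "('k, 'n) monoid_scheme" +
  fixes Y :: "('k \<times> 'h, 'y) gset" and X :: "('h \<times> 'g, 'x) gset"
  assumes Y: "is_gset (K \<times>\<times> H) Y" and X: "is_gset (H \<times>\<times> G) X" and finite_H: "finite (carrier H)"
begin

definition mid :: "'h \<Rightarrow> 'y \<times> 'x \<Rightarrow> 'y \<times> 'x" where
  "mid h = restrict (map_prod (act Y (\<one>\<^bsub>K\<^esub>, h)) (act X (h, \<one>\<^bsub>G\<^esub>))) (pts Y \<times> pts X)"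

definition out :: "'k \<times> 'g \<Rightarrow> 'y \<times> 'x \<Rightarrow> 'y \<times> 'x" where
  "out = (\<lambda>(k, g). map_prod (act Y (k, \<one>\<^bsub>H\<^esub>)) (act X (\<one>\<^bsub>H\<^esub>, g)))"

lemma Y_mult:
  "\<lbrakk>k \<in> carrier K; h \<in> carrier H; k' \<in> carrier K; h' \<in> carrier H; y \<in> pts Y\<rbrakk> \<Longrightarrow>
    act Y (k, h) (act Y (k', h') y) = act Y (k \<otimes>\<^bsub>K\<^esub> k', h \<otimes>\<^bsub>H\<^esub> h') y"
  using gset_mult[OF Y, of "(k, h)" "(k', h')" y] by simp

lemma X_mult:
  "\<lbrakk>h \<in> carrier H; g \<in> carrier G; h' \<in> carrier H; g' \<in> carrier G; x \<in> pts X\<rbrakk> \<Longrightarrow>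
    act X (h, g) (act X (h', g') x) = act X (h \<otimes>\<^bsub>H\<^esub> h', g \<otimes>\<^bsub>G\<^esub> g') x"
  using gset_mult[OF X, of "(h, g)" "(h', g')" x] by simp

lemma closed [simp]:
  "\<lbrakk>k \<in> carrier K; h \<in> carrier H; y \<in> pts Y\<rbrakk> \<Longrightarrow> act Y (k, h) y \<in> pts Y"
  "\<lbrakk>h \<in> carrier H; g \<in> carrier G; x \<in> pts X\<rbrakk> \<Longrightarrow> act X (h, g) x \<in> pts X"
  using gset_closed[OF Y] gset_closed[OF X] by simp_all

lemma act_one [simp]:
  "y \<in> pts Y \<Longrightarrow> act Y (\<one>\<^bsub>K\<^esub>, \<one>\<^bsub>H\<^esub>) y = y"
  "x \<in> pts X \<Longrightarrow> act X (\<one>\<^bsub>H\<^esub>, \<one>\<^bsub>G\<^esub>) x = x"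
  using gset_one[OF Y] gset_one[OF X] by simp_all

lemma mid_action: "group_action H (pts Y \<times> pts X) mid"
proof (rule group_actionI)
  show "group H" by (rule H.is_group)
  show "mid h \<in> extensional (pts Y \<times> pts X)" for h by (simp add: mid_def)
  show "mid h z \<in> pts Y \<times> pts X" if "h \<in> carrier H" "z \<in> pts Y \<times> pts X" for h z
    using that by (cases z) (simp add: mid_def)
  show "mid \<one>\<^bsub>H\<^esub> z = z" if "z \<in> pts Y \<times> pts X" for z
    using that by (cases z) (simp add: mid_def)
  show "mid (g \<otimes>\<^bsub>H\<^esub> h) z = mid g (mid h z)"
    if "g \<in> carrier H" "h \<in> carrier H" "z \<in> pts Y \<times> pts X" for g h z
    using that by (cases z) (simp add: mid_def Y_mult X_mult)
qed

lemma product_pts: "biset_product_pts G H K Y X = orbits H (pts Y \<times> pts X) mid"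
proof -
  have "orbit H (\<lambda>h. map_prod (act Y (\<one>\<^bsub>K\<^esub>, h)) (act X (h, \<one>\<^bsub>G\<^esub>))) z = orbit H mid z"
    if "z \<in> pts Y \<times> pts X" for z
    using that by (simp add: orbit_def mid_def)
  then show ?thesis unfolding biset_product_pts_def orbits_def Setcompr_eq_image
    by (intro image_cong) auto
qed

lemma out_orbit:
  assumes "t \<in> carrier (K \<times>\<times> G)" "z \<in> pts Y \<times> pts X"
  shows "out t ` orbit H mid z = orbit H mid (out t z)" "out t z \<in> pts Y \<times> pts X"
proof -
  show "out t z \<in> pts Y \<times> pts X" using assms by (auto simp: out_def)
  moreover have "out t (mid h z) = mid h (out t z)" if "h \<in> carrier H" for h
    using that assms by (auto simp: out_def mid_def Y_mult X_mult)
  ultimately show "out t ` orbit H mid z = orbit H mid (out t z)"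
    using assms by (force simp: orbit_def image_iff)
qed

lemma pts_biset_product: "pts (biset_product G H K Y X) = orbits H (pts Y \<times> pts X) mid"
  by (simp add: biset_product_def product_pts)

lemma act_biset_product:
  assumes "t \<in> carrier (K \<times>\<times> G)" "z \<in> pts Y \<times> pts X"
  shows "act (biset_product G H K Y X) t (orbit H mid z) = orbit H mid (out t z)"
proof -
  have "orbit H mid z \<in> biset_product_pts G H K Y X"
    using assms by (auto simp: product_pts orbits_def)
  then have "act (biset_product G H K Y X) t (orbit H mid z) = out t ` orbit H mid z"
    by (cases t) (simp add: biset_product_def out_def)
  then show ?thesis using out_orbit[OF assms] by simp
qed

lemma is_gset_biset_product: "is_gset (K \<times>\<times> G) (biset_product G H K Y X)"
  unfolding is_gset_def
proof (intro conjI group_actionI)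
  show "group (K \<times>\<times> G)" by (rule DirProd_group[OF K.is_group G.is_group])
  show "finite (pts (biset_product G H K Y X))"
    using is_gset_finite[OF Y] is_gset_finite[OF X]
    unfolding pts_biset_product orbits_def Setcompr_eq_image by simp
  show "act (biset_product G H K Y X) t \<in> extensional (pts (biset_product G H K Y X))" for t
    by (cases t) (simp add: biset_product_def)
  fix C assume "C \<in> pts (biset_product G H K Y X)"
  then obtain z where z: "z \<in> pts Y \<times> pts X" and C: "C = orbit H mid z"
    unfolding pts_biset_product orbits_def by blast
  show "act (biset_product G H K Y X) \<one>\<^bsub>K \<times>\<times> G\<^esub> C = C"
  proof -
    have "out \<one>\<^bsub>K \<times>\<times> G\<^esub> z = z" using z by (cases z) (simp add: out_def)
    moreover have "\<one>\<^bsub>K \<times>\<times> G\<^esub> \<in> carrier (K \<times>\<times> G)" by simp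
    note act_biset_product[OF this z]
    ultimately show ?thesis by (simp only: C)
  qed
  fix t assume t: "t \<in> carrier (K \<times>\<times> G)"
  show "act (biset_product G H K Y X) t C \<in> pts (biset_product G H K Y X)"
    unfolding C act_biset_product[OF t z] pts_biset_product orbits_def
    using out_orbit(2)[OF t z] by (intro CollectI exI conjI) (rule refl)
  show "act (biset_product G H K Y X) (t \<otimes>\<^bsub>K \<times>\<times> G\<^esub> u) C =
      act (biset_product G H K Y X) t (act (biset_product G H K Y X) u C)"
    if u: "u \<in> carrier (K \<times>\<times> G)" for u
  proof -
    have "t \<otimes>\<^bsub>K \<times>\<times> G\<^esub> u \<in> carrier (K \<times>\<times> G)" using t u by (auto simp: mult_DirProd')
    moreover have "out (t \<otimes>\<^bsub>K \<times>\<times> G\<^esub> u) z = out t (out u z)"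
      using t u z by (auto simp: out_def Y_mult X_mult)
    ultimately show ?thesis
      by (simp only: C act_biset_product[OF _ z] act_biset_product[OF t out_orbit(2)[OF u z]]
          u)
  qed
qed

text \<open>\<open>(k, g)\<close> fixes the orbit of \<open>(y, x)\<close> iff some \<open>h\<close> moves \<open>(k, g).(y, x)\<close> back to \<open>(y, x)\<close>, that is,
  \<open>(k, h)\<close> fixes \<open>y\<close> and \<open>(h, g)\<close> fixes \<open>x\<close>.\<close>

lemma stabilizer_biset_product:
  assumes y: "y \<in> pts Y" and x: "x \<in> pts X"
  shows "stabilizer (K \<times>\<times> G) (act (biset_product G H K Y X)) (orbit H mid (y, x)) =
    stabilizer (K \<times>\<times> H) (act Y) y O stabilizer (H \<times>\<times> G) (act X) x"
proof -
  interpret mid: group_action H "pts Y \<times> pts X" mid by (rule mid_action)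
  have yx: "(y, x) \<in> pts Y \<times> pts X" using y x by simp
  have *: "orbit H mid (out (k, g) (y, x)) = orbit H mid (y, x) \<longleftrightarrow>
      (\<exists>h\<in>carrier H. act Y (k, h) y = y \<and> act X (h, g) x = x)"
    if k: "k \<in> carrier K" and g: "g \<in> carrier G" for k g
  proof -
    have z: "out (k, g) (y, x) \<in> pts Y \<times> pts X" using k g yx by (intro out_orbit) auto
    have "orbit H mid (out (k, g) (y, x)) = orbit H mid (y, x) \<longleftrightarrow>
        (y, x) \<in> orbit H mid (out (k, g) (y, x))"
      using mid.orbit_eq_iff[OF yx z] by auto
    also have "\<dots> \<longleftrightarrow> (\<exists>h\<in>carrier H. mid h (out (k, g) (y, x)) = (y, x))"
      unfolding orbit_def mem_Collect_eq by metis
    also have "\<dots> \<longleftrightarrow> (\<exists>h\<in>carrier H. act Y (k, h) y = y \<and> act X (h, g) x = x)"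
      using k g x y by (auto simp: mid_def out_def Y_mult X_mult)
    finally show ?thesis .
  qed
  have "(k, g) \<in> stabilizer (K \<times>\<times> G) (act (biset_product G H K Y X)) (orbit H mid (y, x)) \<longleftrightarrow>
      (k, g) \<in> stabilizer (K \<times>\<times> H) (act Y) y O stabilizer (H \<times>\<times> G) (act X) x" for k g
    using act_biset_product[OF _ yx, of "(k, g)"] *[of k g]
    by (cases "k \<in> carrier K \<and> g \<in> carrier G") (simp_all add: stabilizer_def relcomp_unfold, blast+)
  then show ?thesis by auto
qed

text \<open>The sum over orbits becomes a sum over all pairs \<open>(y, x)\<close> when each pair is weighted by the
  reciprocal of its orbit length, which is \<open>|middle_stab| / |H|\<close>.\<close>

lemma stab_sum_biset_product:
  "stab_sum (K \<times>\<times> G) w (biset_product G H K Y X) =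
    stab_sum (K \<times>\<times> H) (\<lambda>A. stab_sum (H \<times>\<times> G) (\<lambda>B. comp_weight G H K w A B) X) Y"
proof -
  interpret mid: group_action H "pts Y \<times> pts X" mid by (rule mid_action)
  let ?E = "pts Y \<times> pts X"
  let ?s = "\<lambda>C. w (stabilizer (K \<times>\<times> G) (act (biset_product G H K Y X)) C)"
  have finE: "finite ?E" using is_gset_finite[OF Y] is_gset_finite[OF X] by simp
  have "stab_sum (K \<times>\<times> G) w (biset_product G H K Y X) = (\<Sum>C\<in>orbits H ?E mid. ?s C)"
    by (simp add: stab_sum_def pts_biset_product)
  also have "\<dots> = (\<Sum>C\<in>orbits H ?E mid. \<Sum>z\<in>C. ?s (orbit H mid z) / of_nat (card (orbit H mid z)))"
  proof (rule sum.cong[OF refl])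
    fix C assume "C \<in> orbits H ?E mid"
    then obtain z where z: "z \<in> ?E" "C = orbit H mid z" unfolding orbits_def by blast
    have "orbit H mid z' = C" if z': "z' \<in> C" for z'
    proof -
      have "z' \<in> ?E" using z z' mid.orbit_subset by blast
      from mid.orbit_eq_iff[OF this z(1)] show ?thesis using z z' by simp
    qed
    then have "(\<Sum>z\<in>C. ?s (orbit H mid z) / of_nat (card (orbit H mid z))) =
        (\<Sum>z\<in>C. ?s C / of_nat (card C))" by (intro sum.cong) auto
    also have "\<dots> = ?s C"
    proof -
      have "finite C" using finite_H unfolding z(2) orbit_def by simp
      then have "card C \<noteq> 0" using mid.orbit_refl[OF z(1)] by (auto simp: z(2))
      then show ?thesis by simp
    qed
    finally show "?s C = (\<Sum>z\<in>C. ?s (orbit H mid z) / of_nat (card (orbit H mid z)))" by simp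
  qed
  also have "\<dots> = (\<Sum>z\<in>?E. ?s (orbit H mid z) / of_nat (card (orbit H mid z)))"
    by (rule mid.disjoint_sum[OF finE])
  also have "\<dots> = (\<Sum>(y, x)\<in>?E. comp_weight G H K w
      (stabilizer (K \<times>\<times> H) (act Y) y) (stabilizer (H \<times>\<times> G) (act X) x))"
  proof (rule sum.cong[OF refl], clarify)
    fix y x assume y: "y \<in> pts Y" and x: "x \<in> pts X"
    let ?O = "orbit H mid (y, x)" and ?S = "stabilizer H mid (y, x)"
    have "card ?O * card ?S = order H" using x y by (intro mid.orbit_stabilizer_theorem) auto
    moreover have "?S = middle_stab G H K (stabilizer (K \<times>\<times> H) (act Y) y) (stabilizer (H \<times>\<times> G) (act X) x)"
      using x y by (auto simp: stabilizer_def middle_stab_def mid_def)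
    moreover have "order H > 0" using finite_H H.order_gt_0_iff_finite by simp
    ultimately have eq: "of_nat (card ?O) * of_nat (card (middle_stab G H K
        (stabilizer (K \<times>\<times> H) (act Y) y) (stabilizer (H \<times>\<times> G) (act X) x))) = (of_nat (order H) :: rat)"
      and pos: "of_nat (order H) > (0 :: rat)"
      by (simp_all flip: of_nat_mult)
    then have "of_nat (card ?O) \<noteq> (0 :: rat)" by (metis mult_zero_left less_irrefl)
    then have "1 / of_nat (card ?O) = (of_nat (card (middle_stab G H K
        (stabilizer (K \<times>\<times> H) (act Y) y) (stabilizer (H \<times>\<times> G) (act X) x))) / of_nat (order H) :: rat)"
      using pos unfolding eq[symmetric] by (simp add: zero_less_mult_iff)
    then show "?s ?O / of_nat (card ?O) = comp_weight G H K w
        (stabilizer (K \<times>\<times> H) (act Y) y) (stabilizer (H \<times>\<times> G) (act X) x)"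
      by (simp add: comp_weight_def stabilizer_biset_product[OF y x] divide_inverse)
  qed
  also have "\<dots> = stab_sum (K \<times>\<times> H) (\<lambda>A. stab_sum (H \<times>\<times> G) (\<lambda>B. comp_weight G H K w A B) X) Y"
    by (simp add: stab_sum_def sum.cartesian_product)
  finally show ?thesis .
qed

end

locale three_groups =
  G: group G + H: group H + K: group K
  for G :: "('g, 'l) monoid_scheme" and H :: "('h, 'm) monoid_scheme"
    and K :: "('k, 'n) monoid_scheme" +
  fixes p :: nat
  assumes prime: "prime p" and fin: "finite (carrier G)" "finite (carrier H)" "finite (carrier K)"
begin

lemma groups: "group (K \<times>\<times> G)" "group (K \<times>\<times> H)" "group (H \<times>\<times> G)"
  by (simp_all add: DirProd_group)

lemma product_of_classes:
  assumes "d \<in> iso_classes (K \<times>\<times> H)" "c \<in> iso_classes (H \<times>\<times> G)"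
  shows "is_gset (K \<times>\<times> G) (biset_product G H K (SOME Y. Y \<in> d) (SOME X. X \<in> c))"
proof -
  interpret biset_pair G H K "SOME Y. Y \<in> d" "SOME X. X \<in> c"
    using some_iso_class(1)[OF assms(1)] some_iso_class(1)[OF assms(2)] fin by unfold_locales
  show ?thesis by (rule is_gset_biset_product)
qed

lemma formal_comp_closed:
  assumes "b \<in> formal_sums p (K \<times>\<times> H)" "a \<in> formal_sums p (H \<times>\<times> G)"
  shows "formal_comp G H K b a \<in> formal_sums p (K \<times>\<times> G)"
  unfolding formal_comp_def using assms prime
  by (intro formal_sums_sum formal_sums_single iso_class_in_iso_classes product_of_classes Z_loc_mult)
    (auto simp: formal_sums_def)

lemma wsum_formal_comp:
  assumes b: "b \<in> formal_sums p (K \<times>\<times> H)" and a: "a \<in> formal_sums p (H \<times>\<times> G)"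
  shows "wsum (K \<times>\<times> G) w (formal_comp G H K b a) =
    wsum (K \<times>\<times> H) (\<lambda>A. wsum (H \<times>\<times> G) (\<lambda>B. comp_weight G H K w A B) a) b"
proof -
  let ?s = "stab_sum (K \<times>\<times> G) w"
  have kb: "Poly_Mapping.keys b \<subseteq> iso_classes (K \<times>\<times> H)" and ka: "Poly_Mapping.keys a \<subseteq> iso_classes (H \<times>\<times> G)"
    using a b by (auto simp: formal_sums_def)
  have "wsum (K \<times>\<times> G) w (formal_comp G H K b a) =
      (\<Sum>d\<in>Poly_Mapping.keys b. \<Sum>c\<in>Poly_Mapping.keys a. Poly_Mapping.lookup b d * Poly_Mapping.lookup a c *
        ?s (biset_product G H K (SOME Y. Y \<in> d) (SOME X. X \<in> c)))"
    unfolding formal_comp_def linear_ext_sum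
    using kb ka by (intro sum.cong refl wsum_single product_of_classes) auto
  also have "\<dots> = (\<Sum>d\<in>Poly_Mapping.keys b. Poly_Mapping.lookup b d *
      wsum (H \<times>\<times> G) (\<lambda>B. stab_sum (K \<times>\<times> H) (\<lambda>A. comp_weight G H K w A B) (SOME Y. Y \<in> d)) a)"
  proof (rule sum.cong[OF refl])
    fix d assume d: "d \<in> Poly_Mapping.keys b"
    have "?s (biset_product G H K (SOME Y. Y \<in> d) (SOME X. X \<in> c)) = stab_sum (H \<times>\<times> G)
        (\<lambda>B. stab_sum (K \<times>\<times> H) (\<lambda>A. comp_weight G H K w A B) (SOME Y. Y \<in> d)) (SOME X. X \<in> c)"
      if c: "c \<in> Poly_Mapping.keys a" for c
    proof -
      interpret biset_pair G H K "SOME Y. Y \<in> d" "SOME X. X \<in> c"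
        using some_iso_class(1)[OF subsetD[OF kb d]] some_iso_class(1)[OF subsetD[OF ka c]] fin
        by unfold_locales
      show ?thesis unfolding stab_sum_biset_product by (simp add: stab_sum_def sum.swap[of _ "pts (SOME Y. Y \<in> d)"])
    qed
    then show "(\<Sum>c\<in>Poly_Mapping.keys a. Poly_Mapping.lookup b d * Poly_Mapping.lookup a c *
        ?s (biset_product G H K (SOME Y. Y \<in> d) (SOME X. X \<in> c))) = Poly_Mapping.lookup b d *
      wsum (H \<times>\<times> G) (\<lambda>B. stab_sum (K \<times>\<times> H) (\<lambda>A. comp_weight G H K w A B) (SOME Y. Y \<in> d)) a"
      by (simp add: linear_ext_def sum_distrib_left mult.assoc)
  qed
  also have "\<dots> = wsum (K \<times>\<times> H) (\<lambda>A. wsum (H \<times>\<times> G) (\<lambda>B. comp_weight G H K w A B) a) b"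
    unfolding linear_ext_def[of _ b] unfolding stab_sum_def[of "K \<times>\<times> H"] by (simp add: wsum_linear)
  finally show ?thesis .
qed

text \<open>The marks of a composite are double stabilizer sums over the factors, so they do not
  depend on the representatives.  Since marks separate classes, the union that defines
  \<open>burnside_comp\<close> is a single class.\<close>

lemma burnside_comp_class:
  assumes b: "b \<in> formal_sums p (K \<times>\<times> H)" and a: "a \<in> formal_sums p (H \<times>\<times> G)"
  shows "burnside_comp p G H K (burnside_class p (K \<times>\<times> H) b) (burnside_class p (H \<times>\<times> G) a) =
    burnside_class p (K \<times>\<times> G) (formal_comp G H K b a)"
proof -
  have finKG: "finite (carrier (K \<times>\<times> G))" using fin by simp
  have "burnside_class p (K \<times>\<times> G) (formal_comp G H K b' a') = burnside_class p (K \<times>\<times> G) (formal_comp G H K b a)"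
    if b': "b' \<in> burnside_class p (K \<times>\<times> H) b" and a': "a' \<in> burnside_class p (H \<times>\<times> G) a" for a' b'
  proof -
    have fs: "b' \<in> formal_sums p (K \<times>\<times> H)" "a' \<in> formal_sums p (H \<times>\<times> G)"
      using a' b' by (auto simp: mem_burnside_class)
    show ?thesis
      using burnside_class_eq_iff[OF prime groups(1) finKG] formal_comp_closed a b fs
      by (simp add: wsum_formal_comp wsum_burnside_class[OF a'] wsum_burnside_class[OF b'])
  qed
  then show ?thesis
    unfolding burnside_comp_def using burnside_class_self[OF b] burnside_class_self[OF a] by blast
qed

end

section \<open>Morphisms and graphs in a fusion system\<close>

locale fusion = group S for S :: "('a, 'm) monoid_scheme" (structure) +
  fixes F :: "'a fusion"
  assumes finite_S: "finite (carrier S)" and fusion: "fusion_system S F"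
begin

text \<open>Every morphism is a morphism into \<open>S\<close>, and it may be corestricted to any subgroup that contains
  its image (\<open>mor_in_F\<close>); so the sets \<open>F P S\<close> carry all information.\<close>

definition mor :: "'a set \<Rightarrow> ('a \<Rightarrow> 'a) set" where
  "mor P = F P (carrier S)"

abbreviation sub :: "'a set \<Rightarrow> bool" where "sub P \<equiv> subgroup P S"

lemma F_in_inj_homs: "\<lbrakk>sub P; sub Q; \<phi> \<in> F P Q\<rbrakk> \<Longrightarrow> \<phi> \<in> inj_homs S P Q"
  using fusion unfolding fusion_system_def by blast

lemma F_comp: "\<lbrakk>sub P; sub Q; sub R; \<phi> \<in> F P Q; \<psi> \<in> F Q R\<rbrakk> \<Longrightarrow> compose P \<psi> \<phi> \<in> F P R"
  using fusion unfolding fusion_system_def by blast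

lemma F_image: "\<lbrakk>sub P; sub Q; \<phi> \<in> F P Q\<rbrakk> \<Longrightarrow> \<phi> \<in> F P (\<phi> ` P)"
  using fusion unfolding fusion_system_def by blast

lemma F_inverse:
  "\<lbrakk>sub P; sub Q; \<phi> \<in> F P Q\<rbrakk> \<Longrightarrow> restrict (inv_into P \<phi>) (\<phi> ` P) \<in> F (\<phi> ` P) P"
  using fusion unfolding fusion_system_def by blast

lemma F_conj:
  assumes "sub P" "sub Q" "x \<in> carrier S" "conj_map S x ` P \<subseteq> Q"
  shows "restrict (conj_map S x) P \<in> F P Q"
proof -
  have "trivial_fusion S P Q \<subseteq> F P Q" using assms(1,2) fusion unfolding fusion_system_def by blast
  then show ?thesis using assms(3,4) unfolding trivial_fusion_def by blast
qed

lemma F_inclusion: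
  assumes "sub P" "sub Q" "P \<subseteq> Q"
  shows "restrict id P \<in> F P Q"
proof -
  have eq: "conj_map S \<one> u = u" if "u \<in> P" for u using that subgroup.mem_carrier[OF assms(1)] by simp
  then have "restrict (conj_map S \<one>) P = restrict id P" by (auto simp: restrict_def)
  moreover have "conj_map S \<one> ` P \<subseteq> Q" using eq assms(3) by auto
  ultimately show ?thesis using F_conj[OF assms(1,2) one_closed] by simp
qed

lemma sub_carrier [simp]: "sub (carrier S)"
  by (rule subgroup_self)

lemma F_hom:
  assumes "sub P" "sub Q" "\<phi> \<in> F P Q"
  shows "\<And>u v. \<lbrakk>u \<in> P; v \<in> P\<rbrakk> \<Longrightarrow> \<phi> (u \<otimes> v) = \<phi> u \<otimes> \<phi> v" "\<And>u. u \<in> P \<Longrightarrow> \<phi> u \<in> Q"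
    "inj_on \<phi> P" "\<phi> \<in> extensional P"
  using F_in_inj_homs[OF assms] by (auto simp: inj_homs_def mon_def hom_def)

lemmas mor_hom = F_hom(1)[OF _ sub_carrier, folded mor_def]
lemmas mor_closed = F_hom(2)[OF _ sub_carrier, folded mor_def]
lemmas mor_inj = F_hom(3)[OF _ sub_carrier, folded mor_def]
lemmas mor_ext = F_hom(4)[OF _ sub_carrier, folded mor_def]

lemma sub_closed: "\<lbrakk>sub P; u \<in> P\<rbrakk> \<Longrightarrow> u \<in> carrier S"
  by (rule subgroup.mem_carrier)

lemma finite_sub: "sub P \<Longrightarrow> finite P"
  by (rule finite_subset[OF subgroup.subset finite_S])

lemma mor_group_hom:
  assumes "sub P" "\<phi> \<in> mor P"
  shows "group_hom (S\<lparr>carrier := P\<rparr>) S \<phi>"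
  using assms mor_hom[OF assms] mor_closed[OF assms]
  by (auto simp: group_hom_def group_hom_axioms_def subgroup_imp_group hom_def)

lemma mor_one: "\<lbrakk>sub P; \<phi> \<in> mor P\<rbrakk> \<Longrightarrow> \<phi> \<one> = \<one>"
  using group_hom.hom_one[OF mor_group_hom] by simp

lemma mor_inv: "\<lbrakk>sub P; \<phi> \<in> mor P; u \<in> P\<rbrakk> \<Longrightarrow> \<phi> (inv u) = inv (\<phi> u)"
  using group_hom.hom_inv[OF mor_group_hom] by (simp add: m_inv_consistent)

lemma mor_image: 
  assumes "sub P" "\<phi> \<in> mor P"
  shows "sub (\<phi> ` P)"
  using group_hom.img_is_subgroup[OF mor_group_hom[OF assms]] by simp

lemma F_subset_mor:
  assumes "sub P" "sub Q" "\<phi> \<in> F P Q"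
  shows "\<phi> \<in> mor P"
proof -
  have "compose P (restrict id Q) \<phi> \<in> F P (carrier S)"
    using assms by (intro F_comp[of _ Q] F_inclusion subgroup.subset) auto
  moreover have "compose P (restrict id Q) \<phi> = \<phi>"
    using F_hom(2,4)[OF assms] by (intro extensionalityI[of _ P]) (auto simp: compose_def)
  ultimately show ?thesis by (simp add: mor_def)
qed

lemma mor_in_F:
  assumes "sub P" "sub Q" "\<phi> \<in> mor P" "\<phi> ` P \<subseteq> Q"
  shows "\<phi> \<in> F P Q"
proof -
  have im: "sub (\<phi> ` P)" "\<phi> \<in> F P (\<phi> ` P)"
    using assms mor_image F_image[OF assms(1) sub_carrier] by (auto simp: mor_def)
  have "compose P (restrict id (\<phi> ` P)) \<phi> \<in> F P Q"
    using assms im by (intro F_comp[of _ "\<phi> ` P"] F_inclusion) auto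
  moreover have "compose P (restrict id (\<phi> ` P)) \<phi> = \<phi>"
    using mor_ext[OF assms(1,3)] by (intro extensionalityI[of _ P]) (auto simp: compose_def)
  ultimately show ?thesis by simp
qed

lemma mor_comp:
  assumes "sub P" "sub Q" "\<phi> \<in> mor P" "\<phi> ` P \<subseteq> Q" "\<psi> \<in> mor Q"
  shows "compose P \<psi> \<phi> \<in> mor P"
  using F_comp[OF assms(1,2) sub_carrier mor_in_F[OF assms(1-4)]] assms(5) by (simp add: mor_def)

lemma mor_restrict:
  assumes "sub P" "sub Q" "Q \<subseteq> P" "restrict \<phi> P \<in> mor P"
  shows "restrict \<phi> Q \<in> mor Q"
proof -
  have "compose Q (restrict \<phi> P) (restrict id Q) \<in> F Q (carrier S)"
    using assms by (intro F_comp[of _ P] F_inclusion) (auto simp: mor_def)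
  moreover have "compose Q (restrict \<phi> P) (restrict id Q) = restrict \<phi> Q"
    using assms(3) by (intro extensionalityI[of _ Q]) (auto simp: compose_def)
  ultimately show ?thesis by (simp add: mor_def)
qed

lemma mor_restrict_self: "\<lbrakk>sub P; \<phi> \<in> mor P\<rbrakk> \<Longrightarrow> restrict \<phi> P = \<phi>"
  by (rule extensional_restrict[OF mor_ext])

lemma mor_inverse:
  assumes "sub P" "\<phi> \<in> mor P"
  shows "restrict (inv_into P \<phi>) (\<phi> ` P) \<in> mor (\<phi> ` P)"
  using F_subset_mor[OF mor_image[OF assms] assms(1) F_inverse[OF assms(1) sub_carrier]] assms(2)
  by (simp add: mor_def)

lemma mor_conj: "\<lbrakk>sub P; x \<in> carrier S\<rbrakk> \<Longrightarrow> restrict (conj_map S x) P \<in> mor P"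
  unfolding mor_def using sub_closed[of P] by (intro F_conj) auto

lemma mor_id: "sub P \<Longrightarrow> restrict id P \<in> mor P"
  unfolding mor_def by (intro F_inclusion subgroup.subset) auto

lemma finite_mor:
  assumes "sub P"
  shows "finite (mor P)"
proof (rule finite_subset)
  show "mor P \<subseteq> P \<rightarrow>\<^sub>E carrier S"
    using mor_closed[OF assms] mor_ext[OF assms] by (auto simp: PiE_def)
  show "finite (P \<rightarrow>\<^sub>E carrier S)" by (intro finite_PiE finite_sub assms finite_S)
qed

lemma card_mor_pos: "sub P \<Longrightarrow> card (mor P) > 0"
  using mor_id finite_mor by (auto simp: card_gt_0_iff)

lemma inj_on_compose: 
  assumes "A \<subseteq> extensional (\<phi> ` P)"
  shows "inj_on (\<lambda>\<psi>. compose P \<psi> \<phi>) A"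
proof (rule inj_onI)
  fix \<psi> \<psi>' assume \<psi>: "\<psi> \<in> A" "\<psi>' \<in> A" and eq: "compose P \<psi> \<phi> = compose P \<psi>' \<phi>"
  have "\<psi> (\<phi> u) = \<psi>' (\<phi> u)" if "u \<in> P" for u
    using fun_cong[OF eq, of u] that by (simp add: compose_eq)
  then show "\<psi> = \<psi>'" using assms \<psi> by (intro extensionalityI[of _ "\<phi> ` P"]) auto
qed

lemma card_mor_le:
  assumes P: "sub P" and \<phi>: "\<phi> \<in> mor P"
  shows "card (mor (\<phi> ` P)) \<le> card (mor P)"
proof (rule card_inj_on_le)
  show "inj_on (\<lambda>\<psi>. compose P \<psi> \<phi>) (mor (\<phi> ` P))"
    using mor_ext[OF mor_image[OF P \<phi>]] by (intro inj_on_compose) auto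
  show "(\<lambda>\<psi>. compose P \<psi> \<phi>) ` mor (\<phi> ` P) \<subseteq> mor P"
    using mor_comp[OF P mor_image[OF P \<phi>] \<phi> subset_refl] by auto
qed (rule finite_mor[OF P])

lemma inv_image:
  assumes "sub P" "\<phi> \<in> mor P"
  shows "restrict (inv_into P \<phi>) (\<phi> ` P) ` \<phi> ` P = P"
  using inv_into_image_cancel[OF mor_inj[OF assms] subset_refl] by (simp cong: image_cong)

text \<open>Precomposition with \<open>\<phi>\<close> embeds the morphisms from \<open>\<phi>(P)\<close> into those from \<open>P\<close>, and \<open>\<phi>\<^sup>-\<^sup>1\<close> gives the
  reverse inequality.\<close>

lemma card_mor_iso:
  assumes "sub P" "\<phi> \<in> mor P"
  shows "card (mor (\<phi> ` P)) = card (mor P)"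
  using card_mor_le[OF assms] card_mor_le[OF mor_image mor_inverse, OF assms assms]
  unfolding inv_image[OF assms] by simp

lemma fconj_class_iff:
  assumes P: "sub P"
  shows "Q \<in> fconj_class S F P \<longleftrightarrow> (\<exists>\<phi>\<in>mor P. \<phi> ` P = Q)"
proof
  assume "Q \<in> fconj_class S F P"
  then obtain \<phi> \<psi> where Q: "sub Q" and \<phi>: "\<phi> \<in> F P Q" and \<psi>: "\<psi> \<in> F Q P" and eq: "\<forall>y\<in>Q. \<phi> (\<psi> y) = y"
    unfolding fconj_class_def by blast
  have "\<phi> ` P = Q"
    using F_hom(2)[OF P Q \<phi>] F_hom(2)[OF Q P \<psi>] eq by (force simp: image_iff)
  then show "\<exists>\<phi>\<in>mor P. \<phi> ` P = Q" using F_subset_mor[OF P Q \<phi>] by blast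
next
  assume "\<exists>\<phi>\<in>mor P. \<phi> ` P = Q"
  then obtain \<phi> where \<phi>: "\<phi> \<in> mor P" and Q: "Q = \<phi> ` P" by blast
  have "\<phi> \<in> F P Q" "restrict (inv_into P \<phi>) Q \<in> F Q P"
    using F_image[OF P sub_carrier] F_inverse[OF P sub_carrier] \<phi> by (auto simp: mor_def Q)
  moreover have "\<forall>u\<in>P. restrict (inv_into P \<phi>) Q (\<phi> u) = u" "\<forall>y\<in>Q. \<phi> (restrict (inv_into P \<phi>) Q y) = y"
    using mor_inj[OF P \<phi>] by (auto simp: Q)
  ultimately show "Q \<in> fconj_class S F P"
    using mor_image[OF P \<phi>] unfolding fconj_class_def Q by blast
qed

subsection \<open>Graphs of morphisms\<close>

abbreviation T :: "('a \<times> 'a) monoid" where "T \<equiv> S \<times>\<times> S"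

lemma group_T: "group T"
  by (simp add: DirProd_group)

lemma finite_T: "finite (carrier T)"
  using finite_S by simp

definition graphs :: "('a \<times> 'a) set set" where
  "graphs = {twisted_diag P \<phi> | P \<phi>. sub P \<and> \<phi> \<in> mor P}"

lemma twisted_diag_eq_image: "twisted_diag P \<phi> = (\<lambda>u. (\<phi> u, u)) ` P"
  by (auto simp: twisted_diag_def)

lemma snd_twisted_diag [simp]: "snd ` twisted_diag P \<phi> = P"
  by (auto simp: twisted_diag_eq_image image_image)

lemma fst_twisted_diag [simp]: "fst ` twisted_diag P \<phi> = \<phi> ` P"
  by (auto simp: twisted_diag_eq_image image_image)

lemma card_twisted_diag [simp]: "card (twisted_diag P \<phi>) = card P"
  unfolding twisted_diag_eq_image by (rule card_image) (auto simp: inj_on_def)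

lemma mem_twisted_diag [simp]: "(v, u) \<in> twisted_diag P \<phi> \<longleftrightarrow> u \<in> P \<and> v = \<phi> u"
  by (auto simp: twisted_diag_def)

lemma subgroup_twisted_diag:
  assumes "sub P" "\<phi> \<in> mor P"
  shows "subgroup (twisted_diag P \<phi>) T"
  using assms mor_closed[OF assms] mor_hom[OF assms] mor_one[OF assms] mor_inv[OF assms]
    subgroup.subset[OF assms(1)] subgroup.m_closed[OF assms(1)] subgroup.one_closed[OF assms(1)]
    subgroup.m_inv_closed[OF assms(1)]
  by (intro subgroup.intro) (auto simp: inv_DirProd twisted_diag_def)

lemma graphsI: "\<lbrakk>sub P; \<phi> \<in> mor P\<rbrakk> \<Longrightarrow> twisted_diag P \<phi> \<in> graphs"
  unfolding graphs_def by blast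

lemma graphsE:
  assumes "U \<in> graphs"
  obtains P \<phi> where "sub P" "\<phi> \<in> mor P" "U = twisted_diag P \<phi>"
  using assms unfolding graphs_def by blast

lemma graphs_subgroup: "U \<in> graphs \<Longrightarrow> subgroup U T"
  using graphsE subgroup_twisted_diag by metis

lemma finite_graphs: "finite graphs"
proof (rule finite_subset)
  show "graphs \<subseteq> Pow (carrier T)" using graphs_subgroup subgroup.subset by blast
qed (use finite_T in simp)

lemma sub_snd: "subgroup D T \<Longrightarrow> sub (snd ` D)"
proof -
  assume D: "subgroup D T"
  have "snd \<in> hom T S" by (auto simp: hom_def mult_DirProd')
  then interpret h: group_hom T S snd
    by (simp add: group_hom_def group_hom_axioms_def group_T)
  show ?thesis by (rule h.subgroup_img_is_subgroup[OF D])
qed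

lemma twisted_diag_subset_iff:
  assumes "\<psi> \<in> extensional Q"
  shows "twisted_diag Q \<psi> \<subseteq> twisted_diag P \<phi> \<longleftrightarrow> Q \<subseteq> P \<and> \<psi> = restrict \<phi> Q"
proof -
  have "twisted_diag Q \<psi> \<subseteq> twisted_diag P \<phi> \<longleftrightarrow> (\<forall>u\<in>Q. u \<in> P \<and> \<psi> u = \<phi> u)"
    by (auto simp: twisted_diag_def)
  also have "\<dots> \<longleftrightarrow> Q \<subseteq> P \<and> \<psi> = restrict \<phi> Q"
    using assms by (auto simp: extensional_def restrict_def fun_eq_iff)
  finally show ?thesis .
qed

lemma graphs_downward:
  assumes "U \<in> graphs" "subgroup D T" "D \<subseteq> U"
  shows "D \<in> graphs"
proof -
  obtain P \<phi> where P: "sub P" and \<phi>: "\<phi> \<in> mor P" and U: "U = twisted_diag P \<phi>"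
    using assms(1) by (rule graphsE)
  have sub: "snd ` D \<subseteq> P" using assms(3) by (auto simp: U twisted_diag_def)
  have "D = twisted_diag (snd ` D) (restrict \<phi> (snd ` D))"
    using assms(3) by (force simp: U twisted_diag_def)
  moreover have "restrict \<phi> (snd ` D) \<in> mor (snd ` D)"
    using mor_restrict[OF P sub_snd[OF assms(2)] sub] \<phi> mor_restrict_self[OF P \<phi>] by simp
  ultimately show ?thesis using graphsI[OF sub_snd[OF assms(2)]] by metis
qed

lemma graphs_single_valued: "\<lbrakk>U \<in> graphs; (x, u) \<in> U; (y, u) \<in> U\<rbrakk> \<Longrightarrow> x = y"
  by (auto simp: graphs_def)

text \<open>Morphisms applied in both coordinates carry graphs to graphs.\<close>

lemma graphs_push:
  assumes D: "D \<in> graphs" and sub: "D \<subseteq> A \<times> B"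
    and A: "sub A" "restrict \<alpha> A \<in> mor A" and B: "sub B" "restrict \<beta> B \<in> mor B"
  shows "map_prod \<alpha> \<beta> ` D \<in> graphs"
    "\<exists>\<psi>\<in>mor (snd ` D). \<psi> ` (snd ` D) = snd ` map_prod \<alpha> \<beta> ` D"
proof -
  obtain Q \<psi> where Q: "sub Q" and \<psi>: "\<psi> \<in> mor Q" and eq: "D = twisted_diag Q \<psi>" using D by (rule graphsE)
  have QB: "Q \<subseteq> B" and \<psi>A: "\<psi> ` Q \<subseteq> A" using sub by (auto simp: eq twisted_diag_def)
  let ?b = "restrict \<beta> Q" and ?c = "restrict (inv_into Q (restrict \<beta> Q)) (restrict \<beta> Q ` Q)"
  let ?a = "compose Q (restrict \<alpha> A) \<psi>"
  have b: "?b \<in> mor Q" by (rule mor_restrict[OF B(1) Q QB B(2)])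
  have a: "?a \<in> mor Q" by (rule mor_comp[OF Q A(1) \<psi> \<psi>A A(2)])
  have "compose (?b ` Q) ?a ?c \<in> mor (?b ` Q)"
    by (rule mor_comp[OF mor_image[OF Q b] Q mor_inverse[OF Q b] _ a]) (simp only: inv_image[OF Q b] subset_refl)
  moreover have "map_prod \<alpha> \<beta> ` D = twisted_diag (?b ` Q) (compose (?b ` Q) ?a ?c)"
  proof -
    have "compose (?b ` Q) ?a ?c (\<beta> u) = \<alpha> (\<psi> u)" if u: "u \<in> Q" for u
    proof -
      have "?c (?b u) = u" using u inv_into_f_f[OF mor_inj[OF Q b] u] by simp
      then show ?thesis using u \<psi>A by (auto simp: compose_def)
    qed
    then show ?thesis by (simp add: eq twisted_diag_eq_image image_image cong: image_cong)
  qed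
  ultimately show "map_prod \<alpha> \<beta> ` D \<in> graphs" using graphsI[OF mor_image[OF Q b]] by metis
  show "\<exists>\<psi>\<in>mor (snd ` D). \<psi> ` (snd ` D) = snd ` map_prod \<alpha> \<beta> ` D"
    using b by (intro bexI[of _ ?b]) (auto simp: eq image_image twisted_diag_eq_image cong: image_cong)
qed

text \<open>The converse, by transport along the inverse morphisms.\<close>

lemma graphs_pull:
  assumes D: "map_prod \<alpha> \<beta> ` D \<in> graphs" and sub: "D \<subseteq> A \<times> B"
    and A: "sub A" "restrict \<alpha> A \<in> mor A" and B: "sub B" "restrict \<beta> B \<in> mor B"
  shows "D \<in> graphs"
proof -
  let ?a = "inv_into A (restrict \<alpha> A)" and ?b = "inv_into B (restrict \<beta> B)"
  have "map_prod ?a ?b ` (map_prod \<alpha> \<beta> ` D) \<in> graphs"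
    using mor_inverse[OF A] mor_inverse[OF B] mor_image[OF A] mor_image[OF B] sub
    by (intro graphs_push(1)[OF D, of "restrict \<alpha> A ` A" "restrict \<beta> B ` B"]) auto
  moreover have "map_prod ?a ?b (map_prod \<alpha> \<beta> z) = z" if "z \<in> D" for z
  proof -
    have "fst z \<in> A" "snd z \<in> B" using that sub by auto
    then have "?a (restrict \<alpha> A (fst z)) = fst z" "?b (restrict \<beta> B (snd z)) = snd z"
      using mor_inj[OF A] mor_inj[OF B] by (simp_all only: inv_into_f_f)
    then show ?thesis using \<open>fst z \<in> A\<close> \<open>snd z \<in> B\<close> by (cases z) simp
  qed
  then have "map_prod ?a ?b ` (map_prod \<alpha> \<beta> ` D) = D" by (simp add: image_image cong: image_cong)
  ultimately show ?thesis by simp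
qed

text \<open>The fixed point counts of the stabilization of \<open>(S \<times> S)/\<Delta>(S)\<close>.\<close>

definition target :: "('a \<times> 'a) set \<Rightarrow> rat" where
  "target D = (if D \<in> graphs then of_nat (order S) / of_nat (card (mor (snd ` D))) else 0)"

text \<open>The invariance behind stability: transport changes the domain of a graph by an isomorphism of
  \<open>F\<close>, which preserves the number of morphisms into \<open>S\<close>.\<close>

lemma target_push:
  assumes sub: "D \<subseteq> A \<times> B" and A: "sub A" "restrict \<alpha> A \<in> mor A" and B: "sub B" "restrict \<beta> B \<in> mor B"
  shows "target (map_prod \<alpha> \<beta> ` D) = target D"
proof (cases "D \<in> graphs")
  case True
  obtain \<psi> where "\<psi> \<in> mor (snd ` D)" "\<psi> ` (snd ` D) = snd ` map_prod \<alpha> \<beta> ` D"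
    using graphs_push(2)[OF True sub A B] by blast
  moreover have "sub (snd ` D)" using True by (intro sub_snd graphs_subgroup)
  ultimately have "card (mor (snd ` map_prod \<alpha> \<beta> ` D)) = card (mor (snd ` D))"
    using card_mor_iso by metis
  then show ?thesis using True graphs_push(1)[OF True sub A B] by (simp add: target_def)
next
  case False
  then show ?thesis using graphs_pull[OF _ sub A B] by (auto simp: target_def)
qed

lemma conj_set_T:
  assumes "a \<in> carrier S" "b \<in> carrier S"
  shows "conj_set T (a, b) D = map_prod (conj_map S a) (conj_map S b) ` D"
  unfolding conj_set_def using assms
  by (intro image_cong refl) (auto simp: conj_map_def inv_DirProd mult_DirProd')

lemma mor_conj_carrier: "x \<in> carrier S \<Longrightarrow> restrict (conj_map S x) (carrier S) \<in> mor (carrier S)"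
  by (rule mor_conj) auto

lemma graphs_conj:
  assumes "g \<in> carrier T" "U \<in> graphs"
  shows "conj_set T g U \<in> graphs"
proof -
  obtain a b where g: "g = (a, b)" "a \<in> carrier S" "b \<in> carrier S" using assms(1) by auto
  show ?thesis
    using graphs_push(1)[OF assms(2), of "carrier S" "carrier S"] subgroup.subset[OF graphs_subgroup[OF assms(2)]]
      mor_conj_carrier g by (simp add: conj_set_T)
qed

text \<open>Inside the graph of \<open>\<phi> : P \<rightarrow> S\<close> there is exactly one graph with domain \<open>Q\<close> for each \<open>Q \<le> P\<close>, that
  of the restriction of \<open>\<phi>\<close>.\<close>

lemma column_sum_graph:
  assumes Q: "sub Q" and U: "U \<in> graphs"
  shows "(\<Sum>\<psi>\<in>mor Q. contains (twisted_diag Q \<psi>) U) = of_bool (Q \<subseteq> snd ` U)"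
proof -
  obtain P \<phi> where P: "sub P" and \<phi>: "\<phi> \<in> mor P" and eq: "U = twisted_diag P \<phi>" using U by (rule graphsE)
  have iff: "twisted_diag Q \<psi> \<subseteq> U \<longleftrightarrow> Q \<subseteq> P \<and> \<psi> = restrict \<phi> Q" if "\<psi> \<in> mor Q" for \<psi>
    unfolding eq by (rule twisted_diag_subset_iff[OF mor_ext[OF Q that]])
  show ?thesis
  proof (cases "Q \<subseteq> P")
    case True
    then have r: "restrict \<phi> Q \<in> mor Q" using mor_restrict[OF P Q] \<phi> mor_restrict_self[OF P \<phi>] by simp
    have "(\<Sum>\<psi>\<in>mor Q. contains (twisted_diag Q \<psi>) U) = (\<Sum>\<psi>\<in>mor Q. if \<psi> = restrict \<phi> Q then 1 else 0)"
      using iff True by (intro sum.cong) auto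
    then show ?thesis using r finite_mor[OF Q] True by (simp add: eq)
  next
    case False
    then show ?thesis using iff by (simp add: eq)
  qed
qed

end

section \<open>Counting with group actions\<close>

lemma (in group_action) card_orbit_prime_power:
  assumes "prime p" "order G = p ^ k" "x \<in> E"
  obtains i where "card (orbit G \<phi> x) = p ^ i"
proof -
  have "card (orbit G \<phi> x) dvd p ^ k"
    using orbit_stabilizer_theorem[OF assms(3)] assms(2) by (metis dvd_triv_left)
  then show ?thesis using that assms(1) by (auto simp: divides_primepow_nat)
qed

lemma (in group_action) card_eq_sum_orbits:
  "finite E \<Longrightarrow> card E = (\<Sum>C\<in>orbits G E \<phi>. card C)"
  using disjoint_sum[of "\<lambda>_. 1 :: nat"] by simp

text \<open>In place of the conjugacy part of Sylow's theorem: if \<open>p\<^sup>a\<close> is the full power of \<open>p\<close> in the number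
  of points, the orbits of a \<open>p\<close>-group cannot all have length divisible by \<open>p\<^sup>a\<^sup>+\<^sup>1\<close>.\<close>

lemma (in group_action) p_group_small_orbit:
  assumes p: "prime p" and G: "order G = p ^ k" and fin: "finite E"
    and card: "card E = p ^ a * m" "\<not> p dvd m"
  obtains x i where "x \<in> E" "card (orbit G \<phi> x) = p ^ i" "i \<le> a"
proof (rule ccontr)
  assume none: "\<not> thesis"
  note result = that
  have "p ^ Suc a dvd card C" if C: "C \<in> orbits G E \<phi>" for C
  proof -
    obtain x where x: "x \<in> E" "C = orbit G \<phi> x" using C unfolding orbits_def by blast
    obtain i where i: "card (orbit G \<phi> x) = p ^ i" by (rule card_orbit_prime_power[OF p G x(1)])
    then have "Suc a \<le> i" using none result[OF x(1) i] by fastforce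
    then show ?thesis unfolding x(2) i by (rule le_imp_power_dvd)
  qed
  then have "p ^ Suc a dvd p ^ a * m" unfolding card(1)[symmetric] card_eq_sum_orbits[OF fin] by (rule dvd_sum)
  then have "p dvd m" using prime_gt_0_nat[OF p] by simp
  then show False using card(2) by contradiction
qed

text \<open>Orbits through points that are not fixed have length divisible by \<open>p\<close>.\<close>

lemma (in group_action) p_group_fixed_points:
  assumes p: "prime p" and G: "order G = p ^ k" and fin: "finite E" and dvd: "p dvd card E"
  shows "p dvd card {x \<in> E. \<forall>g\<in>carrier G. \<phi> g x = x}"
proof -
  let ?Fix = "{x \<in> E. \<forall>g\<in>carrier G. \<phi> g x = x}"
  have orbit_fix: "orbit G \<phi> x = {x}" if "x \<in> ?Fix" for x
    using that orbit_refl[of x] by (auto simp: orbit_def)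
  have "p dvd (\<Sum>x\<in>C. of_bool (x \<notin> ?Fix))" if C: "C \<in> orbits G E \<phi>" for C
  proof -
    obtain x where x: "x \<in> E" "C = orbit G \<phi> x" using C unfolding orbits_def by blast
    show ?thesis
    proof (cases "\<exists>y\<in>C. y \<in> ?Fix")
      case True
      then obtain y where y: "y \<in> C" "y \<in> ?Fix" by blast
      then have "C = {y}" using orbit_eq_iff[of y x] x orbit_fix[of y] by auto
      then show ?thesis using y by simp
    next
      case False
      obtain i where i: "card (orbit G \<phi> x) = p ^ i" by (rule card_orbit_prime_power[OF p G x(1)])
      have "i \<noteq> 0"
      proof
        assume "i = 0"
        then have "card C = 1" using i by (simp add: x(2))
        then obtain y where "C = {y}" by (auto simp: card_1_singleton_iff)
        then have C: "C = {x}" using orbit_refl[OF x(1)] x(2) by auto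
        then have "\<phi> g x = x" if "g \<in> carrier G" for g
          using that unfolding x(2) orbit_def by blast
        then show False using False C x(1) by auto
      qed
      moreover have "(\<Sum>z\<in>C. of_bool (z \<notin> ?Fix)) = card C" using False by simp
      ultimately show ?thesis using i by (simp add: x(2) dvd_power)
    qed
  qed
  then have "p dvd (\<Sum>x\<in>E. of_bool (x \<notin> ?Fix))"
    unfolding disjoint_sum[OF fin, symmetric] by (rule dvd_sum)
  also have "(\<Sum>x\<in>E. of_bool (x \<notin> ?Fix)) = card E - card ?Fix"
  proof -
    have "(\<Sum>x\<in>E. of_bool (x \<notin> ?Fix)) = (\<Sum>x\<in>E - ?Fix. 1 :: nat)"
      using fin by (intro sum.mono_neutral_cong_right) auto
    also have "\<dots> = card (E - ?Fix)" by simp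
    also have "\<dots> = card E - card ?Fix" using fin by (intro card_Diff_subset) auto
    finally show ?thesis .
  qed
  finally have "p dvd card E - card ?Fix" .
  moreover have "card ?Fix \<le> card E" by (rule card_mono[OF fin Collect_restrict])
  ultimately show ?thesis using dvd_diffD1 dvd by blast
qed

text \<open>The stabilizers along one orbit have total order \<open>|G|\<close>.  Orbits are represented by a chosen
  element, because below they index classes of graphs.\<close>

lemma (in group_action) sum_over_orbits:
  fixes h :: "_ \<Rightarrow> rat"
  assumes finG: "finite (carrier G)" and fin: "finite E"
    and inv: "\<And>g x. g \<in> carrier G \<Longrightarrow> x \<in> E \<Longrightarrow> h (\<phi> g x) = h x"
  shows "(\<Sum>x\<in>E. of_nat (card (stabilizer G \<phi> x)) * h x) =
    of_nat (order G) * (\<Sum>C\<in>orbits G E \<phi>. h (SOME x. x \<in> C))"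
proof -
  have "(\<Sum>x\<in>C. of_nat (card (stabilizer G \<phi> x)) * h x) = of_nat (order G) * h (SOME x. x \<in> C)"
    if C: "C \<in> orbits G E \<phi>" for C
  proof -
    obtain x where x: "x \<in> E" "C = orbit G \<phi> x" using C unfolding orbits_def by blast
    have hx: "h y = h x" if "y \<in> C" for y using that inv x by (auto simp: orbit_def)
    have "(SOME x. x \<in> C) \<in> C" using orbit_refl[OF x(1)] x(2) by (metis someI)
    then have "h (SOME x. x \<in> C) = h x" by (rule hx)
    moreover have "(\<Sum>x\<in>C. of_nat (card (stabilizer G \<phi> x)) * h x) =
        of_nat (\<Sum>x\<in>C. card (stabilizer G \<phi> x)) * h x"
      using hx by (simp add: sum_distrib_right)
    ultimately show ?thesis using card_stablizer_sum[OF finG C] by simp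
  qed
  then show ?thesis unfolding disjoint_sum[OF fin, symmetric] by (simp add: sum_distrib_left)
qed

lemma (in group_action) card_stabilizer_orbit:
  assumes fin: "finite (carrier G)" and g: "g \<in> carrier G" and x: "x \<in> E"
  shows "card (stabilizer G \<phi> (\<phi> g x)) = card (stabilizer G \<phi> x)"
proof -
  have gx: "\<phi> g x \<in> E" using element_image[OF g x] by simp
  have "orbit G \<phi> (\<phi> g x) = orbit G \<phi> x"
    unfolding orbit_eq_iff[OF gx x] using g by (auto simp: orbit_def)
  then have "card (orbit G \<phi> x) * card (stabilizer G \<phi> (\<phi> g x)) = card (orbit G \<phi> x) * card (stabilizer G \<phi> x)"
    using orbit_stabilizer_theorem[OF x] orbit_stabilizer_theorem[OF gx] by simp
  moreover have "card (orbit G \<phi> x) \<noteq> 0"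
    using orbit_refl[OF x] fin by (auto simp: orbit_def card_eq_0_iff)
  ultimately show ?thesis by simp
qed

text \<open>If \<open>K\<close> normalizes \<open>D\<close>, then \<open>K\<close> acts on the \<open>D\<close>-fixed points, and the orbit count of
  this action gives a congruence between marks.\<close>

lemma (in group) burnside_congruence:
  assumes fin: "finite (carrier G)" and X: "is_gset G X" and K: "subgroup K G"
    and D: "D \<subseteq> carrier G" and norm: "\<And>k. k \<in> K \<Longrightarrow> conj_set G k D \<subseteq> D"
  obtains c :: nat where "(\<Sum>k\<in>K. stab_sum G (contains (insert k D)) X) = of_nat (card K * c)"
proof -
  let ?E = "fixed_points D X" and ?\<phi> = "\<lambda>k. restrict (act X k) (fixed_points D X)"
  have finE: "finite ?E" using is_gset_finite[OF X] by (simp add: fixed_points_def)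
  have KG: "k \<in> carrier G" if "k \<in> K" for k using subgroup.mem_carrier[OF K that] .
  have cl: "act X k x \<in> ?E" if k: "k \<in> K" and x: "x \<in> ?E" for k x
  proof -
    have xX: "x \<in> pts X" using x by (simp add: fixed_points_def)
    have "act X d (act X k x) = act X k x" if d: "d \<in> D" for d
    proof -
      have dG: "d \<in> carrier G" using d D by auto
      let ?d = "conj_map G (inv k) d"
      have "?d \<in> D" using norm[OF subgroup.m_inv_closed[OF K k]] d by (auto simp: conj_set_def)
      then have "act X ?d x = x" using x by (simp add: fixed_points_def)
      moreover have "d \<otimes> k = k \<otimes> ?d" using KG[OF k] dG by (simp add: conj_map_def flip: m_assoc)
      ultimately show ?thesis
        using KG[OF k] dG X xX by (metis conj_map_closed gset_mult inv_closed)
    qed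
    then show ?thesis using gset_closed[OF X KG[OF k] xX] by (simp add: fixed_points_def)
  qed
  interpret A: group_action "G\<lparr>carrier := K\<rparr>" ?E ?\<phi>
  proof (rule group_actionI)
    show "group (G\<lparr>carrier := K\<rparr>)" by (rule subgroup_imp_group[OF K])
    fix x assume x: "x \<in> ?E"
    then have xX: "x \<in> pts X" by (simp add: fixed_points_def)
    show "?\<phi> \<one>\<^bsub>G\<lparr>carrier := K\<rparr>\<^esub> x = x" using x xX X by (simp add: gset_one)
    show "?\<phi> k x \<in> ?E" if "k \<in> carrier (G\<lparr>carrier := K\<rparr>)" for k using that x cl by simp
    show "?\<phi> (g \<otimes>\<^bsub>G\<lparr>carrier := K\<rparr>\<^esub> h) x = ?\<phi> g (?\<phi> h x)"
      if "g \<in> carrier (G\<lparr>carrier := K\<rparr>)" "h \<in> carrier (G\<lparr>carrier := K\<rparr>)" for g h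
      using that x xX X cl KG by (simp add: gset_mult)
  qed simp
  have finK: "finite K" using fin subgroup.subset[OF K] finite_subset by blast
  have inv: "stab_sum G (contains (insert k D)) X = of_nat (card (invariants ?E ?\<phi> k))" if "k \<in> K" for k
  proof -
    have "invariants ?E ?\<phi> k = fixed_points (insert k D) X"
      by (auto simp: invariants_def fixed_points_def)
    moreover have "insert k D \<subseteq> carrier G" using KG[OF that] D by simp
    ultimately show ?thesis using card_fixed_points[OF is_gset_finite[OF X]] by metis
  qed
  have "(\<Sum>k\<in>K. stab_sum G (contains (insert k D)) X) = (\<Sum>k\<in>K. of_nat (card (invariants ?E ?\<phi> k)))"
    by (intro sum.cong refl inv)
  also have "\<dots> = of_nat (card K * card (orbits (G\<lparr>carrier := K\<rparr>) ?E ?\<phi>))"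
    using A.burnside finK finE by (simp add: order_def mult.commute flip: of_nat_sum of_nat_mult)
  finally show ?thesis by (rule that)
qed

text \<open>Normalizers grow in \<open>p\<close>-groups: the fixed points of \<open>P\<close> on \<open>G/P\<close> are the cosets in \<open>N(P)/P\<close>, and
  their number is divisible by \<open>p\<close> because \<open>|G/P|\<close> is.\<close>

lemma (in group) normalizer_index_dvd:
  assumes p: "prime p" and ord: "order G = p ^ n" and P: "subgroup P G" and ne: "P \<noteq> carrier G"
  obtains k where "card (normalizer G P) = p * k * card P"
proof -
  have fin: "finite (carrier G)" using ord prime_gt_0_nat[OF p] order_gt_0_iff_finite by simp
  have PG: "P \<subseteq> carrier G" using P by (rule subgroup.subset)
  let ?X = "coset_gset G P"
  have X: "is_gset G ?X" by (rule is_gset_coset[OF is_group fin P])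
  interpret X: group_action G "pts ?X" "act ?X" using X by (rule is_gset_action)
  interpret A: group_action "G\<lparr>carrier := P\<rparr>" "pts ?X" "act ?X" by (rule X.induced_action[OF P])
  have pts: "card (pts ?X) * card P = p ^ n"
    using l_lagrange[OF fin P] ord by (simp add: coset_gset_def)
  have "card P dvd p ^ n" using pts by (metis dvd_triv_right)
  then obtain j where j: "card P = p ^ j" using p by (auto simp: divides_primepow_nat)
  have "card (pts ?X) dvd p ^ n" using pts by (metis dvd_triv_left)
  then obtain i where i: "card (pts ?X) = p ^ i" using p by (auto simp: divides_primepow_nat)
  have "i \<noteq> 0"
  proof
    assume "i = 0"
    then have "card P = card (carrier G)" using i pts ord by (simp add: order_def)
    then show False using ne PG fin card_subset_eq by blast
  qed
  then have "p dvd card (pts ?X)" by (simp add: i dvd_power)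
  then have "p dvd card {x \<in> pts ?X. \<forall>g\<in>carrier (G\<lparr>carrier := P\<rparr>). act ?X g x = x}"
    using A.p_group_fixed_points[OF p _ is_gset_finite[OF X]] j by (simp add: order_def)
  then obtain k where k: "card (fixed_points P ?X) = p * k" by (auto simp: fixed_points_def)
  have "P \<subseteq> conj_set G a P \<longleftrightarrow> a \<in> normalizer G P" if "a \<in> carrier G" for a
  proof -
    have "finite (conj_set G a P)" using conj_set_closed[OF that PG] fin finite_subset by blast
    then have "P \<subseteq> conj_set G a P \<longleftrightarrow> conj_set G a P = P"
      using card_subset_eq[of "conj_set G a P" P] card_conj_set[OF that PG] by auto
    then show ?thesis using that by (simp add: mem_normalizer[OF PG])
  qed
  then have "(\<Sum>a\<in>carrier G. contains P (conj_set G a P)) =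
      (\<Sum>a\<in>carrier G. of_bool (a \<in> normalizer G P))"
    by (intro sum.cong) auto
  also have "\<dots> = of_nat (card (normalizer G P))"
  proof -
    have "carrier G \<inter> normalizer G P = normalizer G P" using mem_normalizer[OF PG] by auto
    then show ?thesis using fin by (simp add: sum_of_bool_eq)
  qed
  finally have "of_nat (card (fixed_points P ?X)) = (of_nat (card (normalizer G P)) / of_nat (card P) :: rat)"
    by (simp add: card_fixed_points[OF is_gset_finite[OF X] PG] stab_sum_coset[OF fin P])
  then have "of_nat (p * k * card P) = (of_nat (card (normalizer G P)) :: rat)"
    using j prime_gt_0_nat[OF p] by (simp add: k field_simps)
  then show ?thesis using that of_nat_eq_iff by metis
qed

section \<open>Combinations of graph bisets\<close>

lemma (in group) bij_betw_left_mult: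
  "g \<in> carrier G \<Longrightarrow> bij_betw (\<lambda>h. g \<otimes> h) (carrier G) (carrier G)"
  by (intro bij_betwI[where g = "\<lambda>h. inv g \<otimes> h"]) (auto simp flip: m_assoc)

locale saturated_fusion = fusion S F for S :: "('a, 'm) monoid_scheme" (structure) and F +
  fixes p n :: nat
  assumes prime: "prime p" and order_S: "order S = p ^ n" and sat: "saturated p S F"
begin

abbreviation Zp :: "rat set" where "Zp \<equiv> Z_loc p"

text \<open>\<open>D\<close> need not be a subgroup: orbit counting produces the marks at the sets \<open>insert k D\<close>.\<close>

definition mark :: "('a \<times> 'a) set \<Rightarrow> ('a \<times> 'a) set \<Rightarrow> rat" where
  "mark U D = stab_sum T (contains D) (coset_gset T U)"

text \<open>The functions of marks of \<open>p\<close>-integral combinations of graph bisets.\<close>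

definition realizable :: "(('a \<times> 'a) set \<Rightarrow> rat) \<Rightarrow> bool" where
  "realizable f \<longleftrightarrow> (\<exists>q. (\<forall>U. q U \<in> Zp) \<and> f = (\<lambda>D. \<Sum>U\<in>graphs. q U * mark U D))"

lemma realizable_add: 
  assumes "realizable f" "realizable g"
  shows "realizable (\<lambda>D. f D + g D)"
proof -
  obtain q r where "\<forall>U. q U \<in> Zp" "f = (\<lambda>D. \<Sum>U\<in>graphs. q U * mark U D)"
    "\<forall>U. r U \<in> Zp" "g = (\<lambda>D. \<Sum>U\<in>graphs. r U * mark U D)"
    using assms unfolding realizable_def by blast
  then show ?thesis unfolding realizable_def
    by (intro exI[of _ "\<lambda>U. q U + r U"]) (auto simp: prime distrib_right sum.distrib)
qed

lemma realizable_mark: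
  assumes "U \<in> graphs" "r \<in> Zp"
  shows "realizable (\<lambda>D. r * mark U D)"
  unfolding realizable_def
proof (intro exI[of _ "\<lambda>V. if V = U then r else 0"] conjI allI ext)
  show "(if V = U then r else 0) \<in> Zp" for V using assms prime by simp
  show "r * mark U D = (\<Sum>V\<in>graphs. (if V = U then r else 0) * mark V D)" for D
  proof -
    have "(\<Sum>V\<in>graphs. (if V = U then r else 0) * mark V D) = (\<Sum>V\<in>graphs. if V = U then r * mark U D else 0)"
      by (intro sum.cong) auto
    then show ?thesis using assms(1) finite_graphs by simp
  qed
qed

lemma realizable_sum:
  assumes "finite I" "\<And>i. i \<in> I \<Longrightarrow> realizable (f i)"
  shows "realizable (\<lambda>D. \<Sum>i\<in>I. f i D)"
  using assms
proof (induction I)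
  case empty
  show ?case unfolding realizable_def using prime by (intro exI[of _ "\<lambda>_. 0"]) simp
next
  case (insert i I)
  then show ?case using realizable_add[of "f i" "\<lambda>D. \<Sum>i\<in>I. f i D"] by simp
qed

subsection \<open>Marks of graph bisets\<close>

lemma mark_eq:
  assumes "U \<in> graphs"
  shows "mark U D = (\<Sum>g\<in>carrier T. contains D (conj_set T g U)) / of_nat (card U)"
  unfolding mark_def by (rule group.stab_sum_coset[OF group_T finite_T graphs_subgroup[OF assms]])

text \<open>The stabilizers of \<open>T/U\<close> are conjugates of \<open>U\<close>, hence graphs; so a mark only depends on the
  graphs that contain \<open>D\<close>.\<close>

lemma mark_zero:
  assumes "U \<in> graphs" "\<And>W. W \<in> graphs \<Longrightarrow> \<not> D \<subseteq> W"
  shows "mark U D = 0"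
  using assms(2)[OF graphs_conj[OF _ assms(1)]] by (simp add: mark_eq[OF assms(1)])

lemma mark_cong:
  assumes "U \<in> graphs" "\<And>W. W \<in> graphs \<Longrightarrow> D \<subseteq> W \<longleftrightarrow> D' \<subseteq> W"
  shows "mark U D = mark U D'"
  using assms(2)[OF graphs_conj[OF _ assms(1)]] by (simp add: mark_eq[OF assms(1)])

lemma mark_conj:
  assumes U: "U \<in> graphs" and D: "D \<subseteq> carrier T" and g: "g \<in> carrier T"
  shows "mark U (conj_set T g D) = mark U D"
proof -
  interpret T: group T by (rule group_T)
  have UT: "U \<subseteq> carrier T" using graphs_subgroup[OF U] by (rule subgroup.subset)
  have bij: "bij_betw (\<lambda>h. g \<otimes>\<^bsub>T\<^esub> h) (carrier T) (carrier T)"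
    by (rule T.bij_betw_left_mult[OF g])
  have "(\<Sum>h\<in>carrier T. contains (conj_set T g D) (conj_set T h U)) =
      (\<Sum>h\<in>carrier T. contains (conj_set T g D) (conj_set T (g \<otimes>\<^bsub>T\<^esub> h) U))"
    by (rule sum.reindex_bij_betw[OF bij, symmetric])
  also have "\<dots> = (\<Sum>h\<in>carrier T. contains D (conj_set T h U))"
    by (intro sum.cong refl)
      (simp only: T.conj_set_mult[OF g _ UT] T.conj_set_mono_iff[OF g D T.conj_set_closed[OF _ UT]])
  finally show ?thesis by (simp only: mark_eq[OF U])
qed

lemma mark_congruence:
  assumes U: "U \<in> graphs" and K: "subgroup K T"
    and D: "D \<subseteq> carrier T" and norm: "\<And>k. k \<in> K \<Longrightarrow> conj_set T k D \<subseteq> D"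
  shows "\<exists>z\<in>Zp. (\<Sum>k\<in>K. mark U (insert k D)) = of_nat (card K) * z"
proof -
  obtain c where "(\<Sum>k\<in>K. stab_sum T (contains (insert k D)) (coset_gset T U)) = of_nat (card K * c)"
    by (rule group.burnside_congruence[OF group_T finite_T
          is_gset_coset[OF group_T finite_T graphs_subgroup[OF U]] K D norm])
  then show ?thesis using prime by (intro bexI[of _ "of_nat c"]) (simp_all add: mark_def)
qed

text \<open>The sum of the marks of \<open>T/\<Delta>(P, \<phi>)\<close> over all graphs with domain \<open>Q\<close>.  A stabilizer contains one such
  graph if its domain contains \<open>Q\<close>, and none otherwise, so that \<open>\<phi>\<close> drops out.\<close>

definition column :: "'a set \<Rightarrow> 'a set \<Rightarrow> rat" where
  "column Q P = of_nat (order S) * (\<Sum>b\<in>carrier S. of_bool (Q \<subseteq> conj_set S b P)) / of_nat (card P)"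

lemma column_sum_mark:
  assumes P: "sub P" "\<phi> \<in> mor P" and Q: "sub Q"
  shows "(\<Sum>\<psi>\<in>mor Q. mark (twisted_diag P \<phi>) (twisted_diag Q \<psi>)) = column Q P"
proof -
  let ?U = "twisted_diag P \<phi>"
  have U: "?U \<in> graphs" using P by (rule graphsI)
  have "(\<Sum>\<psi>\<in>mor Q. mark ?U (twisted_diag Q \<psi>)) =
      (\<Sum>\<psi>\<in>mor Q. \<Sum>g\<in>carrier T. contains (twisted_diag Q \<psi>) (conj_set T g ?U)) / of_nat (card P)"
    by (simp add: mark_eq[OF U] sum_divide_distrib)
  also have "(\<Sum>\<psi>\<in>mor Q. \<Sum>g\<in>carrier T. contains (twisted_diag Q \<psi>) (conj_set T g ?U)) =
      (\<Sum>g\<in>carrier T. of_bool (Q \<subseteq> snd ` conj_set T g ?U))"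
    by (subst sum.swap) (intro sum.cong refl column_sum_graph[OF Q] graphs_conj U)
  also have "\<dots> = (\<Sum>(a, b)\<in>carrier S \<times> carrier S. of_bool (Q \<subseteq> conj_set S b P))"
  proof (intro sum.cong, simp, clarify)
    fix a b assume ab: "a \<in> carrier S" "b \<in> carrier S"
    have "snd ` conj_set T (a, b) ?U = conj_set S b P"
      unfolding conj_set_T[OF ab] by (simp add: twisted_diag_eq_image image_image conj_set_def)
    then show "of_bool (Q \<subseteq> snd ` conj_set T (a, b) ?U) = (of_bool (Q \<subseteq> conj_set S b P) :: rat)" by simp
  qed
  also have "\<dots> = of_nat (order S) * (\<Sum>b\<in>carrier S. of_bool (Q \<subseteq> conj_set S b P))"
    by (simp add: sum.cartesian_product[symmetric] order_def)
  finally show ?thesis by (simp add: column_def)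
qed

lemma realizable_props:
  assumes f: "realizable f"
  shows realizable_zero: "(\<And>W. W \<in> graphs \<Longrightarrow> \<not> D \<subseteq> W) \<Longrightarrow> f D = 0"
    and realizable_cong: "(\<And>W. W \<in> graphs \<Longrightarrow> D \<subseteq> W \<longleftrightarrow> D' \<subseteq> W) \<Longrightarrow> f D = f D'"
    and realizable_conj: "D \<subseteq> carrier T \<Longrightarrow> g \<in> carrier T \<Longrightarrow> f (conj_set T g D) = f D"
    and realizable_congruence: "subgroup K T \<Longrightarrow> D \<subseteq> carrier T \<Longrightarrow> (\<And>k. k \<in> K \<Longrightarrow> conj_set T k D \<subseteq> D) \<Longrightarrow>
      \<exists>z\<in>Zp. (\<Sum>k\<in>K. f (insert k D)) = of_nat (card K) * z"
proof -
  obtain q where q: "\<And>U. q U \<in> Zp" and f_eq: "f = (\<lambda>D. \<Sum>U\<in>graphs. q U * mark U D)"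
    using f unfolding realizable_def by blast
  show "f D = 0" if "\<And>W. W \<in> graphs \<Longrightarrow> \<not> D \<subseteq> W"
    unfolding f_eq using mark_zero[OF _ that] by (intro sum.neutral) simp
  show "f D = f D'" if "\<And>W. W \<in> graphs \<Longrightarrow> D \<subseteq> W \<longleftrightarrow> D' \<subseteq> W"
    unfolding f_eq by (intro sum.cong refl arg_cong[of _ _ "(*) _"] mark_cong that)
  show "f (conj_set T g D) = f D" if "D \<subseteq> carrier T" "g \<in> carrier T"
    unfolding f_eq by (intro sum.cong refl arg_cong[of _ _ "(*) _"] mark_conj that)
  show "\<exists>z\<in>Zp. (\<Sum>k\<in>K. f (insert k D)) = of_nat (card K) * z"
    if K: "subgroup K T" "D \<subseteq> carrier T" "\<And>k. k \<in> K \<Longrightarrow> conj_set T k D \<subseteq> D"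
  proof -
    have "\<forall>U\<in>graphs. \<exists>z\<in>Zp. (\<Sum>k\<in>K. mark U (insert k D)) = of_nat (card K) * z"
      using mark_congruence[OF _ K] by blast
    then obtain z where z: "\<And>U. U \<in> graphs \<Longrightarrow> z U \<in> Zp"
      "\<And>U. U \<in> graphs \<Longrightarrow> (\<Sum>k\<in>K. mark U (insert k D)) = of_nat (card K) * z U" by metis
    have "(\<Sum>k\<in>K. f (insert k D)) = (\<Sum>U\<in>graphs. q U * (\<Sum>k\<in>K. mark U (insert k D)))"
      unfolding f_eq by (subst sum.swap) (simp add: sum_distrib_left)
    also have "\<dots> = of_nat (card K) * (\<Sum>U\<in>graphs. q U * z U)"
      by (simp add: z(2) sum_distrib_left mult_ac)
    finally show ?thesis using q z(1) prime by (intro bexI[of _ "\<Sum>U\<in>graphs. q U * z U"] Z_loc_sum) auto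
  qed
qed

subsection \<open>Normalizers and centralizers\<close>

lemma sub_normalizer: "sub P \<Longrightarrow> sub (normalizer S P)"
  by (rule normalizer_imp_subgroup[OF subgroup.subset])

lemma normalizer_sub:
  assumes "sub P"
  shows "x \<in> normalizer S P \<longleftrightarrow> x \<in> carrier S \<and> conj_set S x P = P"
  using mem_normalizer[OF subgroup.subset[OF assms]] .

lemma normalizer_conj_closed:
  "\<lbrakk>sub P; x \<in> normalizer S P; u \<in> P\<rbrakk> \<Longrightarrow> conj_map S x u \<in> P"
  using normalizer_sub by (auto simp: conj_set_def)

lemma normalizer_contains: "\<lbrakk>sub P; x \<in> P\<rbrakk> \<Longrightarrow> x \<in> normalizer S P"
proof -
  assume P: "sub P" and x: "x \<in> P"
  have "conj_map S x u \<in> P" if "u \<in> P" for u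
    using P x that by (simp add: conj_map_def subgroup.m_closed subgroup.m_inv_closed)
  then have "conj_set S x P \<subseteq> P" by (auto simp: conj_set_def)
  moreover have "card (conj_set S x P) = card P"
    using card_conj_set[OF sub_closed[OF P x] subgroup.subset[OF P]] .
  ultimately have "conj_set S x P = P" using card_subset_eq[OF finite_sub[OF P]] by blast
  then show ?thesis using normalizer_sub[OF P] sub_closed[OF P x] by blast
qed

lemma p_power_card:
  assumes "sub P"
  obtains i where "card P = p ^ i"
proof -
  have "card P dvd p ^ n"
    using lagrange[OF assms] order_S by (metis dvd_triv_right)
  then show ?thesis using that prime by (auto simp: divides_primepow_nat)
qed

lemma centralizer_sub:
  assumes "sub P"
  shows "sub (centralizer S P)"
proof (rule subgroup.intro)
  have PS: "u \<in> carrier S" if "u \<in> P" for u using sub_closed[OF assms that] .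
  show "centralizer S P \<subseteq> carrier S" by (auto simp: centralizer_def)
  show "\<one> \<in> centralizer S P" using PS by (auto simp: centralizer_def)
  fix x assume x: "x \<in> centralizer S P"
  then have xS: "x \<in> carrier S" by (simp add: centralizer_def)
  show "inv x \<in> centralizer S P"
  proof -
    have "inv x \<otimes> u = u \<otimes> inv x" if u: "u \<in> P" for u
    proof -
      have "x \<otimes> u = u \<otimes> x" using x u by (simp add: centralizer_def)
      then have "inv x \<otimes> (u \<otimes> x) = u" using xS PS[OF u] by (metis inv_closed l_inv l_one m_assoc)
      moreover have "inv x \<otimes> u = inv x \<otimes> (u \<otimes> x) \<otimes> inv x" using xS PS[OF u] by (simp add: m_assoc)
      ultimately show ?thesis by simp
    qed
    then show ?thesis using xS by (simp add: centralizer_def)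
  qed
  fix y assume y: "y \<in> centralizer S P"
  have "x \<otimes> y \<otimes> u = u \<otimes> (x \<otimes> y)" if u: "u \<in> P" for u
    using x y PS[OF u] u by (simp add: centralizer_def m_assoc) (simp add: m_assoc[symmetric])
  then show "x \<otimes> y \<in> centralizer S P" using x y by (simp add: centralizer_def)
qed

lemma conj_map_eq_iff:
  assumes "x \<in> carrier S" "y \<in> carrier S" "u \<in> carrier S"
  shows "conj_map S x u = conj_map S y u \<longleftrightarrow> inv y \<otimes> x \<otimes> u = u \<otimes> (inv y \<otimes> x)"
proof -
  have "conj_map S x u = conj_map S y u \<longleftrightarrow> conj_map S (inv y) (conj_map S x u) = u"
    using assms by (metis conj_map_closed conj_map_inv)
  also have "\<dots> \<longleftrightarrow> conj_map S (inv y \<otimes> x) u = u" using assms by (simp add: conj_map_mult)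
  also have "\<dots> \<longleftrightarrow> inv y \<otimes> x \<otimes> u = u \<otimes> (inv y \<otimes> x)"
    using assms by (auto simp: conj_map_def inv_solve_right')
  finally show ?thesis .
qed

text \<open>Two elements of \<open>N(P)\<close> induce the same automorphism iff they differ by a centralizing element.\<close>

lemma card_Aut_inner:
  assumes P: "sub P"
  shows "card (Aut_inner S P) * card (normalizer S P \<inter> centralizer S P) = card (normalizer S P)"
proof -
  let ?N = "normalizer S P" and ?C = "normalizer S P \<inter> centralizer S P"
  let ?c = "\<lambda>x. restrict (conj_map S x) P"
  have NS: "x \<in> carrier S" if "x \<in> ?N" for x using that normalizer_sub[OF P] by blast
  have finN: "finite ?N" using finite_sub[OF sub_normalizer[OF P]] .
  have fib: "card {y \<in> ?N. ?c y = ?c x} = card ?C" if x: "x \<in> ?N" for x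
  proof (rule bij_betw_same_card[symmetric])
    have eq: "?c y = ?c x \<longleftrightarrow> inv x \<otimes> y \<in> centralizer S P" if y: "y \<in> ?N" for y
    proof -
      have "?c y = ?c x \<longleftrightarrow> (\<forall>u\<in>P. conj_map S y u = conj_map S x u)"
        by (auto simp: restrict_def fun_eq_iff)
      also have "\<dots> \<longleftrightarrow> (\<forall>u\<in>P. inv x \<otimes> y \<otimes> u = u \<otimes> (inv x \<otimes> y))"
        using conj_map_eq_iff NS[OF x] NS[OF y] sub_closed[OF P] by auto
      finally show ?thesis using NS[OF x] NS[OF y] by (simp add: centralizer_def)
    qed
    show "bij_betw (\<lambda>z. x \<otimes> z) ?C {y \<in> ?N. ?c y = ?c x}"
    proof (rule bij_betwI[where g = "\<lambda>y. inv x \<otimes> y"])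
      show "(\<otimes>) x \<in> ?C \<rightarrow> {y \<in> ?N. ?c y = ?c x}"
        using x NS eq subgroup.m_closed[OF sub_normalizer[OF P]] by (auto simp flip: m_assoc)
      show "(\<otimes>) (inv x) \<in> {y \<in> ?N. ?c y = ?c x} \<rightarrow> ?C"
        using x eq subgroup.m_closed[OF sub_normalizer[OF P]] subgroup.m_inv_closed[OF sub_normalizer[OF P]]
        by auto
    qed (use x NS in \<open>auto simp flip: m_assoc\<close>)
  qed
  have "card ?N = (\<Sum>x\<in>?N. 1)" by simp
  also have "\<dots> = (\<Sum>\<psi>\<in>?c ` ?N. \<Sum>y | y \<in> ?N \<and> ?c y = \<psi>. 1)" by (rule sum.image_gen[OF finN])
  also have "\<dots> = (\<Sum>\<psi>\<in>?c ` ?N. card ?C)" using fib by (intro sum.cong) auto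
  also have "?c ` ?N = Aut_inner S P" by (auto simp: Aut_inner_def)
  finally show ?thesis by simp
qed


section \<open>Saturation and normalizers of graphs\<close>

lemma F_self_iff:
  assumes P: "sub P"
  shows "\<chi> \<in> F P P \<longleftrightarrow> \<chi> \<in> mor P \<and> \<chi> ` P = P"
proof
  assume \<chi>: "\<chi> \<in> F P P"
  have "\<chi> ` P \<subseteq> P" using F_hom(2)[OF P P \<chi>] by auto
  then show "\<chi> \<in> mor P \<and> \<chi> ` P = P"
    using F_subset_mor[OF P P \<chi>] endo_inj_surj[OF finite_sub[OF P] _ F_hom(3)[OF P P \<chi>]] by blast
qed (use mor_in_F[OF P P] in auto)

lemma card_isos:
  assumes P: "sub P" and \<theta>: "\<theta> \<in> mor P"
  shows "card {\<phi> \<in> mor P. \<phi> ` P = \<theta> ` P} = card (F (\<theta> ` P) (\<theta> ` P))"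
proof -
  let ?P0 = "\<theta> ` P" and ?i = "restrict (inv_into P \<theta>) (\<theta> ` P)"
  let ?E = "{\<phi> \<in> mor P. \<phi> ` P = ?P0}"
  have P0: "sub ?P0" using P \<theta> by (rule mor_image)
  have i: "?i \<in> mor ?P0" "?i ` ?P0 = P" using mor_inverse[OF P \<theta>] inv_image[OF P \<theta>] by auto
  have finE: "finite ?E" using finite_mor[OF P] by simp
  have finF: "finite (F ?P0 ?P0)"
    by (rule finite_subset[OF _ finite_mor[OF P0]]) (use F_self_iff[OF P0] in blast)
  have "card (F ?P0 ?P0) \<le> card ?E"
  proof (rule card_inj_on_le[OF _ _ finE])
    show "inj_on (\<lambda>\<psi>. compose P \<psi> \<theta>) (F ?P0 ?P0)"
      using mor_ext[OF P0] F_self_iff[OF P0] by (intro inj_on_compose) blast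
    show "(\<lambda>\<psi>. compose P \<psi> \<theta>) ` F ?P0 ?P0 \<subseteq> ?E"
    proof
      fix \<phi> assume "\<phi> \<in> (\<lambda>\<psi>. compose P \<psi> \<theta>) ` F ?P0 ?P0"
      then obtain \<psi> where \<psi>: "\<psi> \<in> mor ?P0" "\<psi> ` ?P0 = ?P0" "\<phi> = compose P \<psi> \<theta>"
        using F_self_iff[OF P0] by blast
      have "\<phi> ` P = \<psi> ` ?P0" by (simp add: \<psi>(3) image_image compose_eq cong: image_cong)
      then show "\<phi> \<in> ?E" using mor_comp[OF P P0 \<theta> subset_refl \<psi>(1)] \<psi>(2,3) by simp
    qed
  qed
  moreover have "card ?E \<le> card (F ?P0 ?P0)"
  proof (rule card_inj_on_le[OF _ _ finF])
    show "inj_on (\<lambda>\<psi>. compose ?P0 \<psi> ?i) ?E"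
      using mor_ext[OF P] by (intro inj_on_compose) (auto simp only: i(2))
    show "(\<lambda>\<psi>. compose ?P0 \<psi> ?i) ` ?E \<subseteq> F ?P0 ?P0"
    proof
      fix \<chi> assume "\<chi> \<in> (\<lambda>\<psi>. compose ?P0 \<psi> ?i) ` ?E"
      then obtain \<psi> where \<psi>: "\<psi> \<in> mor P" "\<psi> ` P = ?P0" "\<chi> = compose ?P0 \<psi> ?i" by blast
      have "\<chi> ` ?P0 = \<psi> ` (?i ` ?P0)" unfolding \<psi>(3) image_image by (intro image_cong) (auto simp: compose_eq)
      then have "\<chi> ` ?P0 = ?P0" using i(2) \<psi>(2) by simp
      then show "\<chi> \<in> F ?P0 ?P0"
        using mor_comp[OF P0 P i(1) _ \<psi>(1)] i(2) \<psi>(3) F_self_iff[OF P0] by simp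
    qed
  qed
  ultimately show ?thesis by simp
qed

lemma sylow_size:
  assumes P: "sub P" and fn: "fully_normalized S F P"
  obtains a m where "card (F P P) = p ^ a * m" "\<not> p dvd m" "card (Aut_inner S P) = p ^ a"
proof -
  have "sylow_subgroup p (Aut_inner S P) (Aut_fusion F P)"
    using sat P fn unfolding saturated_def by blast
  then have card: "card (Aut_inner S P) = p ^ multiplicity p (card (F P P))"
    by (simp add: sylow_subgroup_def Aut_fusion_def order_def)
  have "restrict id P \<in> F P P" using F_inclusion[OF P P] by simp
  moreover have "F P P \<subseteq> mor P" using F_self_iff[OF P] by blast
  ultimately have "card (F P P) \<noteq> 0" using finite_subset[OF _ finite_mor[OF P]] by (auto simp: card_eq_0_iff)
  moreover have "\<not> is_unit p" using prime by (simp add: prime_nat_iff)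
  ultimately obtain m where "card (F P P) = p ^ multiplicity p (card (F P P)) * m" "\<not> p dvd m"
    using multiplicity_decompose' by metis
  then show ?thesis using card that by metis
qed

text \<open>
  Let \<open>P0\<close> be fully normalized and conjugate to \<open>P\<close>.  The \<open>p\<close>-group \<open>N(P0) \<times> N(P)\<close> acts on the
  isomorphisms \<open>P \<rightarrow> P0\<close> of \<open>F\<close> by conjugation on either side.  Their number is \<open>|Aut\<^sub>F(P0)|\<close>, whose \<open>p\<close>-part
  is \<open>|Aut\<^sub>S(P0)|\<close> by saturation; so some orbit is no longer than that.  It contains the \<open>|Aut\<^sub>S(P0)|\<close>
  composites of its member \<open>\<phi>0\<close> with inner automorphisms of \<open>P0\<close>, so it consists of them.  In
  particular \<open>\<phi>0 \<circ> c\<^sub>y\<close> has the form \<open>c\<^sub>z \<circ> \<phi>0\<close> for every \<open>y \<in> N(P)\<close>.\<close>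

lemma good_morphism:
  assumes P: "sub P"
  obtains \<phi>0 where "\<phi>0 \<in> mor P" "fully_centralized S F (\<phi>0 ` P)"
    "\<And>y. y \<in> normalizer S P \<Longrightarrow> \<exists>z\<in>carrier S. \<forall>u\<in>P. \<phi>0 (conj_map S y u) = conj_map S z (\<phi>0 u)"
proof -
  have "\<forall>\<theta>. \<theta> \<in> mor P \<longrightarrow> card (normalizer S (\<theta> ` P)) < Suc (card (carrier S))"
  proof (intro allI impI)
    fix \<theta> assume "\<theta> \<in> mor P"
    then have "normalizer S (\<theta> ` P) \<subseteq> carrier S"
      using subgroup.subset[OF sub_normalizer[OF mor_image[OF P]]] by blast
    then show "card (normalizer S (\<theta> ` P)) < Suc (card (carrier S))"
      using card_mono[OF finite_S] by (simp add: less_Suc_eq_le)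
  qed
  from ex_has_greatest_nat[of "\<lambda>\<theta>. \<theta> \<in> mor P", OF mor_id[OF P] this]
  obtain \<theta> where \<theta>: "\<theta> \<in> mor P"
    and max: "\<And>\<theta>'. \<theta>' \<in> mor P \<Longrightarrow> card (normalizer S (\<theta>' ` P)) \<le> card (normalizer S (\<theta> ` P))" by blast
  define P0 where "P0 = \<theta> ` P"
  have P0: "sub P0" unfolding P0_def using P \<theta> by (rule mor_image)
  have fn: "fully_normalized S F P0"
    unfolding fully_normalized_def
  proof
    fix Q assume "Q \<in> fconj_class S F P0"
    then obtain \<chi> where \<chi>: "\<chi> \<in> mor P0" "\<chi> ` P0 = Q" using fconj_class_iff[OF P0] by blast
    have "compose P \<chi> \<theta> \<in> mor P" using mor_comp[OF P P0 \<theta> _ \<chi>(1)] by (simp add: P0_def)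
    moreover have "compose P \<chi> \<theta> ` P = Q"
      by (simp add: \<chi>(2)[symmetric] P0_def image_image compose_eq cong: image_cong)
    ultimately show "card (normalizer S Q) \<le> card (normalizer S P0)" using max unfolding P0_def by blast
  qed
  have fc: "fully_centralized S F P0" using sat P0 fn unfolding saturated_def by blast
  obtain a m where am: "card (F P0 P0) = p ^ a * m" "\<not> p dvd m" and inner: "card (Aut_inner S P0) = p ^ a"
    using sylow_size[OF P0 fn] .
  let ?N0 = "normalizer S P0" and ?N1 = "normalizer S P"
  have N0: "sub ?N0" and N1: "sub ?N1" using sub_normalizer P P0 by auto
  define E where "E = {\<phi> \<in> mor P. \<phi> ` P = P0}"
  define L where "L = S\<lparr>carrier := ?N0\<rparr> \<times>\<times> S\<lparr>carrier := ?N1\<rparr>"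
  \<comment> \<open>The action \<open>(x, y).\<phi> = c\<^sub>x \<circ> \<phi> \<circ> c\<^sub>y\<^sup>-\<^sup>1\<close> on isomorphisms onto \<open>P0\<close>.\<close>
  define \<rho> where "\<rho> = (\<lambda>(x, y). \<lambda>\<phi>\<in>E. \<lambda>u\<in>P. conj_map S x (\<phi> (conj_map S (inv y) u)))"
  have L_carrier: "carrier L = ?N0 \<times> ?N1" by (simp add: L_def)
  have finE: "finite E" using finite_mor[OF P] by (simp add: E_def)
  have E_card: "card E = p ^ a * m" using card_isos[OF P \<theta>] am(1) by (simp add: E_def P0_def)
  obtain i j where "card ?N0 = p ^ i" "card ?N1 = p ^ j" using p_power_card N0 N1 by metis
  then have L_order: "order L = p ^ (i + j)" by (simp add: order_def L_carrier card_cartesian_product power_add)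
  have EP: "\<phi> u \<in> P0" if "\<phi> \<in> E" "u \<in> P" for \<phi> u using that by (auto simp: E_def)
  have inv1: "conj_map S (inv y) u \<in> P" if "y \<in> ?N1" "u \<in> P" for y u
    using normalizer_conj_closed[OF P subgroup.m_inv_closed[OF N1 that(1)] that(2)] .
  have \<rho>E: "\<rho> (x, y) \<phi> \<in> E" if x: "x \<in> ?N0" and y: "y \<in> ?N1" and \<phi>: "\<phi> \<in> E" for x y \<phi>
  proof -
    let ?c = "restrict (conj_map S (inv y)) P" and ?d = "restrict (conj_map S x) P0"
    have xS: "x \<in> carrier S" and yS: "inv y \<in> carrier S" using x y normalizer_sub[OF P0] normalizer_sub[OF P] by auto
    have "inv y \<in> ?N1" using subgroup.m_inv_closed[OF N1 y] .
    then have c_im: "?c ` P = P" using normalizer_sub[OF P] by (simp add: conj_set_def cong: image_cong)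
    have "conj_set S x P0 = P0" using x normalizer_sub[OF P0] by blast
    then have d_im: "?d ` P0 = P0" by (simp add: conj_set_def)
    have 1: "compose P \<phi> ?c \<in> mor P"
      using mor_comp[OF P P mor_conj[OF P yS] _, of \<phi>] c_im \<phi> by (simp add: E_def)
    have 2: "compose P \<phi> ?c ` P = P0"
    proof -
      have "compose P \<phi> ?c ` P = \<phi> ` (?c ` P)" unfolding image_image by (intro image_cong) (auto simp: compose_eq)
      then show ?thesis using c_im \<phi> by (simp add: E_def)
    qed
    have 3: "compose P ?d (compose P \<phi> ?c) \<in> mor P"
      using mor_comp[OF P P0 1 _ mor_conj[OF P0 xS]] 2 by simp
    have 4: "compose P ?d (compose P \<phi> ?c) ` P = P0"
    proof -
      have "compose P ?d (compose P \<phi> ?c) ` P = ?d ` (compose P \<phi> ?c ` P)"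
        unfolding image_image by (intro image_cong) (auto simp: compose_eq)
      then show ?thesis using 2 d_im by simp
    qed
    have "\<rho> (x, y) \<phi> = compose P ?d (compose P \<phi> ?c)"
      using \<phi> EP[OF \<phi>] inv1[OF y] by (auto simp: \<rho>_def compose_def restrict_def fun_eq_iff)
    then show ?thesis using 3 4 by (simp add: E_def)
  qed
  interpret \<rho>: group_action L E \<rho>
  proof (rule group_actionI)
    show "group L" unfolding L_def by (intro DirProd_group subgroup_imp_group N0 N1)
    show "\<rho> g \<in> extensional E" for g by (cases g) (simp add: \<rho>_def)
    fix \<phi> assume \<phi>: "\<phi> \<in> E"
    have PS: "u \<in> carrier S" if "u \<in> P" for u using sub_closed[OF P that] .
    have \<phi>S: "\<phi> u \<in> carrier S" if "u \<in> P" for u using sub_closed[OF P0 EP[OF \<phi> that]] .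
    show "\<rho> \<one>\<^bsub>L\<^esub> \<phi> = \<phi>"
      using mor_ext[OF P, of \<phi>] \<phi> PS \<phi>S
      by (intro extensionalityI[of _ P]) (auto simp: \<rho>_def L_def E_def)
    show "\<rho> g \<phi> \<in> E" if "g \<in> carrier L" for g using that \<phi> \<rho>E by (cases g) (auto simp: L_carrier)
    show "\<rho> (g \<otimes>\<^bsub>L\<^esub> h) \<phi> = \<rho> g (\<rho> h \<phi>)" if g: "g \<in> carrier L" and h: "h \<in> carrier L" for g h
    proof -
      obtain x y x' y' where gh: "g = (x, y)" "h = (x', y')" "x \<in> ?N0" "y \<in> ?N1" "x' \<in> ?N0" "y' \<in> ?N1"
        using g h by (cases g, cases h) (auto simp: L_carrier)
      then have c: "x \<in> carrier S" "y \<in> carrier S" "x' \<in> carrier S" "y' \<in> carrier S"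
        using normalizer_sub[OF P0] normalizer_sub[OF P] by auto
      have eq: "conj_map S (x \<otimes> x') (\<phi> (conj_map S (inv (y \<otimes> y')) u)) =
          conj_map S x (conj_map S x' (\<phi> (conj_map S (inv y') (conj_map S (inv y) u))))" if u: "u \<in> P" for u
        using c u PS \<phi>S[OF inv1[OF gh(6) inv1[OF gh(4) u]]]
        by (simp add: conj_map_mult inv_mult_group)
      have "g \<otimes>\<^bsub>L\<^esub> h = (x \<otimes> x', y \<otimes> y')" by (simp add: gh L_def)
      then show ?thesis
        using \<phi> \<rho>E[OF gh(5,6) \<phi>] eq inv1[OF gh(4)] by (auto simp: \<rho>_def gh(1,2) restrict_def fun_eq_iff)
    qed
  qed
  obtain \<phi>0 k where \<phi>0: "\<phi>0 \<in> E" and k: "card (orbit L \<rho> \<phi>0) = p ^ k" "k \<le> a"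
    using \<rho>.p_group_small_orbit[OF prime L_order finE E_card am(2)] .
  have \<phi>0m: "\<phi>0 \<in> mor P" "\<phi>0 ` P = P0" using \<phi>0 by (auto simp: E_def)
  let ?A = "(\<lambda>\<psi>. compose P \<psi> \<phi>0) ` Aut_inner S P0"
  have "?A \<subseteq> orbit L \<rho> \<phi>0"
  proof
    fix \<psi> assume "\<psi> \<in> ?A"
    then obtain x where x: "x \<in> ?N0" and \<psi>: "\<psi> = compose P (restrict (conj_map S x) P0) \<phi>0"
      unfolding Aut_inner_def by blast
    have "\<rho> (x, \<one>) \<phi>0 = \<psi>"
      using \<phi>0 EP[OF \<phi>0] sub_closed[OF P] by (auto simp: \<rho>_def \<psi> compose_def restrict_def fun_eq_iff)
    moreover have "(x, \<one>) \<in> carrier L" using x subgroup.one_closed[OF N1] by (simp add: L_carrier)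
    ultimately show "\<psi> \<in> orbit L \<rho> \<phi>0" unfolding orbit_def by blast
  qed
  moreover have finO: "finite (orbit L \<rho> \<phi>0)" using \<rho>.orbit_subset[OF \<phi>0] finE finite_subset by blast
  moreover have "card ?A = p ^ a"
  proof -
    have "inj_on (\<lambda>\<psi>. compose P \<psi> \<phi>0) (Aut_inner S P0)"
      by (rule inj_on_compose) (auto simp: Aut_inner_def \<phi>0m(2))
    then show ?thesis using inner by (simp add: card_image)
  qed
  moreover have "p ^ k \<le> p ^ a" using k(2) prime_gt_0_nat[OF prime] by (intro power_increasing) auto
  \<comment> \<open>The two bounds on the orbit length squeeze the orbit onto \<open>Aut\<^sub>S(P0) \<circ> \<phi>0\<close>.\<close>
  ultimately have orb: "?A = orbit L \<rho> \<phi>0" using k(1) card_mono[OF finO, of ?A] by (intro card_subset_eq) auto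
  have "\<exists>z\<in>carrier S. \<forall>u\<in>P. \<phi>0 (conj_map S y u) = conj_map S z (\<phi>0 u)" if y: "y \<in> ?N1" for y
  proof -
    have y': "inv y \<in> ?N1" using subgroup.m_inv_closed[OF N1 y] .
    have yS: "y \<in> carrier S" using y normalizer_sub[OF P] by auto
    have "(\<one>, inv y) \<in> carrier L" using y' subgroup.one_closed[OF N0] by (simp add: L_carrier)
    then have "\<rho> (\<one>, inv y) \<phi>0 \<in> ?A" unfolding orb orbit_def by blast
    then obtain x where x: "x \<in> ?N0" and eq: "\<rho> (\<one>, inv y) \<phi>0 = compose P (restrict (conj_map S x) P0) \<phi>0"
      unfolding Aut_inner_def by blast
    have "\<phi>0 (conj_map S y u) = conj_map S x (\<phi>0 u)" if u: "u \<in> P" for u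
      using fun_cong[OF eq, of u] u \<phi>0 EP[OF \<phi>0] EP[OF \<phi>0 normalizer_conj_closed[OF P y u]] sub_closed[OF P0] yS
      by (simp add: \<rho>_def compose_eq)
    then show ?thesis using x normalizer_sub[OF P0] by blast
  qed
  then show ?thesis using that[of \<phi>0] \<phi>0m fc by simp
qed

lemma sub_extender:
  assumes P: "sub P" and \<phi>: "\<phi> \<in> mor P"
  shows "sub (extender S P \<phi>)"
proof (rule subgroup.intro)
  have PS: "u \<in> carrier S" "\<phi> u \<in> carrier S" if "u \<in> P" for u
    using sub_closed[OF P that] mor_closed[OF P \<phi> that] .
  have N: "sub (normalizer S P)" by (rule sub_normalizer[OF P])
  show "extender S P \<phi> \<subseteq> carrier S" using subgroup.subset[OF N] by (auto simp: extender_def)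
  show "\<one> \<in> extender S P \<phi>"
    using subgroup.one_closed[OF N] PS by (auto simp: extender_def intro!: bexI[of _ \<one>])
  fix x assume "x \<in> extender S P \<phi>"
  then obtain y where x: "x \<in> normalizer S P" and y: "y \<in> carrier S"
    and xy: "\<And>u. u \<in> P \<Longrightarrow> \<phi> (conj_map S x u) = conj_map S y (\<phi> u)" unfolding extender_def by blast
  have xS: "x \<in> carrier S" using x normalizer_sub[OF P] by blast
  have x': "inv x \<in> normalizer S P" using subgroup.m_inv_closed[OF N x] .
  have "\<phi> (conj_map S (inv x) u) = conj_map S (inv y) (\<phi> u)" if u: "u \<in> P" for u
  proof -
    have v: "conj_map S (inv x) u \<in> P" using normalizer_conj_closed[OF P x' u] .
    have "\<phi> u = conj_map S y (\<phi> (conj_map S (inv x) u))" using xy[OF v] xS PS[OF u] by simp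
    then show ?thesis using y PS[OF v] by simp
  qed
  then show "inv x \<in> extender S P \<phi>" using x' y unfolding extender_def by blast
  fix x2 assume "x2 \<in> extender S P \<phi>"
  then obtain y2 where x2: "x2 \<in> normalizer S P" and y2: "y2 \<in> carrier S"
    and xy2: "\<And>u. u \<in> P \<Longrightarrow> \<phi> (conj_map S x2 u) = conj_map S y2 (\<phi> u)" unfolding extender_def by blast
  have x2S: "x2 \<in> carrier S" using x2 normalizer_sub[OF P] by blast
  have "\<phi> (conj_map S (x \<otimes> x2) u) = conj_map S (y \<otimes> y2) (\<phi> u)" if u: "u \<in> P" for u
    using xy[OF normalizer_conj_closed[OF P x2 u]] xy2[OF u] xS x2S y y2 PS[OF u] by (simp add: conj_map_mult)
  then show "x \<otimes> x2 \<in> extender S P \<phi>"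
    using subgroup.m_closed[OF N x x2] y y2 unfolding extender_def by blast
qed

text \<open>A pair normalizes the graph of \<open>\<phi>\<close> iff \<open>\<phi>\<close> intertwines the two conjugations.\<close>

lemma mem_normalizer_graph:
  assumes P: "sub P" and \<phi>: "\<phi> \<in> mor P"
  shows "(x, y) \<in> normalizer T (twisted_diag P \<phi>) \<longleftrightarrow> x \<in> carrier S \<and> y \<in> normalizer S P \<and>
    (\<forall>u\<in>P. conj_map S x (\<phi> u) = \<phi> (conj_map S y u))" (is "?L \<longleftrightarrow> ?R")
proof -
  interpret T: group T by (rule group_T)
  let ?V = "twisted_diag P \<phi>"
  have VT: "?V \<subseteq> carrier T" using subgroup_twisted_diag[OF P \<phi>] by (rule subgroup.subset)
  have "?L \<longleftrightarrow> x \<in> carrier S \<and> y \<in> carrier S \<and> conj_set T (x, y) ?V = ?V"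
    by (simp add: T.mem_normalizer[OF VT])
  also have "\<dots> \<longleftrightarrow> ?R"
  proof (cases "x \<in> carrier S \<and> y \<in> carrier S")
    case True
    then have eq: "conj_set T (x, y) ?V = (\<lambda>u. (conj_map S x (\<phi> u), conj_map S y u)) ` P"
      by (simp add: conj_set_T twisted_diag_eq_image image_image)
    have "(\<lambda>u. (conj_map S x (\<phi> u), conj_map S y u)) ` P = ?V \<longleftrightarrow>
        conj_set S y P = P \<and> (\<forall>u\<in>P. conj_map S x (\<phi> u) = \<phi> (conj_map S y u))"
    proof
      assume *: "(\<lambda>u. (conj_map S x (\<phi> u), conj_map S y u)) ` P = ?V"
      then have "snd ` (\<lambda>u. (conj_map S x (\<phi> u), conj_map S y u)) ` P = snd ` ?V" by (rule arg_cong)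
      then have "conj_set S y P = P" by (simp add: image_image conj_set_def)
      moreover have "conj_map S x (\<phi> u) = \<phi> (conj_map S y u)" if "u \<in> P" for u
      proof -
        have "(conj_map S x (\<phi> u), conj_map S y u) \<in> ?V" unfolding *[symmetric] using that by (rule imageI)
        then show ?thesis by simp
      qed
      ultimately show "conj_set S y P = P \<and> (\<forall>u\<in>P. conj_map S x (\<phi> u) = \<phi> (conj_map S y u))" by blast
    next
      assume *: "conj_set S y P = P \<and> (\<forall>u\<in>P. conj_map S x (\<phi> u) = \<phi> (conj_map S y u))"
      then have "(\<lambda>u. (conj_map S x (\<phi> u), conj_map S y u)) ` P = (\<lambda>v. (\<phi> v, v)) ` (conj_set S y P)"
        unfolding conj_set_def image_image by (intro image_cong) auto
      then show "(\<lambda>u. (conj_map S x (\<phi> u), conj_map S y u)) ` P = ?V"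
        using * by (simp add: twisted_diag_eq_image)
    qed
    then show ?thesis using True by (simp add: eq normalizer_sub[OF P])
  qed (auto simp: normalizer_sub[OF P])
  finally show ?thesis .
qed

text \<open>If \<open>(x, y)\<close> normalizes the graph of \<open>\<phi>\<close>, then conjugation by \<open>x\<close> on \<open>\<phi>(P)\<close> corresponds under
  \<open>\<phi>0 \<circ> \<phi>\<^sup>-\<^sup>1\<close> to \<open>\<phi>0 \<circ> c\<^sub>y \<circ> \<phi>0\<^sup>-\<^sup>1\<close>, which is induced by an element of \<open>S\<close>.  So \<open>x\<close> lies in the extender of
  \<open>\<phi>0 \<circ> \<phi>\<^sup>-\<^sup>1\<close>, over which saturation provides the extension \<open>\<alpha>\<close>.\<close>

lemma extend_over_normalizer:
  assumes P: "sub P" and \<phi>0: "\<phi>0 \<in> mor P" "fully_centralized S F (\<phi>0 ` P)"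
    and norm: "\<And>y. y \<in> normalizer S P \<Longrightarrow> \<exists>z\<in>carrier S. \<forall>u\<in>P. \<phi>0 (conj_map S y u) = conj_map S z (\<phi>0 u)"
    and \<phi>: "\<phi> \<in> mor P"
  obtains R \<alpha> where "sub R" "\<alpha> \<in> mor R" "fst ` normalizer T (twisted_diag P \<phi>) \<subseteq> R"
    "\<And>u. u \<in> P \<Longrightarrow> \<alpha> (\<phi> u) = \<phi>0 u"
proof -
  let ?Q = "\<phi> ` P" and ?i = "restrict (inv_into P \<phi>) (\<phi> ` P)"
  let ?\<theta> = "compose ?Q \<phi>0 ?i"
  have Q: "sub ?Q" using P \<phi> by (rule mor_image)
  have \<theta>: "?\<theta> \<in> mor ?Q"
    by (rule mor_comp[OF Q P mor_inverse[OF P \<phi>] _ \<phi>0(1)]) (simp only: inv_image[OF P \<phi>] subset_refl)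
  have \<theta>\<phi>: "?\<theta> (\<phi> u) = \<phi>0 u" if "u \<in> P" for u
    using that inv_into_f_f[OF mor_inj[OF P \<phi>] that] by (simp add: compose_eq)
  then have "?\<theta> ` ?Q = \<phi>0 ` P" unfolding image_image by (intro image_cong) auto
  then have "fully_centralized S F (?\<theta> ` ?Q)" using \<phi>0(2) by simp
  then obtain \<alpha> where \<alpha>: "\<alpha> \<in> F (extender S ?Q ?\<theta>) (carrier S)" "\<forall>u\<in>?Q. \<alpha> u = ?\<theta> u"
    using sat Q \<theta> unfolding saturated_def mor_def by blast
  have "x \<in> extender S ?Q ?\<theta>" if xy: "(x, y) \<in> normalizer T (twisted_diag P \<phi>)" for x y
  proof -
    have x: "x \<in> carrier S" and y: "y \<in> normalizer S P"
      and eq: "\<And>u. u \<in> P \<Longrightarrow> conj_map S x (\<phi> u) = \<phi> (conj_map S y u)"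
      using xy mem_normalizer_graph[OF P \<phi>] by auto
    have "conj_set S x ?Q = \<phi> ` conj_set S y P"
      unfolding conj_set_def image_image by (intro image_cong refl eq)
    then have "conj_set S x ?Q = ?Q" using y normalizer_sub[OF P] by simp
    then have "x \<in> normalizer S ?Q" using x normalizer_sub[OF Q] by blast
    moreover obtain z where z: "z \<in> carrier S" "\<forall>u\<in>P. \<phi>0 (conj_map S y u) = conj_map S z (\<phi>0 u)"
      using norm[OF y] by blast
    moreover have "?\<theta> (conj_map S x v) = conj_map S z (?\<theta> v)" if v: "v \<in> ?Q" for v
    proof -
      obtain u where u: "u \<in> P" "v = \<phi> u" using v by blast
      then show ?thesis
        using eq[OF u(1)] \<theta>\<phi>[OF u(1)] \<theta>\<phi>[OF normalizer_conj_closed[OF P y u(1)]] z(2) by simp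
    qed
    ultimately show ?thesis unfolding extender_def by blast
  qed
  then have "fst ` normalizer T (twisted_diag P \<phi>) \<subseteq> extender S ?Q ?\<theta>" by auto
  moreover have "\<alpha> (\<phi> u) = \<phi>0 u" if "u \<in> P" for u using \<alpha>(2) \<theta>\<phi>[OF that] that by simp
  ultimately show ?thesis
    using that[OF sub_extender[OF Q \<theta>]] \<alpha>(1) unfolding mor_def by blast
qed

section \<open>Existence of an element with the target marks\<close>

lemma diag_in_normalizer:
  assumes P: "sub P" and \<phi>: "\<phi> \<in> mor P"
  shows "twisted_diag P \<phi> \<subseteq> normalizer T (twisted_diag P \<phi>)"
proof -
  have "(\<phi> u, u) \<in> normalizer T (twisted_diag P \<phi>)" if u: "u \<in> P" for u
  proof -
    have "conj_map S (\<phi> u) (\<phi> v) = \<phi> (conj_map S u v)" if v: "v \<in> P" for v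
      using u v P \<phi> by (simp add: conj_map_def mor_hom mor_inv subgroup.m_closed subgroup.m_inv_closed)
    then show ?thesis
      using mor_closed[OF P \<phi> u] normalizer_contains[OF P u] unfolding mem_normalizer_graph[OF P \<phi>] by blast
  qed
  then show ?thesis by (auto simp: twisted_diag_def)
qed

lemma sub_normalizer_T:
  "U \<in> graphs \<Longrightarrow> subgroup (normalizer T U) T"
  by (rule group.normalizer_imp_subgroup[OF group_T subgroup.subset[OF graphs_subgroup]])

lemma normalizer_T_iff:
  assumes "U \<in> graphs"
  shows "g \<in> normalizer T U \<longleftrightarrow> g \<in> carrier T \<and> conj_set T g U = U"
  by (rule group.mem_normalizer[OF group_T subgroup.subset[OF graphs_subgroup[OF assms]]])

lemma p_power_card_T:
  assumes "subgroup K T"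
  obtains i where "card K = p ^ i"
proof -
  have "card K dvd p ^ (n + n)"
    using group.lagrange[OF group_T assms] order_S
    by (metis dvd_triv_right order_def card_cartesian_product carrier_DirProd power_add)
  then show ?thesis using that prime by (auto simp: divides_primepow_nat)
qed

text \<open>A realizable function that is right on all larger graphs agrees, up to a multiple of
  \<open>|N(V)|/|P|\<close>, with its value at the good graph: the extension of \<open>\<phi>0\<close> embeds \<open>N(V)\<close> into
  \<open>N(V0)\<close>, and the two orbit-counting congruences differ only in the terms of \<open>V\<close> and \<open>V0\<close>.\<close>

lemma value_congruence:
  assumes f: "realizable f" and P: "sub P"
    and above: "\<And>Q \<psi>. \<lbrakk>sub Q; card P < card Q; \<psi> \<in> mor Q\<rbrakk> \<Longrightarrow> f (twisted_diag Q \<psi>) = target (twisted_diag Q \<psi>)"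
    and \<phi>0: "\<phi>0 \<in> mor P" "fully_centralized S F (\<phi>0 ` P)"
    and norm: "\<And>y. y \<in> normalizer S P \<Longrightarrow> \<exists>z\<in>carrier S. \<forall>u\<in>P. \<phi>0 (conj_map S y u) = conj_map S z (\<phi>0 u)"
    and \<phi>: "\<phi> \<in> mor P"
  shows "\<exists>z\<in>Zp. of_nat (card P) * (f (twisted_diag P \<phi>) - f (twisted_diag P \<phi>0)) =
    of_nat (card (normalizer T (twisted_diag P \<phi>))) * z"
proof -
  interpret T: group T by (rule group_T)
  define V where "V = twisted_diag P \<phi>"
  define V0 where "V0 = twisted_diag P \<phi>0"
  define K where "K = normalizer T V"
  obtain R \<alpha> where R: "sub R" and \<alpha>: "\<alpha> \<in> mor R" and KR: "fst ` K \<subseteq> R"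
    and \<alpha>\<phi>: "\<And>u. u \<in> P \<Longrightarrow> \<alpha> (\<phi> u) = \<phi>0 u"
    using extend_over_normalizer[OF P \<phi>0 norm \<phi>] unfolding K_def V_def by metis
  \<comment> \<open>The embedding of the normalizer of \<open>V\<close> into that of \<open>V0\<close>.\<close>
  define \<iota> :: "'a \<times> 'a \<Rightarrow> 'a \<times> 'a" where "\<iota> = map_prod \<alpha> id"
  have V: "V \<in> graphs" and V0: "V0 \<in> graphs" unfolding V_def V0_def using P \<phi> \<phi>0(1) by (auto intro: graphsI)
  have VT: "subgroup V T" "V \<subseteq> carrier T" and V0T: "V0 \<subseteq> carrier T"
    by (rule graphs_subgroup[OF V] subgroup.subset[OF graphs_subgroup[OF V]]
        subgroup.subset[OF graphs_subgroup[OF V0]])+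
  have K: "subgroup K T" unfolding K_def by (rule sub_normalizer_T[OF V])
  have KT: "K \<subseteq> carrier T" using K by (rule subgroup.subset)
  have VK: "V \<subseteq> K" unfolding K_def V_def by (rule diag_in_normalizer[OF P \<phi>])
  have KR': "K \<subseteq> R \<times> carrier S" using KR KT by force
  have finK: "finite K" using KT finite_T finite_subset by blast
  have inj: "inj_on \<iota> K"
    using KR' inj_onD[OF mor_inj[OF R \<alpha>]] unfolding \<iota>_def inj_on_def by fastforce
  have hom: "\<iota> (g \<otimes>\<^bsub>T\<^esub> h) = \<iota> g \<otimes>\<^bsub>T\<^esub> \<iota> h" if "g \<in> K" "h \<in> K" for g h
    using subsetD[OF KR' that(1)] subsetD[OF KR' that(2)] mor_hom[OF R \<alpha>]
    by (cases g, cases h) (simp add: \<iota>_def)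
  have cl: "\<iota> g \<in> carrier T" if "g \<in> K" for g
    using subsetD[OF KR' that] mor_closed[OF R \<alpha>] by (cases g) (simp add: \<iota>_def)
  interpret \<iota>: group_hom "T\<lparr>carrier := K\<rparr>" T \<iota>
    using hom cl by (auto simp: group_hom_def group_hom_axioms_def hom_def T.subgroup_imp_group[OF K] T.is_group)
  have \<iota>K: "subgroup (\<iota> ` K) T" using \<iota>.img_is_subgroup by simp
  have \<iota>V: "\<iota> ` V = V0"
    unfolding V_def V0_def twisted_diag_eq_image image_image \<iota>_def by (intro image_cong) (auto simp: \<alpha>\<phi>)
  have \<iota>norm: "conj_set T k V0 \<subseteq> V0" if "k \<in> \<iota> ` K" for k
  proof -
    obtain x y where xy: "(x, y) \<in> K" "k = \<iota> (x, y)" using \<open>k \<in> \<iota> ` K\<close> by force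
    have x: "x \<in> carrier S" and y: "y \<in> normalizer S P"
      and eq: "\<And>u. u \<in> P \<Longrightarrow> conj_map S x (\<phi> u) = \<phi> (conj_map S y u)"
      using xy(1) mem_normalizer_graph[OF P \<phi>] unfolding K_def V_def by auto
    have xR: "x \<in> R" using KR' xy(1) by auto
    have "conj_map S (\<alpha> x) (\<phi>0 u) = \<phi>0 (conj_map S y u)" if u: "u \<in> P" for u
    proof -
      have "(\<phi> u, u) \<in> K" using VK u by (auto simp: V_def)
      then have uR: "\<phi> u \<in> R" using KR' by auto
      have "conj_map S (\<alpha> x) (\<alpha> (\<phi> u)) = \<alpha> (conj_map S x (\<phi> u))"
        using xR uR R \<alpha> by (simp add: conj_map_def mor_hom mor_inv subgroup.m_closed subgroup.m_inv_closed)
      then show ?thesis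
        using eq[OF u] \<alpha>\<phi>[OF u] \<alpha>\<phi>[OF normalizer_conj_closed[OF P y u]] by simp
    qed
    then have "(\<alpha> x, y) \<in> normalizer T V0"
      using mor_closed[OF R \<alpha> xR] y mem_normalizer_graph[OF P \<phi>0(1)] unfolding V0_def by blast
    then show ?thesis using normalizer_T_iff[OF V0] by (simp add: xy(2) \<iota>_def)
  qed
  have right: "f D = target D" if D: "subgroup D T" and card: "card P < card D" for D
  proof (cases "D \<in> graphs")
    case True
    then obtain Q \<psi> where "sub Q" "\<psi> \<in> mor Q" "D = twisted_diag Q \<psi>" by (rule graphsE)
    then show ?thesis using above card by simp
  next
    case False
    then have "\<not> D \<subseteq> W" if "W \<in> graphs" for W using graphs_downward[OF that D] by blast
    then show ?thesis using realizable_zero[OF f, of D] False by (simp add: target_def)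
  qed
  \<comment> \<open>Outside \<open>V\<close> the subgroup generated by \<open>V\<close> and \<open>k\<close> is larger than \<open>V\<close>, where \<open>f\<close> is already the
    target, and \<open>\<iota>\<close> preserves the target.\<close>
  have step: "f (insert k V) = f (insert (\<iota> k) V0)" if k: "k \<in> K" "k \<notin> V" for k
  proof -
    define D where "D = generate T (insert k V)"
    have ins: "insert k V \<subseteq> K" "insert k V \<subseteq> carrier T" using k VK KT by auto
    have D: "subgroup D T" unfolding D_def by (rule T.generate_is_subgroup[OF ins(2)])
    have incl: "insert k V \<subseteq> D" unfolding D_def by (auto intro: generate.incl)
    have DK: "D \<subseteq> K" unfolding D_def by (rule T.generate_subgroup_incl[OF ins(1) K])
    have finD: "finite D" using DK finK finite_subset by blast
    have sub_iff: "insert k V \<subseteq> W \<longleftrightarrow> D \<subseteq> W" if "W \<in> graphs" for W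
      using incl T.generate_subgroup_incl[OF _ graphs_subgroup[OF that], of "insert k V"] unfolding D_def by blast
    have \<iota>sub_iff: "insert (\<iota> k) V0 \<subseteq> W \<longleftrightarrow> \<iota> ` D \<subseteq> W" if W: "W \<in> graphs" for W
    proof
      assume "\<iota> ` D \<subseteq> W"
      then show "insert (\<iota> k) V0 \<subseteq> W" using incl \<iota>V by blast
    next
      assume *: "insert (\<iota> k) V0 \<subseteq> W"
      have Ws: "subgroup W T" using W by (rule graphs_subgroup)
      have "subgroup {d \<in> K. \<iota> d \<in> W} T"
      proof (rule subgroup.intro)
        show "{d \<in> K. \<iota> d \<in> W} \<subseteq> carrier T" using KT by blast
        show "\<one>\<^bsub>T\<^esub> \<in> {d \<in> K. \<iota> d \<in> W}"
          using subgroup.one_closed[OF K] subgroup.one_closed[OF Ws] \<iota>.hom_one by simp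
        show "g \<otimes>\<^bsub>T\<^esub> h \<in> {d \<in> K. \<iota> d \<in> W}" if "g \<in> {d \<in> K. \<iota> d \<in> W}" "h \<in> {d \<in> K. \<iota> d \<in> W}" for g h
          using that hom subgroup.m_closed[OF K] subgroup.m_closed[OF Ws] by simp
        show "inv\<^bsub>T\<^esub> g \<in> {d \<in> K. \<iota> d \<in> W}" if "g \<in> {d \<in> K. \<iota> d \<in> W}" for g
        proof -
          have "\<iota> (inv\<^bsub>T\<^esub> g) = inv\<^bsub>T\<^esub> (\<iota> g)"
            using that \<iota>.hom_inv[of g] T.m_inv_consistent[OF K] by simp
          then show ?thesis using that subgroup.m_inv_closed[OF K] subgroup.m_inv_closed[OF Ws] by simp
        qed
      qed
      then have "D \<subseteq> {d \<in> K. \<iota> d \<in> W}"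
        unfolding D_def using * ins(1) \<iota>V by (intro T.generate_subgroup_incl) auto
      then show "\<iota> ` D \<subseteq> W" by blast
    qed
    have "V \<subset> D" using incl k(2) by blast
    then have card: "card P < card D" using psubset_card_mono[OF finD, of V] card_twisted_diag[of P \<phi>] unfolding V_def by metis
    have \<iota>D: "subgroup (\<iota> ` D) T"
      using \<iota>.subgroup_img_is_subgroup[OF T.subgroup_incl[OF D K DK]] .
    have "card (\<iota> ` D) = card D" using card_image inj_on_subset[OF inj DK] by blast
    then have r: "f (\<iota> ` D) = target (\<iota> ` D)" using right[OF \<iota>D] card by simp
    have "target (\<iota> ` D) = target D"
      unfolding \<iota>_def using DK KR' R \<alpha> mor_restrict_self[OF R \<alpha>] mor_id[OF sub_carrier]
      by (intro target_push[of D R "carrier S"]) auto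
    then show ?thesis
      using realizable_cong[OF f sub_iff] realizable_cong[OF f \<iota>sub_iff] right[OF D card] r by simp
  qed
  obtain z where z: "z \<in> Zp" "(\<Sum>k\<in>K. f (insert k V)) = of_nat (card K) * z"
    using realizable_congruence[OF f K VT(2)] normalizer_T_iff[OF V] unfolding K_def by auto
  obtain z' where z': "z' \<in> Zp" "(\<Sum>k\<in>\<iota> ` K. f (insert k V0)) = of_nat (card (\<iota> ` K)) * z'"
    using realizable_congruence[OF f \<iota>K V0T \<iota>norm] by blast
  have "of_nat (card K) * z - of_nat (card K) * z' =
      (\<Sum>k\<in>K. f (insert k V)) - (\<Sum>k\<in>K. f (insert (\<iota> k) V0))"
    using z(2) z'(2) by (simp add: card_image[OF inj] sum.reindex[OF inj])
  also have "\<dots> = (\<Sum>k\<in>K. f (insert k V) - f (insert (\<iota> k) V0))" by (simp add: sum_subtractf)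
  also have "\<dots> = (\<Sum>k\<in>V. f V - f V0)"
  proof (rule sum.mono_neutral_cong_right[OF finK VK])
    show "\<forall>k\<in>K - V. f (insert k V) - f (insert (\<iota> k) V0) = 0" using step by simp
    fix k assume "k \<in> V"
    then have "insert k V = V" "insert (\<iota> k) V0 = V0" using \<iota>V by auto
    then show "f (insert k V) - f (insert (\<iota> k) V0) = f V - f V0" by simp
  qed
  also have "\<dots> = of_nat (card P) * (f V - f V0)" by (simp add: V_def)
  finally show ?thesis
    using z(1) z'(1) prime unfolding K_def V_def V0_def by (intro bexI[of _ "z - z'"]) (auto simp: algebra_simps)
qed

text \<open>The group \<open>C(\<phi>(P)) \<times> 1\<close> acts freely on the fixed points of the graph of \<open>\<phi>\<close>, because no graph
  contains \<open>(x, 1)\<close> with \<open>x \<noteq> 1\<close>.\<close>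

lemma centralizer_divides_value:
  assumes f: "realizable f" and P: "sub P" and \<phi>: "\<phi> \<in> mor P"
  shows "\<exists>z\<in>Zp. f (twisted_diag P \<phi>) = of_nat (card (centralizer S (\<phi> ` P))) * z"
proof -
  define V where "V = twisted_diag P \<phi>"
  let ?C = "centralizer S (\<phi> ` P)"
  let ?K = "?C \<times> {\<one>}"
  have V: "V \<in> graphs" unfolding V_def using P \<phi> by (rule graphsI)
  have VT: "V \<subseteq> carrier T" using graphs_subgroup[OF V] by (rule subgroup.subset)
  have C: "sub ?C" by (rule centralizer_sub[OF mor_image[OF P \<phi>]])
  have K: "subgroup ?K T" by (rule DirProd_subgroups[OF is_group C is_group triv_subgroup])
  have norm: "conj_set T k V \<subseteq> V" if "k \<in> ?K" for k
  proof -
    obtain x where x: "k = (x, \<one>)" "x \<in> ?C" using \<open>k \<in> ?K\<close> by blast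
    have xS: "x \<in> carrier S" using x(2) by (simp add: centralizer_def)
    have "conj_map S x (\<phi> u) = \<phi> u" if u: "u \<in> P" for u
      using x(2) xS mor_closed[OF P \<phi> u] u by (simp add: conj_map_def centralizer_def m_assoc)
    then show ?thesis
      using x xS sub_closed[OF P] by (auto simp: conj_set_T V_def twisted_diag_def)
  qed
  obtain z where z: "z \<in> Zp" "(\<Sum>k\<in>?K. f (insert k V)) = of_nat (card ?K) * z"
    using realizable_congruence[OF f K VT norm] by blast
  have "(\<Sum>k\<in>?K. f (insert k V)) = (\<Sum>k\<in>{(\<one>, \<one>)}. f V)"
  proof (rule sum.mono_neutral_cong_right)
    show "finite ?K" using finite_sub[OF C] by simp
    show "{(\<one>, \<one>)} \<subseteq> ?K" using subgroup.one_closed[OF C] by simp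
    show "\<forall>k\<in>?K - {(\<one>, \<one>)}. f (insert k V) = 0"
    proof
      fix k assume k: "k \<in> ?K - {(\<one>, \<one>)}"
      then obtain x where x: "k = (x, \<one>)" "x \<noteq> \<one>" by auto
      have "\<not> insert k V \<subseteq> W" if W: "W \<in> graphs" for W
      proof
        assume "insert k V \<subseteq> W"
        moreover have "(\<one>, \<one>) \<in> W" using subgroup.one_closed[OF graphs_subgroup[OF W]] by simp
        ultimately show False using graphs_single_valued[OF W, of x \<one> \<one>] x by auto
      qed
      then show "f (insert k V) = 0" by (rule realizable_zero[OF f])
    qed
    show "f (insert k V) = f V" if "k \<in> {(\<one>, \<one>)}" for k
    proof -
      have "k \<in> V" using that subgroup.one_closed[OF graphs_subgroup[OF V]] by simp
      then show ?thesis by (simp add: insert_absorb)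
    qed
  qed
  then show ?thesis using z by (auto simp: V_def card_cartesian_product)
qed

text \<open>The second projection maps \<open>N(\<Delta>(P, \<phi>))\<close> to \<open>N(P)\<close> with fibers that are cosets of \<open>C(\<phi>(P))\<close>, and
  \<open>\<phi>0(P)\<close> is fully centralized.  All orders are powers of \<open>p\<close>, so the inequality is a divisibility.\<close>

lemma card_normalizer_dvd:
  assumes P: "sub P" and \<phi>0: "\<phi>0 \<in> mor P" "fully_centralized S F (\<phi>0 ` P)" and \<phi>: "\<phi> \<in> mor P"
  shows "card (normalizer T (twisted_diag P \<phi>)) dvd card (centralizer S (\<phi>0 ` P)) * card (normalizer S P)"
proof -
  let ?V = "twisted_diag P \<phi>" and ?C = "centralizer S (\<phi> ` P)" and ?Z = "centralizer S (\<phi>0 ` P)"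
  let ?K = "normalizer T (twisted_diag P \<phi>)" and ?N = "normalizer S P"
  have C: "sub ?C" and C0: "sub ?Z" by (auto intro!: centralizer_sub mor_image P \<phi> \<phi>0)
  have N: "sub ?N" by (rule sub_normalizer[OF P])
  \<comment> \<open>A reference point in each fiber of the second projection.\<close>
  define r where "r y = (SOME x. (x, y) \<in> ?K)" for y
  have r: "(r y, y) \<in> ?K" if "(x, y) \<in> ?K" for x y unfolding r_def using that by (rule someI)
  have "card ?K \<le> card (?C \<times> ?N)"
  proof (rule card_inj_on_le)
    show "inj_on (\<lambda>(x, y). (inv (r y) \<otimes> x, y)) ?K"
    proof (rule inj_onI)
      fix k k' assume k: "k \<in> ?K" "k' \<in> ?K"
        and eq: "(case k of (x, y) \<Rightarrow> (inv (r y) \<otimes> x, y)) = (case k' of (x, y) \<Rightarrow> (inv (r y) \<otimes> x, y))"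
      obtain x y x' where kxy: "k = (x, y)" "k' = (x', y)" using eq by (cases k, cases k') simp
      then have xy: "(x, y) \<in> ?K" "(x', y) \<in> ?K" using k by simp_all
      have "x \<in> carrier S" "x' \<in> carrier S" "r y \<in> carrier S"
        using xy r[OF xy(1)] unfolding mem_normalizer_graph[OF P \<phi>] by blast+
      then show "k = k'" using eq by (simp add: kxy)
    qed
    show "(\<lambda>(x, y). (inv (r y) \<otimes> x, y)) ` ?K \<subseteq> ?C \<times> ?N"
    proof (rule image_subsetI)
      fix k assume k: "k \<in> ?K"
      obtain x y where kxy: "k = (x, y)" by (cases k)
      then have xy: "(x, y) \<in> ?K" using k by simp
      have x: "x \<in> carrier S" "\<And>u. u \<in> P \<Longrightarrow> conj_map S x (\<phi> u) = \<phi> (conj_map S y u)" "y \<in> ?N"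
        using xy unfolding mem_normalizer_graph[OF P \<phi>] by blast+
      have ry: "r y \<in> carrier S" "\<And>u. u \<in> P \<Longrightarrow> conj_map S (r y) (\<phi> u) = \<phi> (conj_map S y u)"
        using r[OF xy] unfolding mem_normalizer_graph[OF P \<phi>] by blast+
      have "inv (r y) \<otimes> x \<otimes> \<phi> u = \<phi> u \<otimes> (inv (r y) \<otimes> x)" if u: "u \<in> P" for u
        using conj_map_eq_iff[OF x(1) ry(1) mor_closed[OF P \<phi> u]] x(2)[OF u] ry(2)[OF u] by simp
      then show "(case k of (x, y) \<Rightarrow> (inv (r y) \<otimes> x, y)) \<in> ?C \<times> ?N"
        using x(1,3) ry(1) by (simp add: kxy centralizer_def)
    qed
    show "finite (?C \<times> ?N)" using finite_sub[OF C] finite_sub[OF N] by simp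
  qed
  also have "\<dots> = card ?C * card ?N" by (rule card_cartesian_product)
  also have "\<dots> \<le> card ?Z * card ?N"
  proof -
    let ?Q0 = "\<phi>0 ` P"
    have Q0: "sub ?Q0" using P \<phi>0(1) by (rule mor_image)
    have "compose ?Q0 \<phi> (restrict (inv_into P \<phi>0) ?Q0) \<in> mor ?Q0"
      by (rule mor_comp[OF Q0 P mor_inverse[OF P \<phi>0(1)] _ \<phi>]) (simp only: inv_image[OF P \<phi>0(1)] subset_refl)
    moreover have "compose ?Q0 \<phi> (restrict (inv_into P \<phi>0) ?Q0) ` ?Q0 = \<phi> ` P"
    proof -
      have "compose ?Q0 \<phi> (restrict (inv_into P \<phi>0) ?Q0) ` ?Q0 = \<phi> ` (restrict (inv_into P \<phi>0) ?Q0 ` ?Q0)"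
        unfolding image_image by (intro image_cong) (auto simp: compose_eq)
      then show ?thesis unfolding inv_image[OF P \<phi>0(1)] .
    qed
    ultimately have "\<phi> ` P \<in> fconj_class S F ?Q0" using fconj_class_iff[OF Q0] by blast
    then show ?thesis using \<phi>0(2) unfolding fully_centralized_def by simp
  qed
  finally have le: "card ?K \<le> card ?Z * card ?N" .
  obtain i where i: "card ?K = p ^ i" using p_power_card_T[OF sub_normalizer_T[OF graphsI[OF P \<phi>]]] .
  obtain j where j: "card ?Z = p ^ j" using p_power_card[OF C0] .
  obtain k where k: "card ?N = p ^ k" using p_power_card[OF N] .
  have "p ^ i \<le> p ^ (j + k)" using le by (simp add: i j k power_add)
  then have "i \<le> j + k" using power_le_imp_le_exp[OF prime_gt_1_nat[OF prime]] by blast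
  then have "p ^ i dvd p ^ (j + k)" by (rule le_imp_power_dvd)
  then show ?thesis by (simp add: i j k power_add)
qed

text \<open>At \<open>P = S\<close> normalizers do not grow, and the divisibility of the target by the order of the
  centralizer is the statement that \<open>Inn(S)\<close> is a Sylow subgroup of \<open>Aut\<^sub>F(S)\<close>.\<close>

lemma centralizer_divides_target_carrier:
  assumes \<phi>0: "\<phi>0 \<in> mor (carrier S)"
  shows "\<exists>z\<in>Zp. of_nat (order S) / of_nat (card (mor (carrier S))) =
    of_nat (card (centralizer S (\<phi>0 ` carrier S))) * z"
proof -
  have im: "\<chi> ` carrier S = carrier S" if \<chi>: "\<chi> \<in> mor (carrier S)" for \<chi>
    using endo_inj_surj[OF finite_S _ mor_inj[OF sub_carrier \<chi>]] mor_closed[OF sub_carrier \<chi>] by auto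
  have fn: "fully_normalized S F (carrier S)"
    using im fconj_class_iff[OF sub_carrier] by (auto simp: fully_normalized_def)
  obtain a m where am: "card (F (carrier S) (carrier S)) = p ^ a * m" "\<not> p dvd m"
    and inner: "card (Aut_inner S (carrier S)) = p ^ a"
    using sylow_size[OF sub_carrier fn] .
  have N: "normalizer S (carrier S) = carrier S"
    using normalizer_contains[OF sub_carrier] normalizer_sub[OF sub_carrier] by blast
  have "carrier S \<inter> centralizer S (carrier S) = centralizer S (carrier S)" by (auto simp: centralizer_def)
  then have ord: "order S = p ^ a * card (centralizer S (carrier S))"
    using card_Aut_inner[OF sub_carrier] inner by (simp add: N order_def)
  then have "of_nat (order S) / of_nat (card (mor (carrier S))) =
      (of_nat (p ^ a) * of_nat (card (centralizer S (carrier S))) / (of_nat (p ^ a) * of_nat m) :: rat)"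
    unfolding mor_def am(1) ord by (simp only: of_nat_mult)
  also have "\<dots> = of_nat (card (centralizer S (carrier S))) * (1 / of_nat m)"
    using prime_gt_0_nat[OF prime] by simp
  finally have "of_nat (order S) / of_nat (card (mor (carrier S))) =
      of_nat (card (centralizer S (\<phi>0 ` carrier S))) * (1 / of_nat m :: rat)"
    using im[OF \<phi>0] by simp
  moreover have "\<not> int p dvd int m" using am(2) by (simp only: int_dvd_int_iff not_False_eq_True)
  then have "1 / of_nat m \<in> Zp" using Z_locI[of p "int m" 1] by simp
  ultimately show ?thesis by blast
qed


lemma twisted_diag_inj: 
  assumes "sub P"
  shows "inj_on (twisted_diag P) (mor P)"
proof (rule inj_onI)
  fix \<phi> \<psi> assume "\<phi> \<in> mor P" "\<psi> \<in> mor P" "twisted_diag P \<phi> = twisted_diag P \<psi>"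
  then show "\<phi> = \<psi>"
    using twisted_diag_subset_iff[OF mor_ext[OF assms], of \<phi> P \<psi>] mor_restrict_self[OF assms] by auto
qed

lemma mark_self:
  assumes U: "U \<in> graphs"
  shows "mark U U = of_nat (card (normalizer T U)) / of_nat (card U)"
proof -
  interpret T: group T by (rule group_T)
  have UT: "U \<subseteq> carrier T" using graphs_subgroup[OF U] by (rule subgroup.subset)
  have iff: "U \<subseteq> conj_set T g U \<longleftrightarrow> g \<in> normalizer T U" if g: "g \<in> carrier T" for g
  proof -
    have "finite (conj_set T g U)" using T.conj_set_closed[OF g UT] finite_T finite_subset by blast
    then have "U \<subseteq> conj_set T g U \<longleftrightarrow> conj_set T g U = U"
      using card_subset_eq[of "conj_set T g U" U] T.card_conj_set[OF g UT] by auto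
    then show ?thesis using g normalizer_T_iff[OF U] by blast
  qed
  have "(\<Sum>g\<in>carrier T. contains U (conj_set T g U)) = (\<Sum>g\<in>carrier T. of_bool (g \<in> normalizer T U))"
    using iff by (intro sum.cong refl) simp
  also have "\<dots> = (\<Sum>g\<in>normalizer T U. 1)"
    by (rule sum.mono_neutral_cong_right) (use finite_T normalizer_T_iff[OF U] in auto)
  finally show ?thesis by (simp add: mark_eq[OF U])
qed

lemma sub_conj: "\<lbrakk>b \<in> carrier S; sub P\<rbrakk> \<Longrightarrow> sub (conj_set S b P)"
  by (rule subgroup_conj_set)

lemma card_mor_conj:
  assumes "b \<in> carrier S" "sub P"
  shows "card (mor (conj_set S b P)) = card (mor P)"
proof -
  have "restrict (conj_map S b) P ` P = conj_set S b P" by (simp add: conj_set_def)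
  then show ?thesis using card_mor_iso[OF assms(2) mor_conj[OF assms(2,1)]] by simp
qed

lemma snd_conj_set: 
  assumes "g \<in> carrier T" 
  shows "snd ` conj_set T g U = conj_set S (snd g) (snd ` U)"
proof -
  obtain a b where g: "g = (a, b)" "a \<in> carrier S" "b \<in> carrier S" using assms by auto
  show ?thesis unfolding g(1) conj_set_T[OF g(2,3)] by (simp add: image_image conj_set_def)
qed

text \<open>
  The notation in the proof: \<open>t\<close> is the target on graphs with domain \<open>P\<close>, \<open>c\<close> the present value at the
  good graph, \<open>k V\<close> the order of the normalizer of \<open>V\<close> in \<open>T\<close>, and \<open>E\<close> the set of graphs on \<open>P\<close>, on which
  \<open>L = S \<times> N(P)\<close> acts by conjugation.  Write \<open>|P|(f V - c) = k V * d V\<close> with integral \<open>d\<close>.  Summed over \<open>E\<close>,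
  where \<open>f\<close> has total value \<open>|S|\<close> and the right-hand side has \<open>|L|\<close> times the sum \<open>z\<close> of \<open>d\<close> over orbit
  representatives, this gives \<open>|P|(t - c) = t |N(P)| z\<close>.  If \<open>P \<noteq> S\<close>, then \<open>p\<close> divides \<open>|N(P)|/|P|\<close>, so \<open>t\<close> is a
  unit multiple of \<open>c\<close> and therefore divisible by \<open>|C(\<phi>0(P))|\<close>.  Consequently \<open>|P|(t - c)\<close> is divisible by
  \<open>|C(\<phi>0(P))| |N(P)|\<close>, hence by \<open>k V\<close>, and \<open>e V = |P|(t - f V) / k V\<close> is integral.  Adding \<open>e V\<close> times \<open>T/V\<close> for
  one \<open>V\<close> of each orbit changes every value on \<open>E\<close> to \<open>t\<close>.  The multipliers used have sum \<open>0\<close>, because \<open>f\<close>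
  and the target have the same total on \<open>E\<close>; this preserves all column sums.\<close>

lemma correction_step:
  assumes f: "realizable f" and P: "sub P"
    and above: "\<And>Q \<psi>. \<lbrakk>sub Q; card P < card Q; \<psi> \<in> mor Q\<rbrakk> \<Longrightarrow> f (twisted_diag Q \<psi>) = target (twisted_diag Q \<psi>)"
    and col: "\<And>Q. sub Q \<Longrightarrow> (\<Sum>\<psi>\<in>mor Q. f (twisted_diag Q \<psi>)) = of_nat (order S)"
  obtains f' where "realizable f'"
    "\<And>Q. sub Q \<Longrightarrow> (\<Sum>\<psi>\<in>mor Q. f' (twisted_diag Q \<psi>)) = of_nat (order S)"
    "\<And>Q \<psi>. \<lbrakk>sub Q; card P \<le> card Q; \<And>b. b \<in> carrier S \<Longrightarrow> Q \<noteq> conj_set S b P; \<psi> \<in> mor Q\<rbrakk> \<Longrightarrow>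
      f' (twisted_diag Q \<psi>) = f (twisted_diag Q \<psi>)"
    "\<And>b \<psi>. \<lbrakk>b \<in> carrier S; \<psi> \<in> mor (conj_set S b P)\<rbrakk> \<Longrightarrow>
      f' (twisted_diag (conj_set S b P) \<psi>) = target (twisted_diag (conj_set S b P) \<psi>)"
proof -
  interpret T: group T by (rule group_T)
  obtain \<phi>0 where \<phi>0: "\<phi>0 \<in> mor P" "fully_centralized S F (\<phi>0 ` P)"
    and norm: "\<And>y. y \<in> normalizer S P \<Longrightarrow> \<exists>z\<in>carrier S. \<forall>u\<in>P. \<phi>0 (conj_map S y u) = conj_map S z (\<phi>0 u)"
    using good_morphism[OF P] by metis
  define N where "N = normalizer S P"
  define C where "C = centralizer S (\<phi>0 ` P)"
  define c where "c = f (twisted_diag P \<phi>0)"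
  define t :: rat where "t = of_nat (order S) / of_nat (card (mor P))"
  define E where "E = {V \<in> graphs. snd ` V = P}"
  define k where "k V = (of_nat (card (normalizer T V)) :: rat)" for V
  define L where "L = S \<times>\<times> S\<lparr>carrier := N\<rparr>"
  define \<rho> where "\<rho> g = (\<lambda>V\<in>E. conj_set T g V)" for g
  have N: "sub N" unfolding N_def by (rule sub_normalizer[OF P])
  have NS: "b \<in> carrier S" "conj_set S b P = P" if "b \<in> N" for b
    using that normalizer_sub[OF P] unfolding N_def by auto
  have LT: "g \<in> carrier T" "snd g \<in> N" if "g \<in> carrier L" for g
    using that NS by (auto simp: L_def)
  have finE: "finite E" using finite_graphs by (simp add: E_def)
  have E_eq: "E = twisted_diag P ` mor P"
    using graphsI[OF P] by (auto simp: E_def elim!: graphsE)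
  have sumE: "(\<Sum>V\<in>E. h V) = (\<Sum>\<phi>\<in>mor P. h (twisted_diag P \<phi>))" for h :: "('a \<times> 'a) set \<Rightarrow> rat"
    unfolding E_eq by (rule sum.reindex[OF twisted_diag_inj[OF P], unfolded o_def])
  have cardE: "card E = card (mor P)"
    unfolding E_eq by (rule card_image[OF twisted_diag_inj[OF P]])
  have Egr: "V \<in> graphs" "V \<subseteq> carrier T" "card V = card P" if "V \<in> E" for V
  proof -
    show V: "V \<in> graphs" using that by (simp add: E_def)
    show "V \<subseteq> carrier T" by (rule subgroup.subset[OF graphs_subgroup[OF V]])
    show "card V = card P" using that by (auto simp: E_eq)
  qed
  have Pfin: "finite P" and Ppos: "card P > 0"
    using finite_sub[OF P] subgroup.one_closed[OF P] by (auto simp: card_gt_0_iff)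
  have \<rho>E: "conj_set T g V \<in> E" if "g \<in> carrier L" "V \<in> E" for g V
    using that graphs_conj[OF LT(1)] snd_conj_set[OF LT(1)] NS(2)[OF LT(2)] by (auto simp: E_def)
  interpret \<rho>: group_action L E \<rho>
  proof (rule group_actionI)
    show "group L" unfolding L_def by (intro DirProd_group is_group subgroup_imp_group[OF N])
    show "\<rho> g \<in> extensional E" for g by (simp add: \<rho>_def)
    fix V assume V: "V \<in> E"
    have one: "\<one>\<^bsub>L\<^esub> = \<one>\<^bsub>T\<^esub>" by (simp add: L_def)
    show "\<rho> \<one>\<^bsub>L\<^esub> V = V" unfolding one using V T.conj_set_one[OF Egr(2)[OF V]] by (simp add: \<rho>_def)
    show "\<rho> g V \<in> E" if "g \<in> carrier L" for g using that V \<rho>E by (simp add: \<rho>_def)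
    show "\<rho> (g \<otimes>\<^bsub>L\<^esub> h) V = \<rho> g (\<rho> h V)" if g: "g \<in> carrier L" and h: "h \<in> carrier L" for g h
    proof -
      have "g \<otimes>\<^bsub>L\<^esub> h = g \<otimes>\<^bsub>T\<^esub> h" by (simp add: L_def mult_DirProd')
      then show ?thesis
        using V \<rho>E[OF h V] T.conj_set_mult[OF LT(1)[OF g] LT(1)[OF h] Egr(2)[OF V]] by (simp add: \<rho>_def)
    qed
  qed
  have finL: "finite (carrier L)" using finite_S finite_sub[OF N] by (simp add: L_def)
  have ordL: "order L = order S * card N" by (simp add: L_def order_def card_cartesian_product)
  have "card N \<noteq> 0" using finite_sub[OF N] subgroup.one_closed[OF N] by (auto simp: card_eq_0_iff)
  then have ordL0: "of_nat (order L) \<noteq> (0 :: rat)" using prime_gt_0_nat[OF prime] by (simp add: ordL order_S)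
  have stab: "stabilizer L \<rho> V = normalizer T V" if V: "V \<in> E" for V
  proof -
    have "g \<in> carrier L" if g: "g \<in> carrier T" "conj_set T g V = V" for g
    proof -
      have "conj_set S (snd g) P = P" using snd_conj_set[OF g(1), of V] g(2) V by (simp add: E_def)
      then show ?thesis using g(1) normalizer_sub[OF P] by (auto simp: L_def N_def)
    qed
    then have "g \<in> stabilizer L \<rho> V \<longleftrightarrow> g \<in> normalizer T V" for g
      unfolding normalizer_T_iff[OF Egr(1)[OF V]] using LT(1)[of g] V by (auto simp: stabilizer_def \<rho>_def)
    then show ?thesis by blast
  qed
  have k_inv: "k (\<rho> g V) = k V" and f_inv: "f (\<rho> g V) = f V" if "g \<in> carrier L" "V \<in> E" for g V
  proof -
    show "k (\<rho> g V) = k V"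
      using \<rho>.card_stabilizer_orbit[OF finL that] stab[OF that(2)] stab[of "\<rho> g V"] \<rho>E[OF that] that(2)
      by (simp add: k_def \<rho>_def)
    show "f (\<rho> g V) = f V"
      using realizable_conj[OF f Egr(2)[OF that(2)] LT(1)[OF that(1)]] that(2) by (simp add: \<rho>_def)
  qed
  have k0: "k V \<noteq> 0" if V: "V \<in> E" for V
  proof -
    have "subgroup (normalizer T V) T" by (rule sub_normalizer_T[OF Egr(1)[OF V]])
    then show ?thesis using finite_subset[OF subgroup.subset finite_T] subgroup.one_closed
      by (fastforce simp: k_def card_eq_0_iff)
  qed
  have orbit_sum: "(\<Sum>V\<in>E. k V * h V) = of_nat (order L) * (\<Sum>\<omega>\<in>orbits L E \<rho>. h (SOME V. V \<in> \<omega>))"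
    if "\<And>g V. g \<in> carrier L \<Longrightarrow> V \<in> E \<Longrightarrow> h (\<rho> g V) = h V" for h
    using \<rho>.sum_over_orbits[OF finL finE, of h] that stab by (simp add: k_def)
  have rep: "(SOME V. V \<in> \<omega>) \<in> \<omega>" "(SOME V. V \<in> \<omega>) \<in> E" if \<omega>: "\<omega> \<in> orbits L E \<rho>" for \<omega>
  proof -
    obtain V where V: "V \<in> E" "\<omega> = orbit L \<rho> V" using \<omega> unfolding orbits_def by blast
    then show "(SOME V. V \<in> \<omega>) \<in> \<omega>" using \<rho>.orbit_refl[OF V(1)] by (metis someI)
    then show "(SOME V. V \<in> \<omega>) \<in> E" using \<rho>.orbit_subset[OF V(1)] V(2) by blast
  qed
  have finO: "finite (orbits L E \<rho>)" unfolding orbits_def Setcompr_eq_image using finE by simp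
  define d where "d V = of_nat (card P) * (f V - c) / k V" for V
  have dZ: "d V \<in> Zp" and dk: "k V * d V = of_nat (card P) * (f V - c)" if V: "V \<in> E" for V
  proof -
    obtain \<phi> where \<phi>: "\<phi> \<in> mor P" "V = twisted_diag P \<phi>" using V unfolding E_eq by blast
    obtain z where "z \<in> Zp" "of_nat (card P) * (f V - c) = k V * z"
      using value_congruence[OF f P above \<phi>0 norm \<phi>(1)] unfolding c_def k_def \<phi>(2) by blast
    then show "d V \<in> Zp" using k0[OF V] by (simp add: d_def)
    show "k V * d V = of_nat (card P) * (f V - c)" using k0[OF V] by (simp add: d_def)
  qed
  define z where "z = (\<Sum>\<omega>\<in>orbits L E \<rho>. d (SOME V. V \<in> \<omega>))"
  have zZ: "z \<in> Zp" unfolding z_def using dZ rep(2) by (intro Z_loc_sum prime) blast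
  have "(\<Sum>V\<in>E. k V * d V) = of_nat (order L) * z"
    unfolding z_def by (rule orbit_sum) (simp add: d_def k_inv f_inv)
  moreover have "(\<Sum>V\<in>E. k V * d V) = of_nat (card P) * (of_nat (order S) - of_nat (card (mor P)) * c)"
    using col[OF P] by (simp add: dk sum_distrib_left[symmetric] sum_subtractf cardE sumE[of f])
  ultimately have balance: "of_nat (card P) * (of_nat (order S) - of_nat (card (mor P)) * c) =
      of_nat (order S) * of_nat (card N) * z" by (simp add: ordL)
  have m0: "of_nat (card (mor P)) \<noteq> (0 :: rat)" using card_mor_pos[OF P] by simp
  have balance_t: "of_nat (card P) * (t - c) = t * of_nat (card N) * z"
    using balance m0 by (simp add: t_def field_simps)
  obtain c' where c': "c' \<in> Zp" "c = of_nat (card C) * c'"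
    using centralizer_divides_value[OF f P \<phi>0(1)] unfolding c_def C_def by blast
  have "\<exists>s\<in>Zp. t = of_nat (card C) * s"
  proof (cases "P = carrier S")
    case True
    then show ?thesis using centralizer_divides_target_carrier \<phi>0(1) unfolding t_def C_def by blast
  next
    case False
    obtain j where j: "card N = p * j * card P"
      unfolding N_def by (rule normalizer_index_dvd[OF prime order_S P False])
    have "of_nat (card P) * (t - c) = of_nat (card P) * (t * (of_nat p * (of_nat j * z)))"
      unfolding balance_t by (simp add: j mult_ac)
    then have "t - c = t * (of_nat p * (of_nat j * z))" using Ppos by simp
    then have "t * (1 - of_nat p * (of_nat j * z)) = c" by (simp add: right_diff_distrib)
    moreover have "of_nat j * z \<in> Zp" using zZ prime by simp
    ultimately have "t = c * (1 / (1 - of_nat p * (of_nat j * z)))"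
      using Z_loc_inverse(1)[OF prime, of "of_nat j * z"] by (simp add: field_simps)
    then show ?thesis
      using c'(2) Z_loc_mult[OF prime c'(1) Z_loc_inverse(2)[OF prime \<open>of_nat j * z \<in> Zp\<close>]]
      by (intro bexI[of _ "c' * (1 / (1 - of_nat p * (of_nat j * z)))"]) (simp_all only: mult.assoc)
  qed
  then obtain s where s: "s \<in> Zp" "t = of_nat (card C) * s" by blast
  define e where "e V = of_nat (card P) * (t - f V) / k V" for V
  have eZ: "e V \<in> Zp" if V: "V \<in> E" for V
  proof -
    obtain \<phi> where \<phi>: "\<phi> \<in> mor P" "V = twisted_diag P \<phi>" using V unfolding E_eq by blast
    obtain i where "card C * card N = card (normalizer T V) * i"
      using card_normalizer_dvd[OF P \<phi>0 \<phi>(1)] unfolding C_def N_def \<phi>(2) by (rule dvdE)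
    then have i: "of_nat (card C) * of_nat (card N) = k V * of_nat i"
      unfolding k_def by (simp flip: of_nat_mult)
    have "of_nat (card P) * (t - f V) = of_nat (card P) * (t - c) - of_nat (card P) * (f V - c)"
      by (simp add: algebra_simps)
    also have "\<dots> = t * of_nat (card N) * z - k V * d V" by (simp only: balance_t dk[OF V])
    also have "\<dots> = (of_nat (card C) * of_nat (card N)) * (s * z) - k V * d V"
      by (simp add: s(2) mult_ac)
    also have "\<dots> = k V * (of_nat i * (s * z) - d V)" by (simp add: i algebra_simps)
    finally have "e V = of_nat i * (s * z) - d V" using k0[OF V] by (simp add: e_def)
    then show ?thesis using s(1) zZ dZ[OF V] prime by simp
  qed
  have e_inv: "e (\<rho> g V) = e V" if "g \<in> carrier L" "V \<in> E" for g V
    using that by (simp add: e_def k_inv f_inv)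
  have e_sum: "(\<Sum>\<omega>\<in>orbits L E \<rho>. e (SOME V. V \<in> \<omega>)) = 0"
  proof -
    have "of_nat (order L) * (\<Sum>\<omega>\<in>orbits L E \<rho>. e (SOME V. V \<in> \<omega>)) = (\<Sum>V\<in>E. k V * e V)"
      using orbit_sum[of e] e_inv by simp
    also have "\<dots> = (\<Sum>V\<in>E. of_nat (card P) * (t - f V))"
      using k0 by (intro sum.cong refl) (simp add: e_def)
    also have "\<dots> = of_nat (card P) * (of_nat (card (mor P)) * t - of_nat (order S))"
      using col[OF P] by (simp add: sum_distrib_left[symmetric] sum_subtractf cardE sumE[of f])
    also have "\<dots> = 0" using m0 by (simp add: t_def)
    finally show ?thesis using ordL0 by simp
  qed
  define g where "g D = (\<Sum>\<omega>\<in>orbits L E \<rho>. e (SOME V. V \<in> \<omega>) * mark (SOME V. V \<in> \<omega>) D)" for D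
  define f' where "f' D = f D + g D" for D
  have "realizable g"
    unfolding g_def using rep(2) eZ Egr(1) by (intro realizable_sum[OF finO] realizable_mark) auto
  then have f': "realizable f'" unfolding f'_def using f by (intro realizable_add) 
  have g_col: "(\<Sum>\<psi>\<in>mor Q. g (twisted_diag Q \<psi>)) = 0" if Q: "sub Q" for Q
  proof -
    have "(\<Sum>\<psi>\<in>mor Q. g (twisted_diag Q \<psi>)) = (\<Sum>\<omega>\<in>orbits L E \<rho>. e (SOME V. V \<in> \<omega>) *
        (\<Sum>\<psi>\<in>mor Q. mark (SOME V. V \<in> \<omega>) (twisted_diag Q \<psi>)))"
      unfolding g_def by (subst sum.swap) (simp add: sum_distrib_left)
    also have "\<dots> = (\<Sum>\<omega>\<in>orbits L E \<rho>. e (SOME V. V \<in> \<omega>) * column Q P)"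
    proof (rule sum.cong[OF refl])
      fix \<omega> assume "\<omega> \<in> orbits L E \<rho>"
      then obtain \<phi> where "\<phi> \<in> mor P" "(SOME V. V \<in> \<omega>) = twisted_diag P \<phi>" using rep(2) unfolding E_eq by blast
      then show "e (SOME V. V \<in> \<omega>) * (\<Sum>\<psi>\<in>mor Q. mark (SOME V. V \<in> \<omega>) (twisted_diag Q \<psi>)) =
          e (SOME V. V \<in> \<omega>) * column Q P"
        using column_sum_mark[OF P _ Q] by metis
    qed
    also have "\<dots> = 0" using e_sum by (simp add: sum_distrib_right[symmetric])
    finally show ?thesis .
  qed
  have mark_conjugate: "\<exists>h\<in>carrier T. D = conj_set T h U"
    if U: "U \<in> E" and D: "D \<in> graphs" "card P \<le> card D" and nz: "mark U D \<noteq> 0" for U D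
  proof -
    have "\<exists>h\<in>carrier T. D \<subseteq> conj_set T h U"
    proof (rule ccontr)
      assume "\<not> ?thesis"
      then have "(\<Sum>h\<in>carrier T. contains D (conj_set T h U)) = 0" by (intro sum.neutral) simp
      then show False using nz unfolding mark_eq[OF Egr(1)[OF U]] by simp
    qed
    then obtain h where h: "h \<in> carrier T" "D \<subseteq> conj_set T h U" by blast
    have "finite (conj_set T h U)" using T.conj_set_closed[OF h(1) Egr(2)[OF U]] finite_T finite_subset by blast
    then have "D = conj_set T h U"
      using card_seteq[OF _ h(2)] D(2) T.card_conj_set[OF h(1) Egr(2)[OF U]] Egr(3)[OF U] by simp
    then show ?thesis using h(1) by blast
  qed
  \<comment> \<open>Only the representative of the orbit of \<open>V\<close> has a nonzero mark at \<open>V\<close>, namely \<open>k V / |P|\<close>.\<close>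
  have f'_E: "f' V = t" if V: "V \<in> E" for V
  proof -
    have "e (SOME W. W \<in> \<omega>) * mark (SOME W. W \<in> \<omega>) V = (if \<omega> = orbit L \<rho> V then t - f V else 0)"
      if \<omega>: "\<omega> \<in> orbits L E \<rho>" for \<omega>
    proof -
      let ?U = "SOME W. W \<in> \<omega>"
      have U: "?U \<in> E" "?U \<in> \<omega>" using rep[OF \<omega>] by auto
      obtain W where W: "W \<in> E" "\<omega> = orbit L \<rho> W" using \<omega> unfolding orbits_def by blast
      have OU: "\<omega> = orbit L \<rho> ?U" using \<rho>.orbit_eq_iff[OF U(1) W(1)] U(2) W(2) by simp
      show ?thesis
      proof (cases "V \<in> \<omega>")
        case True
        then have OV: "\<omega> = orbit L \<rho> V" using \<rho>.orbit_eq_iff[OF V W(1)] W(2) by simp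
        obtain h where h: "h \<in> carrier L" "V = \<rho> h ?U" using True OU unfolding orbit_def by blast
        then have "mark ?U V = mark ?U ?U"
          using mark_conj[OF Egr(1,2)[OF U(1)] LT(1)[OF h(1)]] U(1) by (simp add: \<rho>_def)
        also have "\<dots> = k V / of_nat (card P)"
          using mark_self[OF Egr(1)[OF U(1)]] Egr(3)[OF U(1)] k_inv[OF h(1) U(1)] h(2) by (simp add: k_def)
        finally have "e ?U * mark ?U V = e V * (k V / of_nat (card P))" using e_inv[OF h(1) U(1)] h(2) by simp
        also have "\<dots> = t - f V" using k0[OF V] Ppos by (simp add: e_def)
        finally show ?thesis using OV by simp
      next
        case False
        have "mark ?U V = 0"
        proof (rule ccontr)
          assume "mark ?U V \<noteq> 0"
          then obtain h where h: "h \<in> carrier T" "V = conj_set T h ?U"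
            using mark_conjugate[OF U(1) Egr(1)[OF V]] Egr(3)[OF V] by auto
          have "conj_set S (snd h) P = P" using snd_conj_set[OF h(1), of ?U] h(2) U(1) V by (simp add: E_def)
          then have "h \<in> carrier L" using h(1) normalizer_sub[OF P] by (auto simp: L_def N_def)
          moreover have "V = \<rho> h ?U" using h(2) U(1) by (simp add: \<rho>_def)
          ultimately have "V \<in> orbit L \<rho> ?U" unfolding orbit_def by blast
          then have "V \<in> \<omega>" by (subst OU)
          then show False using False by contradiction
        qed
        moreover have "\<omega> \<noteq> orbit L \<rho> V" using False \<rho>.orbit_refl[OF V] by blast
        ultimately show ?thesis by simp
      qed
    qed
    then have "g V = (\<Sum>\<omega>\<in>orbits L E \<rho>. if \<omega> = orbit L \<rho> V then t - f V else 0)"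
      unfolding g_def by (intro sum.cong refl) 
    also have "\<dots> = t - f V" using finO V by (auto simp: orbits_def)
    finally show ?thesis by (simp add: f'_def)
  qed
  show ?thesis
  proof (rule that[of f'])
    show "realizable f'" by (rule f')
    show "(\<Sum>\<psi>\<in>mor Q. f' (twisted_diag Q \<psi>)) = of_nat (order S)" if "sub Q" for Q
      using col[OF that] g_col[OF that] by (simp add: f'_def sum.distrib)
    show "f' (twisted_diag Q \<psi>) = f (twisted_diag Q \<psi>)"
      if Q: "sub Q" "card P \<le> card Q" and nc: "\<And>b. b \<in> carrier S \<Longrightarrow> Q \<noteq> conj_set S b P" and \<psi>: "\<psi> \<in> mor Q" for Q \<psi>
    proof -
      have "mark U (twisted_diag Q \<psi>) = 0" if U: "U \<in> E" for U
      proof (rule ccontr)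
        assume "mark U (twisted_diag Q \<psi>) \<noteq> 0"
        then obtain h where h: "h \<in> carrier T" "twisted_diag Q \<psi> = conj_set T h U"
          using mark_conjugate[OF U graphsI[OF Q(1) \<psi>]] Q(2) by auto
        have "Q = conj_set S (snd h) P" using snd_conj_set[OF h(1), of U] h(2)[symmetric] U by (simp add: E_def)
        then show False using nc[of "snd h"] h(1) by auto
      qed
      then have "g (twisted_diag Q \<psi>) = 0" unfolding g_def using rep(2) by (intro sum.neutral) simp
      then show ?thesis by (simp add: f'_def)
    qed
    show "f' (twisted_diag (conj_set S b P) \<psi>) = target (twisted_diag (conj_set S b P) \<psi>)"
      if b: "b \<in> carrier S" and \<psi>: "\<psi> \<in> mor (conj_set S b P)" for b \<psi>
    proof -
      let ?D = "twisted_diag (conj_set S b P) \<psi>" and ?h = "(\<one>, inv b)"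
      have D: "?D \<in> graphs" using graphsI[OF sub_conj[OF b P] \<psi>] .
      have h: "?h \<in> carrier T" using b by simp
      have "snd ` conj_set T ?h ?D = P" using snd_conj_set[OF h, of ?D] b subgroup.subset[OF P] by simp
      then have "conj_set T ?h ?D \<in> E" using graphs_conj[OF h D] by (simp add: E_def)
      then have "f' ?D = t"
        using f'_E realizable_conj[OF f' subgroup.subset[OF graphs_subgroup[OF D]] h] by simp
      then show ?thesis using D card_mor_conj[OF b P] by (simp add: target_def t_def)
    qed
  qed
qed

text \<open>The initial element \<open>T/\<Delta>(S)\<close> has the column sums that the target has.\<close>

lemma column_sum_diagonal:
  assumes Q: "sub Q"
  shows "(\<Sum>\<psi>\<in>mor Q. mark (twisted_diag (carrier S) (restrict id (carrier S))) (twisted_diag Q \<psi>)) =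
    of_nat (order S)"
proof -
  have "conj_set S b (carrier S) = carrier S" if "b \<in> carrier S" for b
    using normalizer_contains[OF sub_carrier that] normalizer_sub[OF sub_carrier] by blast
  then have "column Q (carrier S) = of_nat (order S)"
    using subgroup.subset[OF Q] finite_S one_closed by (auto simp: column_def order_def card_eq_0_iff)
  then show ?thesis using column_sum_mark[OF sub_carrier mor_id[OF sub_carrier] Q] by simp
qed

text \<open>The induction enlarges an upward closed set \<open>\<H>\<close> of domains at which all values are right by the
  conjugacy class of a largest missing subgroup.\<close>

lemma realizable_target:
  obtains q where "\<And>U. q U \<in> Zp"
    "\<And>D. subgroup D T \<Longrightarrow> (\<Sum>U\<in>graphs. q U * mark U D) = target D"
proof -
  let ?subs = "{P. sub P}"
  have fin: "finite ?subs"
    by (rule finite_subset[of _ "Pow (carrier S)"]) (use subgroup.subset finite_S in auto)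
  have main: "\<exists>f'. realizable f' \<and> (\<forall>Q \<psi>. sub Q \<longrightarrow> \<psi> \<in> mor Q \<longrightarrow> f' (twisted_diag Q \<psi>) = target (twisted_diag Q \<psi>))"
    if "realizable f" "\<And>Q. sub Q \<Longrightarrow> (\<Sum>\<psi>\<in>mor Q. f (twisted_diag Q \<psi>)) = of_nat (order S)"
      "\<H> \<subseteq> ?subs" "\<And>Q \<psi>. Q \<in> \<H> \<Longrightarrow> \<psi> \<in> mor Q \<Longrightarrow> f (twisted_diag Q \<psi>) = target (twisted_diag Q \<psi>)"
      "\<And>Q R. Q \<in> \<H> \<Longrightarrow> sub R \<Longrightarrow> card Q < card R \<Longrightarrow> R \<in> \<H>"
    for f \<H>
    using that
  proof (induction "card (?subs - \<H>)" arbitrary: f \<H> rule: less_induct)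
    case less
    show ?case
    proof (cases "?subs \<subseteq> \<H>")
      case True
      then show ?thesis using less.prems(1,4) by blast
    next
      case False
      then obtain P1 where P1: "sub P1 \<and> P1 \<notin> \<H>" by blast
      have "\<forall>Q. sub Q \<and> Q \<notin> \<H> \<longrightarrow> card Q < Suc (card (carrier S))"
        by (auto simp: less_Suc_eq_le intro!: card_mono[OF finite_S] subgroup.subset)
      from ex_has_greatest_nat[of "\<lambda>Q. sub Q \<and> Q \<notin> \<H>", OF P1 this]
      obtain P where P: "sub P" "P \<notin> \<H>" and max: "\<And>Q. sub Q \<Longrightarrow> Q \<notin> \<H> \<Longrightarrow> card Q \<le> card P" by blast
      have bigger: "Q \<in> \<H>" if "sub Q" "card P < card Q" for Q using max[OF that(1)] that(2) by fastforce
      have \<H>_card: "card P \<le> card Q" if "Q \<in> \<H>" for Q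
        using less.prems(5)[OF that P(1)] P(2) by fastforce
      show ?thesis
      proof (rule correction_step[OF less.prems(1) P(1) less.prems(4)[OF bigger] less.prems(2)])
        fix f' assume f': "realizable f'"
        "\<And>Q. sub Q \<Longrightarrow> (\<Sum>\<psi>\<in>mor Q. f' (twisted_diag Q \<psi>)) = of_nat (order S)"
        "\<And>Q \<psi>. \<lbrakk>sub Q; card P \<le> card Q; \<And>b. b \<in> carrier S \<Longrightarrow> Q \<noteq> conj_set S b P; \<psi> \<in> mor Q\<rbrakk> \<Longrightarrow>
          f' (twisted_diag Q \<psi>) = f (twisted_diag Q \<psi>)"
        "\<And>b \<psi>. \<lbrakk>b \<in> carrier S; \<psi> \<in> mor (conj_set S b P)\<rbrakk> \<Longrightarrow>
          f' (twisted_diag (conj_set S b P) \<psi>) = target (twisted_diag (conj_set S b P) \<psi>)"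
      let ?\<H>' = "\<H> \<union> (\<lambda>b. conj_set S b P) ` carrier S"
      have P': "P \<in> ?\<H>'"
        using conj_set_one[OF subgroup.subset[OF P(1)]] one_closed by (metis UnI2 imageI)
      show ?thesis
      proof (rule less.hyps[of ?\<H>' f'])
        show "card (?subs - ?\<H>') < card (?subs - \<H>)"
          by (rule psubset_card_mono) (use fin P P' in auto)
        show "realizable f'" by (rule f'(1))
        show "(\<Sum>\<psi>\<in>mor Q. f' (twisted_diag Q \<psi>)) = of_nat (order S)" if "sub Q" for Q by (rule f'(2)[OF that])
        show "?\<H>' \<subseteq> ?subs" using less.prems(3) sub_conj[OF _ P(1)] by blast
        show "f' (twisted_diag Q \<psi>) = target (twisted_diag Q \<psi>)" if Q: "Q \<in> ?\<H>'" and \<psi>: "\<psi> \<in> mor Q" for Q \<psi>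
        proof (cases "\<exists>b\<in>carrier S. Q = conj_set S b P")
          case True
          then show ?thesis using f'(4) \<psi> by blast
        next
          case False
          then have QH: "Q \<in> \<H>" using Q by blast
          then have "sub Q" using less.prems(3) by blast
          then show ?thesis using f'(3)[OF _ \<H>_card[OF QH] _ \<psi>] False less.prems(4)[OF QH \<psi>] by auto
        qed
        show "R \<in> ?\<H>'" if Q: "Q \<in> ?\<H>'" and R: "sub R" "card Q < card R" for Q R
        proof (cases "Q \<in> \<H>")
          case True
          then show ?thesis using less.prems(5) R by blast
        next
          case False
          then obtain b where "b \<in> carrier S" "Q = conj_set S b P" using Q by blast
          then have "card Q = card P" using card_conj_set subgroup.subset[OF P(1)] by simp
          then show ?thesis using bigger R by simp
        qed
      qed
      qed
    qed
  qed
  let ?\<Delta> = "twisted_diag (carrier S) (restrict id (carrier S))"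
  have \<Delta>: "?\<Delta> \<in> graphs" by (rule graphsI[OF sub_carrier mor_id[OF sub_carrier]])
  have "realizable (mark ?\<Delta>)" using realizable_mark[OF \<Delta> Z_loc_1[OF prime]] by simp
  moreover have "(\<Sum>\<psi>\<in>mor Q. mark ?\<Delta> (twisted_diag Q \<psi>)) = of_nat (order S)" if Q: "sub Q" for Q
    by (rule column_sum_diagonal[OF Q])
  ultimately obtain f where f: "realizable f"
    and right: "\<And>Q \<psi>. sub Q \<Longrightarrow> \<psi> \<in> mor Q \<Longrightarrow> f (twisted_diag Q \<psi>) = target (twisted_diag Q \<psi>)"
    using main[of "mark ?\<Delta>" "{}"] by auto
  obtain q where q: "\<And>U. q U \<in> Zp" "f = (\<lambda>D. \<Sum>U\<in>graphs. q U * mark U D)"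
    using f unfolding realizable_def by blast
  show ?thesis
  proof (rule that[of q])
    show "q U \<in> Zp" for U by (rule q(1))
    show "(\<Sum>U\<in>graphs. q U * mark U D) = target D" if D: "subgroup D T" for D
    proof (cases "D \<in> graphs")
      case True
      then show ?thesis using right q(2) by (auto elim!: graphsE)
    next
      case False
      then have "\<not> D \<subseteq> W" if "W \<in> graphs" for W using graphs_downward[OF that D] by blast
      then show ?thesis using realizable_zero[OF f, of D] False q(2) by (simp add: target_def)
    qed
  qed
qed


section \<open>The stabilization\<close>

abbreviation "product_F \<equiv> product_fusion S F S (trivial_fusion S)"

lemma sub_fst: "subgroup D T \<Longrightarrow> sub (fst ` D)"
proof -
  assume D: "subgroup D T"
  have "fst \<in> hom T S" by (auto simp: hom_def mult_DirProd')
  then interpret h: group_hom T S fst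
    by (simp add: group_hom_def group_hom_axioms_def group_T)
  show ?thesis by (rule h.subgroup_img_is_subgroup[OF D])
qed

text \<open>Subgroups are also transported to subgroups.  As in \<open>graphs_push\<close>, the maps \<open>\<alpha>\<close> and \<open>\<beta>\<close> need only
  restrict to morphisms, so that conjugation maps and identities may be used directly.\<close>

lemma subgroup_push:
  assumes D: "subgroup D T" and sub: "D \<subseteq> A \<times> B"
    and A: "sub A" "restrict \<alpha> A \<in> mor A" and B: "sub B" "restrict \<beta> B \<in> mor B"
  shows "subgroup (map_prod \<alpha> \<beta> ` D) T"
proof -
  interpret T: group T by (rule group_T)
  have \<alpha>: "\<alpha> (u \<otimes> v) = \<alpha> u \<otimes> \<alpha> v" "\<alpha> u \<in> carrier S" if "u \<in> A" "v \<in> A" for u v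
    using mor_hom[OF A that] mor_closed[OF A that(1)] that subgroup.m_closed[OF A(1)] by simp_all
  have \<beta>: "\<beta> (u \<otimes> v) = \<beta> u \<otimes> \<beta> v" "\<beta> u \<in> carrier S" if "u \<in> B" "v \<in> B" for u v
    using mor_hom[OF B that] mor_closed[OF B that(1)] that subgroup.m_closed[OF B(1)] by simp_all
  have "map_prod \<alpha> \<beta> (g \<otimes>\<^bsub>T\<^esub> h) = map_prod \<alpha> \<beta> g \<otimes>\<^bsub>T\<^esub> map_prod \<alpha> \<beta> h" if "g \<in> D" "h \<in> D" for g h
    using subsetD[OF sub that(1)] subsetD[OF sub that(2)] \<alpha>(1) \<beta>(1) by (cases g, cases h) simp
  moreover have "map_prod \<alpha> \<beta> g \<in> carrier T" if "g \<in> D" for g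
    using subsetD[OF sub that] by (cases g) (auto intro: \<alpha>(2) \<beta>(2))
  ultimately interpret h: group_hom "T\<lparr>carrier := D\<rparr>" T "map_prod \<alpha> \<beta>"
    by (auto simp: group_hom_def group_hom_axioms_def hom_def T.subgroup_imp_group[OF D] T.is_group)
  show ?thesis using h.img_is_subgroup by simp
qed

lemma trivial_fusionI:
  "\<lbrakk>s \<in> carrier S; P \<subseteq> carrier S\<rbrakk> \<Longrightarrow> restrict (conj_map S s) P \<in> trivial_fusion S P (carrier S)"
  unfolding trivial_fusion_def by (intro CollectI exI[of _ s]) auto

text \<open>The conjugates of \<open>D\<close> under \<open>F \<times> F\<^sub>S\<close> are its images, since mutually inverse morphisms between
  \<open>D\<close> and \<open>D'\<close> are onto.\<close>

lemma fconj_class_product: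
  assumes D: "subgroup D T"
  shows "fconj_class T product_F D =
    {map_prod \<alpha> (conj_map S s) ` D | \<alpha> s. \<alpha> \<in> mor (fst ` D) \<and> s \<in> carrier S}" (is "?L = ?R")
proof (intro subset_antisym subsetI)
  have D1: "sub (fst ` D)" and D2: "sub (snd ` D)" using sub_fst sub_snd D by auto
  have DD: "D \<subseteq> fst ` D \<times> snd ` D" by force
  {
    fix D' assume "D' \<in> ?L"
    then obtain \<phi> \<psi> where \<phi>: "\<phi> \<in> product_F D D'" and \<psi>: "\<psi> \<in> product_F D' D"
      and inv: "\<forall>y\<in>D'. \<phi> (\<psi> y) = y" unfolding fconj_class_def by blast
    obtain \<alpha> \<gamma> where \<alpha>: "\<alpha> \<in> F (fst ` D) (carrier S)" and \<gamma>: "\<gamma> \<in> trivial_fusion S (snd ` D) (carrier S)"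
      and \<phi>_eq: "\<phi> = restrict (map_prod \<alpha> \<gamma>) D" and im: "map_prod \<alpha> \<gamma> ` D \<subseteq> D'"
      using \<phi> unfolding product_fusion_def by blast
    obtain s where s: "s \<in> carrier S" "\<gamma> = restrict (conj_map S s) (snd ` D)"
      using \<gamma> unfolding trivial_fusion_def by blast
    have "\<psi> y \<in> D" if "y \<in> D'" for y
      using \<psi> that unfolding product_fusion_def by auto
    then have "D' \<subseteq> \<phi> ` D" using inv by (metis imageI subsetI)
    moreover have "\<phi> ` D = map_prod \<alpha> \<gamma> ` D" by (simp add: \<phi>_eq)
    moreover have "map_prod \<alpha> \<gamma> ` D = map_prod \<alpha> (conj_map S s) ` D"
    proof (rule image_cong[OF refl])
      fix z assume z: "z \<in> D"
      show "map_prod \<alpha> \<gamma> z = map_prod \<alpha> (conj_map S s) z"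
        using imageI[OF z, of snd] unfolding s(2) by (cases z) simp
    qed
    ultimately have "D' = map_prod \<alpha> (conj_map S s) ` D" using im by (metis subset_antisym)
    then show "D' \<in> ?R" using \<alpha> s(1) unfolding mor_def by blast
  }
  {
    fix D' assume "D' \<in> ?R"
    then obtain \<alpha> s where \<alpha>: "\<alpha> \<in> mor (fst ` D)" and s: "s \<in> carrier S"
      and D': "D' = map_prod \<alpha> (conj_map S s) ` D" by blast
    let ?c = "restrict (conj_map S s) (snd ` D)" and ?a' = "restrict (inv_into (fst ` D) \<alpha>) (\<alpha> ` fst ` D)"
    have f': "fst ` D' = \<alpha> ` fst ` D" by (auto simp: D' image_image)
    let ?c' = "restrict (conj_map S (inv s)) (snd ` D')"
    have eq: "map_prod \<alpha> ?c z = map_prod \<alpha> (conj_map S s) z" if "z \<in> D" for z using that by (cases z) force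
    have retract: "map_prod ?a' ?c' (map_prod \<alpha> (conj_map S s) z) = z" if z: "z \<in> D" for z
    proof -
      have z1: "fst z \<in> fst ` D" and z2: "snd z \<in> snd ` D" using z by auto
      have "map_prod \<alpha> (conj_map S s) z \<in> D'" using z by (simp add: D')
      then have "conj_map S s (snd z) \<in> snd ` D'" by (metis snd_map_prod imageI)
      then show ?thesis
        using z1 z2 s inv_into_f_f[OF mor_inj[OF D1 \<alpha>] z1] sub_closed[OF D2 z2] by (cases z) auto
    qed
    have into: "map_prod \<alpha> (conj_map S s) z \<in> D'" if "z \<in> D" for z
      unfolding D' using that by (rule imageI)
    have "restrict (map_prod \<alpha> ?c) D \<in> product_F D D'"
    proof -
      have "map_prod \<alpha> ?c ` D = D'" unfolding D' by (rule image_cong[OF refl eq])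
      moreover have "?c \<in> trivial_fusion S (snd ` D) (carrier S)"
        by (rule trivial_fusionI[OF s subgroup.subset[OF D2]])
      ultimately show ?thesis using \<alpha> unfolding product_fusion_def mor_def by (metis (mono_tags, lifting) mem_Collect_eq subset_refl)
    qed
    moreover have "restrict (map_prod ?a' ?c') D' \<in> product_F D' D"
    proof -
      have "map_prod ?a' ?c' ` D' \<subseteq> D" using retract unfolding D' image_image by (simp add: image_subset_iff)
      moreover have "conj_map S s (snd z) \<in> carrier S" if "z \<in> D" for z
        using s sub_closed[OF D2 imageI[OF that]] by simp
      then have "snd ` D' \<subseteq> carrier S" unfolding D' image_image by (simp add: image_subset_iff)
      then have "?c' \<in> trivial_fusion S (snd ` D') (carrier S)"
        using s by (intro trivial_fusionI) simp_all
      moreover have "?a' \<in> F (fst ` D') (carrier S)" using mor_inverse[OF D1 \<alpha>] by (simp add: mor_def f')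
      ultimately show ?thesis unfolding product_fusion_def by blast
    qed
    moreover have inv1: "restrict (map_prod ?a' ?c') D' (restrict (map_prod \<alpha> ?c) D z) = z" if z: "z \<in> D" for z
      unfolding restrict_apply'[OF z] eq[OF z] restrict_apply'[OF into[OF z]] by (rule retract[OF z])
    moreover have "restrict (map_prod \<alpha> ?c) D (restrict (map_prod ?a' ?c') D' y) = y" if "y \<in> D'" for y
    proof -
      from \<open>y \<in> D'\<close> obtain z where z: "y = map_prod \<alpha> (conj_map S s) z" "z \<in> D"
        unfolding D' by (rule imageE)
      have "restrict (map_prod ?a' ?c') D' y = z"
        unfolding z(1) restrict_apply'[OF into[OF z(2)]] by (rule retract[OF z(2)])
      then show ?thesis using eq[OF z(2)] z by simp
    qed
    moreover have "subgroup D' T"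
      unfolding D' using mor_restrict_self[OF D1 \<alpha>] \<alpha> mor_conj[OF D2 s]
      by (intro subgroup_push[OF D DD D1 _ D2]) simp_all
    ultimately show "D' \<in> ?L" unfolding fconj_class_def by blast
  }
qed

text \<open>Any \<open>\<chi>\<close> on a conjugate of \<open>Q\<close> is reached, with \<open>\<chi> \<circ> c\<^sub>s \<circ> \<psi>\<^sup>-\<^sup>1\<close> as the morphism in the first
  coordinate.\<close>

lemma fconj_class_graph:
  assumes Q: "sub Q" and \<psi>: "\<psi> \<in> mor Q"
  shows "fconj_class T product_F (twisted_diag Q \<psi>) =
    (\<Union>R\<in>(\<lambda>s. conj_set S s Q) ` carrier S. twisted_diag R ` mor R)" (is "?L = ?R")
proof (intro subset_antisym subsetI)
  let ?D = "twisted_diag Q \<psi>"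
  have D: "subgroup ?D T" by (rule subgroup_twisted_diag[OF Q \<psi>])
  have DD: "?D \<subseteq> \<psi> ` Q \<times> Q" by (auto simp: twisted_diag_def)
  {
    fix V assume "V \<in> ?L"
    then obtain \<alpha> s where \<alpha>: "\<alpha> \<in> mor (\<psi> ` Q)" and s: "s \<in> carrier S" and V: "V = map_prod \<alpha> (conj_map S s) ` ?D"
      unfolding fconj_class_product[OF D] by auto
    have "V \<in> graphs"
      unfolding V using \<alpha> mor_restrict_self[OF mor_image[OF Q \<psi>] \<alpha>] mor_conj[OF Q s]
      by (intro graphs_push(1)[OF graphsI[OF Q \<psi>] DD mor_image[OF Q \<psi>] _ Q]) simp_all
    then obtain R \<chi> where R: "sub R" "\<chi> \<in> mor R" "V = twisted_diag R \<chi>" by (rule graphsE)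
    have "R = snd ` V" by (simp add: R(3))
    also have "\<dots> = conj_set S s Q"
      unfolding V by (simp add: twisted_diag_eq_image image_image conj_set_def)
    finally show "V \<in> ?R" using R s by blast
  }
  {
    fix V assume "V \<in> ?R"
    then obtain s \<chi> where s: "s \<in> carrier S" and \<chi>: "\<chi> \<in> mor (conj_set S s Q)"
      and V: "V = twisted_diag (conj_set S s Q) \<chi>" by blast
    let ?c = "restrict (conj_map S s) Q" and ?i = "restrict (inv_into Q \<psi>) (\<psi> ` Q)"
    have c: "?c \<in> mor Q" "?c ` Q = conj_set S s Q" using mor_conj[OF Q s] by (simp_all add: conj_set_def)
    have 1: "compose Q \<chi> ?c \<in> mor Q"
      using mor_comp[OF Q sub_conj[OF s Q] c(1) _ \<chi>] c(2) by simp
    have \<alpha>: "compose (\<psi> ` Q) (compose Q \<chi> ?c) ?i \<in> mor (\<psi> ` Q)" (is "?\<alpha> \<in> _")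
      by (rule mor_comp[OF mor_image[OF Q \<psi>] Q mor_inverse[OF Q \<psi>] _ 1]) (simp only: inv_image[OF Q \<psi>] subset_refl)
    have "?\<alpha> (\<psi> u) = \<chi> (conj_map S s u)" if "u \<in> Q" for u
      using that inv_into_f_f[OF mor_inj[OF Q \<psi>] that] by (simp add: compose_eq)
    then have "map_prod ?\<alpha> (conj_map S s) ` ?D = V"
      by (simp add: V twisted_diag_eq_image image_image conj_set_def cong: image_cong)
    moreover have "?\<alpha> \<in> mor (fst ` ?D)" using \<alpha> by simp
    ultimately show "V \<in> ?L" unfolding fconj_class_product[OF D] using s by blast
  }
qed

lemma twisted_diag_disjoint:
  assumes "R \<noteq> R'"
  shows "twisted_diag R ` mor R \<inter> twisted_diag R' ` mor R' = {}"
proof (rule equals0I)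
  fix V assume "V \<in> twisted_diag R ` mor R \<inter> twisted_diag R' ` mor R'"
  then have "snd ` V = R" "snd ` V = R'" by auto
  then show False using assms by simp
qed

text \<open>On the class of a graph the marks of \<open>T/\<Delta>(S)\<close> are summed domain by domain.  The class of any
  other subgroup contains no graph, and its marks vanish.\<close>

lemma average_diagonal:
  assumes D: "subgroup D T"
  shows "1 / of_nat (card (fconj_class T product_F D)) * (\<Sum>D'\<in>fconj_class T product_F D.
    mark (twisted_diag (carrier S) (restrict id (carrier S))) D') = target D"
proof (cases "D \<in> graphs")
  case False
  have D1: "sub (fst ` D)" and D2: "sub (snd ` D)" using sub_fst sub_snd D by auto
  have DD: "D \<subseteq> fst ` D \<times> snd ` D" by force
  have "mark (twisted_diag (carrier S) (restrict id (carrier S))) D' = 0"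
    if "D' \<in> fconj_class T product_F D" for D'
  proof (rule mark_zero[OF graphsI[OF sub_carrier mor_id[OF sub_carrier]]])
    fix W assume W: "W \<in> graphs"
    obtain \<alpha> s where \<alpha>: "\<alpha> \<in> mor (fst ` D)" and s: "s \<in> carrier S" and D': "D' = map_prod \<alpha> (conj_map S s) ` D"
      using \<open>D' \<in> fconj_class T product_F D\<close> unfolding fconj_class_product[OF D] by blast
    have r: "restrict \<alpha> (fst ` D) \<in> mor (fst ` D)" using \<alpha> mor_restrict_self[OF D1 \<alpha>] by simp
    have "subgroup D' T" unfolding D' by (rule subgroup_push[OF D DD D1 r D2 mor_conj[OF D2 s]])
    moreover have "D' \<notin> graphs" using False graphs_pull[OF _ DD D1 r D2 mor_conj[OF D2 s]] unfolding D' by blast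
    ultimately show "\<not> D' \<subseteq> W" using graphs_downward[OF W] by blast
  qed
  then show ?thesis using False by (simp add: target_def)
next
  case True
  then obtain Q \<psi> where Q: "sub Q" and \<psi>: "\<psi> \<in> mor Q" and D_eq: "D = twisted_diag Q \<psi>" by (rule graphsE)
  let ?\<Q> = "(\<lambda>s. conj_set S s Q) ` carrier S" and ?\<Delta> = "twisted_diag (carrier S) (restrict id (carrier S))"
  have sub\<Q>: "sub R" "card (mor R) = card (mor Q)" if "R \<in> ?\<Q>" for R
    using that sub_conj[OF _ Q] card_mor_conj[OF _ Q] by auto
  have fin\<Q>: "finite ?\<Q>" using finite_S by simp
  have fin: "finite (twisted_diag R ` mor R)" if "R \<in> ?\<Q>" for R using finite_mor[OF sub\<Q>(1)[OF that]] by simp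
  have cl: "fconj_class T product_F D = (\<Union>R\<in>?\<Q>. twisted_diag R ` mor R)"
    unfolding D_eq by (rule fconj_class_graph[OF Q \<psi>])
  have "card (fconj_class T product_F D) = (\<Sum>R\<in>?\<Q>. card (twisted_diag R ` mor R))"
    unfolding cl using fin\<Q> fin twisted_diag_disjoint by (intro card_UN_disjoint) auto
  also have "\<dots> = (\<Sum>R\<in>?\<Q>. card (mor Q))"
    using sub\<Q> card_image[OF twisted_diag_inj] by (intro sum.cong refl) metis
  finally have card: "card (fconj_class T product_F D) = card ?\<Q> * card (mor Q)" by simp
  have "(\<Sum>D'\<in>fconj_class T product_F D. mark ?\<Delta> D') = (\<Sum>R\<in>?\<Q>. \<Sum>V\<in>twisted_diag R ` mor R. mark ?\<Delta> V)"
    unfolding cl using fin\<Q> fin twisted_diag_disjoint by (intro sum.UNION_disjoint) auto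
  also have "\<dots> = (\<Sum>R\<in>?\<Q>. of_nat (order S))"
  proof (rule sum.cong[OF refl])
    fix R assume "R \<in> ?\<Q>"
    then have R: "sub R" by (rule sub\<Q>(1))
    have "(\<Sum>V\<in>twisted_diag R ` mor R. mark ?\<Delta> V) = (\<Sum>\<chi>\<in>mor R. mark ?\<Delta> (twisted_diag R \<chi>))"
      by (rule sum.reindex[OF twisted_diag_inj[OF R], unfolded o_def])
    then show "(\<Sum>V\<in>twisted_diag R ` mor R. mark ?\<Delta> V) = of_nat (order S)"
      using column_sum_diagonal[OF R] by simp
  qed
  finally have sum: "(\<Sum>D'\<in>fconj_class T product_F D. mark ?\<Delta> D') = of_nat (card ?\<Q>) * of_nat (order S)" by simp
  have "card ?\<Q> \<noteq> 0" using fin\<Q> one_closed by (auto simp: card_eq_0_iff)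
  then show ?thesis using True by (simp add: target_def card sum) (simp add: D_eq)
qed

lemma diagonal_eq: "{(s, s) | s. s \<in> carrier S} = twisted_diag (carrier S) (restrict id (carrier S))"
  by (auto simp: twisted_diag_def)

text \<open>The formal sum of graph bisets with coefficient function \<open>q\<close>, written as in the definition of
  \<open>F_generated\<close>.\<close>

definition generator :: "(('a \<times> 'a) set \<Rightarrow> rat) \<Rightarrow> ('a \<times> 'a) formal_sum" where
  "generator q = (\<Sum>P\<in>{P. sub P}. \<Sum>\<phi>\<in>F P (carrier S).
    Poly_Mapping.single (iso_class T (trans_biset S S P \<phi>)) (q (twisted_diag P \<phi>)))"

lemma finite_subs: "finite {P. sub P}"
  by (rule finite_subset[of _ "Pow (carrier S)"]) (use subgroup.subset finite_S in auto)

lemma trans_biset_gset: "\<lbrakk>sub P; \<phi> \<in> mor P\<rbrakk> \<Longrightarrow> is_gset T (trans_biset S S P \<phi>)"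
  unfolding trans_biset_def by (rule is_gset_coset[OF group_T finite_T subgroup_twisted_diag])

lemma sum_graphs: "(\<Sum>U\<in>graphs. h U) = (\<Sum>P\<in>{P. sub P}. \<Sum>\<phi>\<in>mor P. h (twisted_diag P \<phi>))"
proof -
  have eq: "graphs = (\<Union>P\<in>{P. sub P}. twisted_diag P ` mor P)" by (auto simp: graphs_def)
  have "(\<Sum>U\<in>graphs. h U) = (\<Sum>P\<in>{P. sub P}. \<Sum>U\<in>twisted_diag P ` mor P. h U)"
    unfolding eq using finite_subs finite_mor twisted_diag_disjoint by (intro sum.UNION_disjoint) auto
  also have "\<dots> = (\<Sum>P\<in>{P. sub P}. \<Sum>\<phi>\<in>mor P. h (twisted_diag P \<phi>))"
    using twisted_diag_inj by (intro sum.cong refl) (simp add: sum.reindex)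
  finally show ?thesis .
qed

lemma generator_formal_sum:
  assumes "\<And>U. q U \<in> Zp"
  shows "generator q \<in> formal_sums p T"
  unfolding generator_def mor_def[symmetric] using assms
  by (intro formal_sums_sum formal_sums_single prime iso_class_in_iso_classes trans_biset_gset) auto

lemma wsum_generator:
  "wsum T w (generator q) = (\<Sum>U\<in>graphs. q U * ((\<Sum>g\<in>carrier T. w (conj_set T g U)) / of_nat (card U)))"
proof -
  have "wsum T w (generator q) = (\<Sum>P\<in>{P. sub P}. \<Sum>\<phi>\<in>mor P. q (twisted_diag P \<phi>) *
      stab_sum T w (coset_gset T (twisted_diag P \<phi>)))"
    unfolding generator_def mor_def[symmetric] linear_ext_sum
    by (intro sum.cong refl) (use wsum_single[OF trans_biset_gset] in \<open>simp add: trans_biset_def del: linear_ext_single\<close>)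
  also have "\<dots> = (\<Sum>U\<in>graphs. q U * stab_sum T w (coset_gset T U))" by (rule sum_graphs[symmetric])
  also have "\<dots> = (\<Sum>U\<in>graphs. q U * ((\<Sum>g\<in>carrier T. w (conj_set T g U)) / of_nat (card U)))"
    by (intro sum.cong refl) (simp add: group.stab_sum_coset[OF group_T finite_T graphs_subgroup])
  finally show ?thesis .
qed

lemma wsum_generator_cong:
  "(\<And>U. U \<in> graphs \<Longrightarrow> w U = w' U) \<Longrightarrow> wsum T w (generator q) = wsum T w' (generator q)"
  unfolding wsum_generator by (intro sum.cong refl arg_cong2[of _ _ _ _ "(*)"] arg_cong2[of _ _ _ _ "(/)"])
    (simp add: graphs_conj)

lemma wsum_generator_marks: "wsum T (contains D) (generator q) = (\<Sum>U\<in>graphs. q U * mark U D)"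
  unfolding wsum_generator by (intro sum.cong refl) (simp add: mark_eq)

section \<open>Stability, idempotence and augmentation\<close>

text \<open>If \<open>B\<close> is the graph of \<open>\<theta>\<close> on \<open>R\<close>, then \<open>A O B\<close> consists of the \<open>(k, u)\<close> with \<open>u \<in> R\<close> and
  \<open>(k, \<theta> u) \<in> A\<close>, and only the identity stabilizes both sides in the middle.  So the composite sees \<open>A\<close>
  only at the transported subgroup.  The same holds for the converse of a graph on the left.\<close>

lemma comp_weight_graph_right:
  assumes A: "A \<in> graphs" and \<theta>: "sub R" "\<theta> \<in> mor R" and G: "\<one>\<^bsub>G\<^esub> = \<one>"
  shows "comp_weight G S S (contains D) A (twisted_diag R \<theta>) =
    of_bool (snd ` D \<subseteq> R) * contains (map_prod id \<theta> ` D) A / of_nat (order S)"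
proof -
  have "(\<one>, \<one>) \<in> A" using subgroup.one_closed[OF graphs_subgroup[OF A]] by simp
  then have "middle_stab G S S A (twisted_diag R \<theta>) = {\<one>}"
    using mor_one[OF \<theta>] subgroup.one_closed[OF \<theta>(1)] by (auto simp: middle_stab_def G)
  moreover have "D \<subseteq> A O twisted_diag R \<theta> \<longleftrightarrow> snd ` D \<subseteq> R \<and> map_prod id \<theta> ` D \<subseteq> A"
    by (force simp: relcomp_unfold)
  ultimately show ?thesis by (simp add: comp_weight_def)
qed

lemma comp_weight_graph_left:
  assumes B: "B \<in> graphs" and \<theta>: "sub R" "\<theta> \<in> mor R" and K: "\<one>\<^bsub>K\<^esub> = \<one>"
  shows "comp_weight S S K (contains D) ((twisted_diag R \<theta>)\<inverse>) B =
    of_bool (fst ` D \<subseteq> R) * contains (map_prod \<theta> id ` D) B / of_nat (order S)"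
proof -
  have "(\<one>, \<one>) \<in> B" using subgroup.one_closed[OF graphs_subgroup[OF B]] by simp
  then have "middle_stab S S K ((twisted_diag R \<theta>)\<inverse>) B = {\<one>}"
    using mor_one[OF \<theta>] subgroup.one_closed[OF \<theta>(1)] by (auto simp: middle_stab_def K)
  moreover have "D \<subseteq> (twisted_diag R \<theta>)\<inverse> O B \<longleftrightarrow> fst ` D \<subseteq> R \<and> map_prod \<theta> id ` D \<subseteq> B"
    by (force simp: relcomp_unfold)
  ultimately show ?thesis by (simp add: comp_weight_def)
qed

lemma target_map_snd:
  assumes D: "D \<subseteq> carrier S \<times> R" and \<theta>: "sub R" "\<theta> \<in> mor R"
  shows "target (map_prod id \<theta> ` D) = target D"
  using mor_restrict_self[OF \<theta>] \<theta> mor_id[OF sub_carrier] by (intro target_push[OF D]) auto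

lemma target_map_fst:
  assumes D: "D \<subseteq> R \<times> carrier S" and \<theta>: "sub R" "\<theta> \<in> mor R"
  shows "target (map_prod \<theta> id ` D) = target D"
  using mor_restrict_self[OF \<theta>] \<theta> mor_id[OF sub_carrier] by (intro target_push[OF D]) auto

lemma subgroup_map_snd:
  assumes "subgroup D T" and D: "D \<subseteq> carrier S \<times> R" and \<theta>: "sub R" "\<theta> \<in> mor R"
  shows "subgroup (map_prod id \<theta> ` D) T"
  using mor_restrict_self[OF \<theta>] \<theta> mor_id[OF sub_carrier] by (intro subgroup_push[OF assms(1) D]) auto

lemma subgroup_map_fst:
  assumes "subgroup D T" and D: "D \<subseteq> R \<times> carrier S" and \<theta>: "sub R" "\<theta> \<in> mor R"
  shows "subgroup (map_prod \<theta> id ` D) T"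
  using mor_restrict_self[OF \<theta>] \<theta> mor_id[OF sub_carrier] by (intro subgroup_push[OF assms(1) D]) auto

lemma conj_graph:
  assumes "a \<in> carrier S" "b \<in> carrier S" "sub P" "\<phi> \<in> mor P"
  obtains \<chi> where "\<chi> \<in> mor (conj_set S b P)" "map_prod (conj_map S a) (conj_map S b) ` twisted_diag P \<phi> =
    twisted_diag (conj_set S b P) \<chi>"
proof -
  have "conj_set T (a, b) (twisted_diag P \<phi>) \<in> graphs" using assms by (intro graphs_conj graphsI) auto
  then obtain R \<chi> where R: "sub R" "\<chi> \<in> mor R" "conj_set T (a, b) (twisted_diag P \<phi>) = twisted_diag R \<chi>"
    by (rule graphsE)
  have "conj_set S b P = snd ` conj_set T (a, b) (twisted_diag P \<phi>)"
    using snd_conj_set[of "(a, b)" "twisted_diag P \<phi>"] assms(1,2) by simp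
  then have "conj_set S b P = R" by (simp add: R(3))
  then show ?thesis using that R(2,3) assms(1,2) by (simp add: conj_set_T)
qed

lemma conj_self: "\<lbrakk>sub P; r \<in> P\<rbrakk> \<Longrightarrow> conj_set S r P = P"
  using normalizer_contains normalizer_sub by blast

lemma subgroup_restricted:
  assumes P: "sub P"
  shows "subgroup D (S \<times>\<times> S\<lparr>carrier := P\<rparr>) \<Longrightarrow> subgroup D T \<and> D \<subseteq> carrier S \<times> P"
    and "subgroup D (S\<lparr>carrier := P\<rparr> \<times>\<times> S) \<Longrightarrow> subgroup D T \<and> D \<subseteq> P \<times> carrier S"
proof -
  interpret T: group T by (rule group_T)
  have 1: "S \<times>\<times> S\<lparr>carrier := P\<rparr> = T\<lparr>carrier := carrier S \<times> P\<rparr>"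
    and 2: "S\<lparr>carrier := P\<rparr> \<times>\<times> S = T\<lparr>carrier := P \<times> carrier S\<rparr>" by (simp_all add: DirProd_def)
  have 3: "subgroup (carrier S \<times> P) T" "subgroup (P \<times> carrier S) T"
    using DirProd_subgroups[OF is_group _ is_group] P by auto
  show "subgroup D (S \<times>\<times> S\<lparr>carrier := P\<rparr>) \<Longrightarrow> subgroup D T \<and> D \<subseteq> carrier S \<times> P"
    unfolding 1 using T.incl_subgroup[OF 3(1)] subgroup.subset by fastforce
  show "subgroup D (S\<lparr>carrier := P\<rparr> \<times>\<times> S) \<Longrightarrow> subgroup D T \<and> D \<subseteq> P \<times> carrier S"
    unfolding 2 using T.incl_subgroup[OF 3(2)] subgroup.subset by fastforce
qed

lemma subgroup_in_restricted:
  assumes P: "sub P"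
  shows "\<lbrakk>subgroup D T; D \<subseteq> carrier S \<times> P\<rbrakk> \<Longrightarrow> subgroup D (S \<times>\<times> S\<lparr>carrier := P\<rparr>)"
    and "\<lbrakk>subgroup D T; D \<subseteq> P \<times> carrier S\<rbrakk> \<Longrightarrow> subgroup D (S\<lparr>carrier := P\<rparr> \<times>\<times> S)"
proof -
  interpret T: group T by (rule group_T)
  have 1: "S \<times>\<times> S\<lparr>carrier := P\<rparr> = T\<lparr>carrier := carrier S \<times> P\<rparr>"
    and 2: "S\<lparr>carrier := P\<rparr> \<times>\<times> S = T\<lparr>carrier := P \<times> carrier S\<rparr>" by (simp_all add: DirProd_def)
  have 3: "subgroup (carrier S \<times> P) T" "subgroup (P \<times> carrier S) T"
    using DirProd_subgroups[OF is_group _ is_group] P by auto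
  show "\<lbrakk>subgroup D T; D \<subseteq> carrier S \<times> P\<rbrakk> \<Longrightarrow> subgroup D (S \<times>\<times> S\<lparr>carrier := P\<rparr>)"
    unfolding 1 by (rule T.subgroup_incl[OF _ 3(1)])
  show "\<lbrakk>subgroup D T; D \<subseteq> P \<times> carrier S\<rbrakk> \<Longrightarrow> subgroup D (S\<lparr>carrier := P\<rparr> \<times>\<times> S)"
    unfolding 2 by (rule T.subgroup_incl[OF _ 3(2)])
qed

lemma subgroup_converse_diag:
  assumes "sub P" "\<phi> \<in> mor P"
  shows "subgroup ((twisted_diag P \<phi>)\<inverse>) (S\<lparr>carrier := P\<rparr> \<times>\<times> S)"
proof (rule subgroup_in_restricted(2)[OF assms(1)])
  show "subgroup ((twisted_diag P \<phi>)\<inverse>) T"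
    using assms mor_closed[OF assms] mor_hom[OF assms] mor_one[OF assms] mor_inv[OF assms]
      subgroup.subset[OF assms(1)] subgroup.m_closed[OF assms(1)] subgroup.one_closed[OF assms(1)]
      subgroup.m_inv_closed[OF assms(1)]
    by (intro subgroup.intro) (auto simp: inv_DirProd)
  show "(twisted_diag P \<phi>)\<inverse> \<subseteq> P \<times> carrier S" using mor_closed[OF assms] by auto
qed

lemma conj_set_restricted:
  assumes P: "sub P" and a: "a \<in> carrier S" and r: "r \<in> P"
  shows "conj_set (S \<times>\<times> S\<lparr>carrier := P\<rparr>) (a, r) D = map_prod (conj_map S a) (conj_map S r) ` D"
    and "conj_set (S\<lparr>carrier := P\<rparr> \<times>\<times> S) (r, a) D = map_prod (conj_map S r) (conj_map S a) ` D"
proof -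
  have gP: "group (S\<lparr>carrier := P\<rparr>)" by (rule subgroup_imp_group[OF P])
  have inv: "inv\<^bsub>S\<lparr>carrier := P\<rparr>\<^esub> r = inv r" by (rule m_inv_consistent[OF P r])
  show "conj_set (S \<times>\<times> S\<lparr>carrier := P\<rparr>) (a, r) D = map_prod (conj_map S a) (conj_map S r) ` D"
    unfolding conj_set_def using a r inv inv_DirProd[OF is_group gP, of a r]
    by (intro image_cong refl) (auto simp: conj_map_def mult_DirProd')
  show "conj_set (S\<lparr>carrier := P\<rparr> \<times>\<times> S) (r, a) D = map_prod (conj_map S r) (conj_map S a) ` D"
    unfolding conj_set_def using a r inv inv_DirProd[OF gP is_group, of r a]
    by (intro image_cong refl) (auto simp: conj_map_def mult_DirProd')
qed


text \<open>From here on \<open>q\<close> is a fixed coefficient function that realizes the target marks, and \<open>b\<close> the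
  corresponding formal sum.\<close>

context
  fixes q :: "('a \<times> 'a) set \<Rightarrow> rat"
  assumes q: "\<And>U. q U \<in> Zp"
    and marks: "\<And>D. subgroup D T \<Longrightarrow> (\<Sum>U\<in>graphs. q U * mark U D) = target D"
begin

abbreviation "b \<equiv> generator q"

lemma b_formal: "b \<in> formal_sums p T"
  by (rule generator_formal_sum[OF q])

lemma b_marks: "subgroup D T \<Longrightarrow> wsum T (contains D) b = target D"
  by (simp add: wsum_generator_marks marks)

lemma stabilization_eq:
  "stabilization p T product_F (gset_class p T (coset_gset T {(s, s) | s. s \<in> carrier S})) =
    burnside_class p T b"
proof -
  interpret T: group T by (rule group_T)
  let ?\<Delta> = "twisted_diag (carrier S) (restrict id (carrier S))"
  let ?A = "gset_class p T (coset_gset T ?\<Delta>)"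
  have \<Delta>: "?\<Delta> \<in> graphs" by (rule graphsI[OF sub_carrier mor_id[OF sub_carrier]])
  have X: "is_gset T (coset_gset T ?\<Delta>)" by (rule is_gset_coset[OF group_T finite_T graphs_subgroup[OF \<Delta>]])
  have fs: "Poly_Mapping.single (iso_class T (coset_gset T ?\<Delta>)) 1 \<in> formal_sums p T"
    using formal_sums_single[OF prime iso_class_in_iso_classes[OF X] Z_loc_1[OF prime]] .
  have A: "fixed_point_map D ?A = mark ?\<Delta> D" if "subgroup D T" for D
    unfolding gset_class_def fixed_point_map_class[OF fs subgroup.subset[OF that]] wsum_single[OF X]
    by (simp add: mark_def)
  have avg: "1 / of_nat (card (fconj_class T product_F D)) *
      (\<Sum>D'\<in>fconj_class T product_F D. fixed_point_map D' ?A) = target D" if D: "subgroup D T" for D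
  proof -
    have "(\<Sum>D'\<in>fconj_class T product_F D. fixed_point_map D' ?A) =
        (\<Sum>D'\<in>fconj_class T product_F D. mark ?\<Delta> D')"
      by (intro sum.cong refl A) (simp add: fconj_class_def)
    then show ?thesis using average_diagonal[OF D] by simp
  qed
  have "stabilization p T product_F ?A = burnside_class p T b"
    unfolding stabilization_def
  proof (rule the_equality)
    have "fixed_point_map D (burnside_class p T b) = target D" if "subgroup D T" for D
      using fixed_point_map_class[OF b_formal subgroup.subset[OF that]] b_marks[OF that] by simp
    then show "burnside_class p T b \<in> burnside p T \<and> (\<forall>D. subgroup D T \<longrightarrow>
        fixed_point_map D (burnside_class p T b) = 1 / of_nat (card (fconj_class T product_F D)) *
          (\<Sum>D'\<in>fconj_class T product_F D. fixed_point_map D' ?A))"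
      using b_formal avg unfolding burnside_iff by metis
  next
    fix B assume B: "B \<in> burnside p T \<and> (\<forall>D. subgroup D T \<longrightarrow>
        fixed_point_map D B = 1 / of_nat (card (fconj_class T product_F D)) *
          (\<Sum>D'\<in>fconj_class T product_F D. fixed_point_map D' ?A))"
    then obtain a where a: "a \<in> formal_sums p T" "B = burnside_class p T a" unfolding burnside_iff by blast
    have "wsum T (contains D) a = wsum T (contains D) b" if D: "subgroup D T" for D
    proof -
      have "fixed_point_map D B = target D" using B D avg[OF D] by metis
      then show ?thesis
        using fixed_point_map_class[OF a(1) subgroup.subset[OF D]] b_marks[OF D] by (simp add: a(2))
    qed
    then show "B = burnside_class p T b"
      unfolding a(2) using burnside_class_eq_iff[OF prime group_T finite_T a(1) b_formal] by blast
  qed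
  then show ?thesis unfolding diagonal_eq .
qed

lemma three_groups:
  assumes "sub P"
  shows "three_groups (S\<lparr>carrier := P\<rparr>) S S p" "three_groups S S (S\<lparr>carrier := P\<rparr>) p" "three_groups S S S p"
  using assms subgroup_imp_group[OF assms] finite_sub[OF assms] finite_S prime
  by (auto simp: three_groups_def three_groups_axioms_def is_group)

text \<open>All stabilizers of \<open>[P, \<phi>]\<close> are graphs of morphisms \<open>\<chi>\<close> on \<open>P\<close>, so the composite has at \<open>D\<close> an average
  of values of the target at transports of \<open>D\<close>, which is the target at \<open>D\<close> itself.  The answer does
  not depend on \<open>\<phi>\<close>.\<close>

lemma right_composite_marks:
  assumes P: "sub P" and \<phi>: "\<phi> \<in> mor P"
  defines "a \<equiv> Poly_Mapping.single (iso_class (S \<times>\<times> S\<lparr>carrier := P\<rparr>) (trans_biset (S\<lparr>carrier := P\<rparr>) S P \<phi>)) 1"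
  shows "a \<in> formal_sums p (S \<times>\<times> S\<lparr>carrier := P\<rparr>)"
    and "subgroup D (S \<times>\<times> S\<lparr>carrier := P\<rparr>) \<Longrightarrow>
      wsum (S \<times>\<times> S\<lparr>carrier := P\<rparr>) (contains D) (formal_comp (S\<lparr>carrier := P\<rparr>) S S b a) = target D"
proof -
  let ?SP = "S \<times>\<times> S\<lparr>carrier := P\<rparr>" and ?U = "twisted_diag P \<phi>"
  interpret three_groups "S\<lparr>carrier := P\<rparr>" S S p by (rule three_groups[OF P])
  have gSP: "group ?SP" by (rule groups)
  have finSP: "finite (carrier ?SP)" using finite_S finite_sub[OF P] by simp
  have ord: "of_nat (card P) \<noteq> (0 :: rat)" "of_nat (order S) \<noteq> (0 :: rat)"
    using finite_sub[OF P] subgroup.one_closed[OF P] finite_S one_closed by (auto simp: card_eq_0_iff order_def)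
  have U: "subgroup ?U ?SP"
    using mor_closed[OF P \<phi>] by (intro subgroup_in_restricted(1)[OF P subgroup_twisted_diag[OF P \<phi>]]) auto
  have X: "is_gset ?SP (trans_biset (S\<lparr>carrier := P\<rparr>) S P \<phi>)"
    unfolding trans_biset_def by (rule is_gset_coset[OF gSP finSP U])
  show a: "a \<in> formal_sums p ?SP"
    unfolding a_def by (rule formal_sums_single[OF prime iso_class_in_iso_classes[OF X] Z_loc_1[OF prime]])
  show "wsum ?SP (contains D) (formal_comp (S\<lparr>carrier := P\<rparr>) S S b a) = target D" if "subgroup D ?SP"
  proof -
    have D: "subgroup D T" "D \<subseteq> carrier S \<times> P" using subgroup_restricted(1)[OF P that] by auto
    let ?w = "\<lambda>A. comp_weight (S\<lparr>carrier := P\<rparr>) S S (contains D) A"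
    have summand: "wsum T (\<lambda>A. ?w A (conj_set ?SP g ?U)) b = target D / of_nat (order S)"
      if g: "g \<in> carrier ?SP" for g
    proof -
      obtain s r where sr: "g = (s, r)" "s \<in> carrier S" "r \<in> P" using g by auto
      obtain \<chi> where \<chi>: "\<chi> \<in> mor P" "conj_set ?SP g ?U = twisted_diag P \<chi>"
        using conj_graph[OF sr(2) sub_closed[OF P sr(3)] P \<phi>] conj_self[OF P sr(3)]
          conj_set_restricted(1)[OF P sr(2,3), of ?U] sr(1) by metis
      have "wsum T (\<lambda>A. ?w A (twisted_diag P \<chi>)) b =
          wsum T (\<lambda>A. (1 / of_nat (order S)) * contains (map_prod id \<chi> ` D) A) b"
        using D(2) by (intro wsum_generator_cong) (auto simp: comp_weight_graph_right[OF _ P \<chi>(1)])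
      also have "\<dots> = target D / of_nat (order S)"
        unfolding wsum_linear(1) b_marks[OF subgroup_map_snd[OF D P \<chi>(1)]] target_map_snd[OF D(2) P \<chi>(1)]
        by simp
      finally show ?thesis unfolding \<chi>(2) .
    qed
    have "wsum ?SP (contains D) (formal_comp (S\<lparr>carrier := P\<rparr>) S S b a) =
        wsum T (\<lambda>A. wsum ?SP (\<lambda>B. ?w A B) a) b"
      by (rule wsum_formal_comp[OF b_formal a])
    also have "\<dots> = wsum T (\<lambda>A. (1 / of_nat (card P)) * (\<Sum>g\<in>carrier ?SP. ?w A (conj_set ?SP g ?U))) b"
      unfolding a_def wsum_single[OF X] unfolding trans_biset_def group.stab_sum_coset[OF gSP finSP U] by simp
    also have "\<dots> = (1 / of_nat (card P)) * (\<Sum>g\<in>carrier ?SP. target D / of_nat (order S))"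
      unfolding wsum_linear using summand by simp
    also have "\<dots> = target D" using ord by (simp add: card_cartesian_product order_def)
    finally show ?thesis .
  qed
qed

text \<open>In the left factor \<open>[\<phi>(P), \<phi>\<^sup>-\<^sup>1]\<close> the stabilizers are converses of graphs on \<open>P\<close>.  The generality in
  \<open>Q\<close> and \<open>\<psi>\<close> accommodates the two descriptions \<open>inv_into P \<phi>\<close> and \<open>id\<close> of such inverses.\<close>

lemma left_composite_marks:
  assumes P: "sub P" and \<phi>: "\<phi> \<in> mor P" and V: "twisted_diag Q \<psi> = (twisted_diag P \<phi>)\<inverse>"
  defines "a \<equiv> Poly_Mapping.single (iso_class (S\<lparr>carrier := P\<rparr> \<times>\<times> S) (trans_biset S (S\<lparr>carrier := P\<rparr>) Q \<psi>)) 1"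
  shows "a \<in> formal_sums p (S\<lparr>carrier := P\<rparr> \<times>\<times> S)"
    and "subgroup D (S\<lparr>carrier := P\<rparr> \<times>\<times> S) \<Longrightarrow>
      wsum (S\<lparr>carrier := P\<rparr> \<times>\<times> S) (contains D) (formal_comp S S (S\<lparr>carrier := P\<rparr>) a b) = target D"
proof -
  let ?PS = "S\<lparr>carrier := P\<rparr> \<times>\<times> S" and ?U = "(twisted_diag P \<phi>)\<inverse>"
  interpret three_groups S S "S\<lparr>carrier := P\<rparr>" p by (rule three_groups[OF P])
  have gPS: "group ?PS" by (rule groups)
  have finPS: "finite (carrier ?PS)" using finite_S finite_sub[OF P] by simp
  have ord: "of_nat (card P) \<noteq> (0 :: rat)" "of_nat (order S) \<noteq> (0 :: rat)"
    using finite_sub[OF P] subgroup.one_closed[OF P] finite_S one_closed by (auto simp: card_eq_0_iff order_def)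
  have U: "subgroup ?U ?PS" by (rule subgroup_converse_diag[OF P \<phi>])
  have cardU: "card ?U = card P" by simp
  have X: "is_gset ?PS (trans_biset S (S\<lparr>carrier := P\<rparr>) Q \<psi>)"
    unfolding trans_biset_def V by (rule is_gset_coset[OF gPS finPS U])
  show a: "a \<in> formal_sums p ?PS"
    unfolding a_def by (rule formal_sums_single[OF prime iso_class_in_iso_classes[OF X] Z_loc_1[OF prime]])
  show "wsum ?PS (contains D) (formal_comp S S (S\<lparr>carrier := P\<rparr>) a b) = target D" if "subgroup D ?PS"
  proof -
    have D: "subgroup D T" "D \<subseteq> P \<times> carrier S" using subgroup_restricted(2)[OF P that] by auto
    let ?w = "\<lambda>A. comp_weight S S (S\<lparr>carrier := P\<rparr>) (contains D) A"
    have summand: "wsum T (\<lambda>B. ?w (conj_set ?PS g ?U) B) b = target D / of_nat (order S)"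
      if g: "g \<in> carrier ?PS" for g
    proof -
      obtain s r where sr: "g = (r, s)" "s \<in> carrier S" "r \<in> P" using g by auto
      obtain \<chi> where \<chi>: "\<chi> \<in> mor P" "map_prod (conj_map S s) (conj_map S r) ` twisted_diag P \<phi> = twisted_diag P \<chi>"
        using conj_graph[OF sr(2) sub_closed[OF P sr(3)] P \<phi>] conj_self[OF P sr(3)] by metis
      have conv: "map_prod f h ` (A\<inverse>) = (map_prod h f ` A)\<inverse>" for f h :: "'a \<Rightarrow> 'a" and A by force
      have eq: "conj_set ?PS g ?U = (twisted_diag P \<chi>)\<inverse>"
        unfolding sr(1) conj_set_restricted(2)[OF P sr(2,3)] conv \<chi>(2) ..
      have "wsum T (\<lambda>B. ?w ((twisted_diag P \<chi>)\<inverse>) B) b =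
          wsum T (\<lambda>B. (1 / of_nat (order S)) * contains (map_prod \<chi> id ` D) B) b"
        using D(2) by (intro wsum_generator_cong) (auto simp: comp_weight_graph_left[OF _ P \<chi>(1)])
      also have "\<dots> = target D / of_nat (order S)"
        unfolding wsum_linear(1) b_marks[OF subgroup_map_fst[OF D P \<chi>(1)]] target_map_fst[OF D(2) P \<chi>(1)]
        by simp
      finally show ?thesis unfolding eq .
    qed
    have "wsum ?PS (contains D) (formal_comp S S (S\<lparr>carrier := P\<rparr>) a b) =
        wsum ?PS (\<lambda>A. wsum T (\<lambda>B. ?w A B) b) a"
      by (rule wsum_formal_comp[OF a b_formal])
    also have "\<dots> = (\<Sum>g\<in>carrier ?PS. wsum T (\<lambda>B. ?w (conj_set ?PS g ?U) B) b) / of_nat (card P)"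
      unfolding a_def wsum_single[OF X] unfolding trans_biset_def V group.stab_sum_coset[OF gPS finPS U] cardU by simp
    also have "\<dots> = (\<Sum>g\<in>carrier ?PS. target D / of_nat (order S)) / of_nat (card P)"
      using summand by simp
    also have "\<dots> = target D" using ord by (simp add: card_cartesian_product order_def)
    finally show ?thesis .
  qed
qed

lemma b_right_stable: "right_stable p S F (burnside_class p T b)"
  unfolding right_stable_def
proof (intro allI impI ballI)
  fix P \<phi> assume P: "sub P" and "\<phi> \<in> F P (carrier S)"
  then have \<phi>: "\<phi> \<in> mor P" by (simp add: mor_def)
  interpret three_groups "S\<lparr>carrier := P\<rparr>" S S p by (rule three_groups[OF P])
  have gSP: "group (S \<times>\<times> S\<lparr>carrier := P\<rparr>)" and finSP: "finite (carrier (S \<times>\<times> S\<lparr>carrier := P\<rparr>))"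
    using groups finite_S finite_sub[OF P] by auto
  have id: "trans_biset (S\<lparr>carrier := P\<rparr>) S P id = trans_biset (S\<lparr>carrier := P\<rparr>) S P (restrict id P)"
    unfolding trans_biset_def by (rule arg_cong[of _ _ "coset_gset _"]) (auto simp: twisted_diag_def)
  show "burnside_comp p (S\<lparr>carrier := P\<rparr>) S S (burnside_class p T b) (trans_class p (S\<lparr>carrier := P\<rparr>) S P \<phi>) =
      burnside_comp p (S\<lparr>carrier := P\<rparr>) S S (burnside_class p T b) (trans_class p (S\<lparr>carrier := P\<rparr>) S P id)"
    unfolding trans_class_def gset_class_def id
    using right_composite_marks[OF P \<phi>] right_composite_marks[OF P mor_id[OF P]]
      burnside_class_eq_iff[OF prime gSP finSP formal_comp_closed[OF b_formal] formal_comp_closed[OF b_formal]]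
    by (simp add: burnside_comp_class[OF b_formal])
qed

lemma b_left_stable: "left_stable p S F (burnside_class p T b)"
  unfolding left_stable_def
proof (intro allI impI ballI)
  fix P \<phi> assume P: "sub P" and "\<phi> \<in> F P (carrier S)"
  then have \<phi>: "\<phi> \<in> mor P" by (simp add: mor_def)
  interpret three_groups S S "S\<lparr>carrier := P\<rparr>" p by (rule three_groups[OF P])
  have gPS: "group (S\<lparr>carrier := P\<rparr> \<times>\<times> S)" and finPS: "finite (carrier (S\<lparr>carrier := P\<rparr> \<times>\<times> S))"
    using groups finite_S finite_sub[OF P] by auto
  have 1: "twisted_diag (\<phi> ` P) (inv_into P \<phi>) = (twisted_diag P \<phi>)\<inverse>"
    using mor_inj[OF P \<phi>] by (auto simp: twisted_diag_def)
  have 2: "twisted_diag P id = (twisted_diag P (restrict id P))\<inverse>"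
    by (auto simp: twisted_diag_def)
  show "burnside_comp p S S (S\<lparr>carrier := P\<rparr>)
        (trans_class p S (S\<lparr>carrier := P\<rparr>) (\<phi> ` P) (inv_into P \<phi>)) (burnside_class p T b) =
      burnside_comp p S S (S\<lparr>carrier := P\<rparr>)
        (trans_class p S (S\<lparr>carrier := P\<rparr>) P id) (burnside_class p T b)"
    unfolding trans_class_def gset_class_def
    using left_composite_marks[OF P \<phi> 1] left_composite_marks[OF P mor_id[OF P] 2]
      burnside_class_eq_iff[OF prime gPS finPS formal_comp_closed[OF _ b_formal] formal_comp_closed[OF _ b_formal]]
    by (simp add: burnside_comp_class[OF _ b_formal])
qed

text \<open>Each of the \<open>|F(Q, S)|\<close> graphs with domain \<open>Q\<close> contributes \<open>|S| / |F(Q, S)|\<close>.\<close>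

lemma b_column_sum:
  assumes Q: "sub Q"
  shows "wsum T (\<lambda>U. of_bool (Q \<subseteq> snd ` U)) b = of_nat (order S)"
proof -
  have "wsum T (\<lambda>U. of_bool (Q \<subseteq> snd ` U)) b = wsum T (\<lambda>U. \<Sum>\<psi>\<in>mor Q. contains (twisted_diag Q \<psi>) U) b"
    by (rule wsum_generator_cong) (simp add: column_sum_graph[OF Q])
  also have "\<dots> = (\<Sum>\<psi>\<in>mor Q. target (twisted_diag Q \<psi>))"
    unfolding wsum_linear(2) by (intro sum.cong refl b_marks subgroup_twisted_diag[OF Q])
  also have "\<dots> = of_nat (order S)"
    using card_mor_pos[OF Q] by (simp add: target_def graphsI[OF Q])
  finally show ?thesis .
qed

text \<open>Stability evaluates the left factor at \<open>target D\<close> for every stabilizer of the right factor whose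
  domain contains the second projection of \<open>D\<close>; what remains is a column sum of \<open>b\<close>.\<close>

lemma b_idempotent: "burnside_comp p S S S (burnside_class p T b) (burnside_class p T b) = burnside_class p T b"
proof -
  interpret three_groups S S S p by (rule three_groups[OF sub_carrier])
  have "wsum T (contains D) (formal_comp S S S b b) = target D" if D: "subgroup D T" for D
  proof -
    let ?w = "\<lambda>A. comp_weight S S S (contains D) A"
    have DS: "sub (snd ` D)" by (rule sub_snd[OF D])
    have summand: "wsum T (\<lambda>A. ?w A B) b = target D / of_nat (order S) * of_bool (snd ` D \<subseteq> snd ` B)"
      if "B \<in> graphs" for B
    proof -
      obtain R \<theta> where R: "sub R" and \<theta>: "\<theta> \<in> mor R" and B: "B = twisted_diag R \<theta>"
        using \<open>B \<in> graphs\<close> by (rule graphsE)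
      have "wsum T (\<lambda>A. ?w A B) b = wsum T (\<lambda>A. of_bool (snd ` D \<subseteq> R) / of_nat (order S) * contains (map_prod id \<theta> ` D) A) b"
        unfolding B by (intro wsum_generator_cong) (auto simp: comp_weight_graph_right[OF _ R \<theta>])
      also have "\<dots> = of_bool (snd ` D \<subseteq> R) / of_nat (order S) * wsum T (contains (map_prod id \<theta> ` D)) b"
        by (rule wsum_linear(1))
      also have "\<dots> = target D / of_nat (order S) * of_bool (snd ` D \<subseteq> R)"
      proof (cases "snd ` D \<subseteq> R")
        case True
        then have D2: "D \<subseteq> carrier S \<times> R" using subgroup.subset[OF D] by force
        show ?thesis
          using True b_marks[OF subgroup_map_snd[OF D D2 R \<theta>]] target_map_snd[OF D2 R \<theta>] by simp
      qed simp
      finally show ?thesis by (simp add: B)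
    qed
    have "wsum T (contains D) (formal_comp S S S b b) = wsum T (\<lambda>A. wsum T (\<lambda>B. ?w A B) b) b"
      by (rule wsum_formal_comp[OF b_formal b_formal])
    also have "\<dots> = wsum T (\<lambda>A. \<Sum>U\<in>graphs. q U / of_nat (card U) * (\<Sum>g\<in>carrier T. ?w A (conj_set T g U))) b"
      unfolding wsum_generator[of _ q] by (simp add: mult.commute)
    also have "\<dots> = (\<Sum>U\<in>graphs. q U / of_nat (card U) * (\<Sum>g\<in>carrier T. wsum T (\<lambda>A. ?w A (conj_set T g U)) b))"
      unfolding wsum_linear ..
    also have "\<dots> = (\<Sum>U\<in>graphs. q U * ((\<Sum>g\<in>carrier T. target D / of_nat (order S) *
        of_bool (snd ` D \<subseteq> snd ` conj_set T g U)) / of_nat (card U)))"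
      by (intro sum.cong refl) (simp add: summand graphs_conj)
    also have "\<dots> = wsum T (\<lambda>B. target D / of_nat (order S) * of_bool (snd ` D \<subseteq> snd ` B)) b"
      by (rule wsum_generator[symmetric])
    also have "\<dots> = target D"
      unfolding wsum_linear(1) b_column_sum[OF DS] using finite_S one_closed by (auto simp: order_def card_eq_0_iff)
    finally show ?thesis .
  qed
  then show ?thesis
    using burnside_class_eq_iff[OF prime group_T finite_T formal_comp_closed[OF b_formal b_formal] b_formal] b_marks
    by (simp add: burnside_comp_class[OF b_formal b_formal])
qed

lemma b_generated: "F_generated p S F (burnside_class p T b)"
  unfolding F_generated_def generator_def
  using q by (intro exI[of _ "\<lambda>P \<phi>. q (twisted_diag P \<phi>)"]) simp

text \<open>Stabilizers are graphs, and a graph is single valued over the identity.\<close>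

lemma graph_biset_left_free:
  assumes "sub P" "\<phi> \<in> mor P" "X \<in> iso_class T (trans_biset S S P \<phi>)"
  shows "left_free S S X"
proof -
  interpret T: group T by (rule group_T)
  let ?Y = "trans_biset S S P \<phi>" and ?U = "twisted_diag P \<phi>"
  have U: "?U \<in> graphs" using assms(1,2) by (rule graphsI)
  obtain f where f: "bij_betw f (pts ?Y) (pts X)"
    and eq: "\<And>g x. g \<in> carrier T \<Longrightarrow> x \<in> pts ?Y \<Longrightarrow> f (act ?Y g x) = act X g (f x)"
    using assms(3) unfolding iso_class_def gset_iso_def by blast
  show ?thesis unfolding left_free_def
  proof (intro ballI impI)
    fix h x assume h: "h \<in> carrier S" and x: "x \<in> pts X" and fx: "act X (h, \<one>) x = x"
    obtain y where y: "y \<in> pts ?Y" "x = f y" using f x unfolding bij_betw_def by blast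
    obtain g where g: "g \<in> carrier T" "y = g <#\<^bsub>T\<^esub> ?U"
      using y(1) unfolding trans_biset_def pts_coset_gset by blast
    have "(h, \<one>) \<in> stabilizer T (act X) x" using h fx by (simp add: stabilizer_def)
    also have "stabilizer T (act X) x = stabilizer T (act ?Y) y"
      unfolding y(2) by (rule stabilizer_iso[OF f eq trans_biset_gset[OF assms(1,2)] y(1)])
    also have "\<dots> = conj_set T g ?U"
      unfolding g(2) trans_biset_def by (rule T.stabilizer_coset[OF graphs_subgroup[OF U] g(1)])
    finally have "(h, \<one>) \<in> conj_set T g ?U" .
    moreover have "conj_set T g ?U \<in> graphs" by (rule graphs_conj[OF g(1) U])
    moreover have "(\<one>, \<one>) \<in> conj_set T g ?U"
      using subgroup.one_closed[OF graphs_subgroup[OF \<open>conj_set T g ?U \<in> graphs\<close>]] by simp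
    ultimately show "h = \<one>" by (metis graphs_single_valued)
  qed
qed

lemma keys_b: "Poly_Mapping.keys b \<subseteq> {iso_class T (trans_biset S S P \<phi>) | P \<phi>. sub P \<and> \<phi> \<in> mor P}"
proof
  fix c assume "c \<in> Poly_Mapping.keys b"
  then obtain P where P: "sub P" and "c \<in> Poly_Mapping.keys (\<Sum>\<phi>\<in>mor P.
      Poly_Mapping.single (iso_class T (trans_biset S S P \<phi>)) (q (twisted_diag P \<phi>)))"
    unfolding generator_def mor_def[symmetric] using Poly_Mapping.keys_sum by fastforce
  then obtain \<phi> where "\<phi> \<in> mor P" "c \<in> Poly_Mapping.keys
      (Poly_Mapping.single (iso_class T (trans_biset S S P \<phi>)) (q (twisted_diag P \<phi>)))"
    using Poly_Mapping.keys_sum by fastforce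
  then show "c \<in> {iso_class T (trans_biset S S P \<phi>) | P \<phi>. sub P \<and> \<phi> \<in> mor P}"
    using P by (auto split: if_splits)
qed

text \<open>\<open>generator q\<close> itself is a representative by left-free bisets, and every stabilizer has the
  identity in its domain, so that the number of points is the column sum at the trivial subgroup.\<close>

lemma b_augmentation: "augmentation S (burnside_class p T b) = 1"
proof -
  let ?h = "\<lambda>X :: ('a \<times> 'a, nat) gset. of_nat (card (pts X)) / of_nat (order S) :: rat"
  let ?A = "{a \<in> burnside_class p T b. \<forall>c\<in>Poly_Mapping.keys a. \<forall>X\<in>c. left_free S S X}"
  have triv: "sub {\<one>}" by (rule triv_subgroup)
  have one: "wsum T (\<lambda>U. 1 / of_nat (order S)) b = 1"
  proof -
    have "wsum T (\<lambda>U. 1 / of_nat (order S)) b = wsum T (\<lambda>U. 1 / of_nat (order S) * of_bool ({\<one>} \<subseteq> snd ` U)) b"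
    proof (rule wsum_generator_cong)
      fix U assume "U \<in> graphs"
      then have "\<one> \<in> snd ` U" using subgroup.one_closed[OF sub_snd[OF graphs_subgroup]] by blast
      then show "1 / of_nat (order S) = 1 / of_nat (order S) * (of_bool ({\<one>} \<subseteq> snd ` U) :: rat)" by simp
    qed
    also have "\<dots> = 1"
      unfolding wsum_linear(1) b_column_sum[OF triv] using finite_S one_closed by (auto simp: order_def card_eq_0_iff)
    finally show ?thesis .
  qed
  have "linear_ext ?h a = 1" if a: "a \<in> burnside_class p T b" for a
  proof -
    have "a \<in> formal_sums p T" using a by (simp add: mem_burnside_class)
    then have "linear_ext ?h a = wsum T (\<lambda>U. 1 / of_nat (order S)) a"
      by (rule linear_ext_cong) (simp add: stab_sum_def)
    then show ?thesis using wsum_burnside_class[OF a] one by simp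
  qed
  moreover have "b \<in> ?A"
    using burnside_class_self[OF b_formal] keys_b graph_biset_left_free by fastforce
  ultimately have "linear_ext ?h ` ?A = {1}" by force
  then show ?thesis unfolding augmentation_def by simp
qed

end

end

theorem proposition5p10:
  fixes p n :: nat
    and S :: "('a, 'm) monoid_scheme"
    and F :: "'a fusion"
    and \<beta> :: "('a \<times> 'a) formal_sum set"
  assumes "prime p"
    and "group S"
    and "order S = p ^ n"
    and "saturated p S F"
    and "\<beta> = stabilization p (S \<times>\<times> S) (product_fusion S F S (trivial_fusion S))
      (gset_class p (S \<times>\<times> S) (coset_gset (S \<times>\<times> S) {(s, s) | s. s \<in> carrier S}))"
  shows "augmentation S \<beta> = 1 \<and> characteristic_idempotent p S F \<beta>"
proof -
  have "finite (carrier S)"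
    using assms(1,3) prime_gt_0_nat by (intro card_ge_0_finite) (simp add: order_def)
  moreover have "fusion_system S F" using assms(4) by (simp add: saturated_def)
  ultimately interpret saturated_fusion S F p n
    using assms(1-4) by (simp add: saturated_fusion_def saturated_fusion_axioms_def fusion_def fusion_axioms_def)
  obtain q where q: "\<And>U. q U \<in> Z_loc p"
    "\<And>D. subgroup D T \<Longrightarrow> (\<Sum>U\<in>graphs. q U * mark U D) = target D"
    using realizable_target by metis
  have \<beta>: "\<beta> = burnside_class p T (generator q)"
    unfolding assms(5) by (rule stabilization_eq[OF q])
  have "\<beta> \<in> burnside p T" using b_formal[OF q] unfolding \<beta> burnside_iff by blast
  moreover have "1 \<in> Z_loc p" using assms(1) by simp
  ultimately show ?thesis
    unfolding characteristic_idempotent_def characteristic_def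
    using b_idempotent[OF q] b_generated[OF q] b_left_stable[OF q] b_right_stable[OF q] b_augmentation[OF q]
    by (auto simp: \<beta>)
qed

end
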